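(* The Gray tensor product equips $\mathbf{Gray}_{icon}$ with the structure of a strongly monoidal 2-category; that is, there is a strongly monoidal structure on $\mathbf{Gray}_{icon}$ whose tensor 2-functor $\mathbf{Gray}_{icon}\times\mathbf{Gray}_{icon}\to\mathbf{Gray}_{icon}$ is given on objects and 1-cells by the Gray tensor product of 2-categories and 2-functors, and whose unit is the terminal 2-category.
   Context: "Functor" between bicategories means pseudofunctor; "2-functor" means strict 2-functor; $*$ is horizontal composition. Let $F,G:B\to C$ be functors of bicategories with constraints $\varphi_0,\varphi_2$ and $\psi_0,\psi_2$, agreeing on objects. An icon $\alpha:F\Rightarrow G$ consists of natural transformations $\alpha_{ab}:F_{ab}\Rightarrow G_{ab}:B(a,b)\to C(Fa,Fb)$, i.e. 2-cells $\alpha_f:Ff\Rightarrow Gf$, such that $\alpha_{I_a}\varphi_0=\psi_0$ and $\alpha_{f*g}\varphi_2=\psi_2(\alpha_f*\alpha_g)$. $\mathbf{Gray}_{icon}$ is the 2-category of 2-categories, 2-functors, and icons. Gray tensor product: for 2-categories $A,B$, the 2-category $A\otimes B$ has objects $a\otimes b$; its 1-cells are generated by $f\otimes 1:a\otimes b\to a'\otimes b$ ($f:a\to a'$ in $A$, $b\in B$) and $1\otimes g:a\otimes b\to a\otimes b'$ ($a\in A$, $g:b\to b'$ in $B$); its 2-cells are generated by $\alpha\otimes1$, $1\otimes\beta$ ($\alpha,\beta$ 2-cells of $A,B$) and invertible $\Sigma_{f,g}:(f\otimes1)*(1\otimes g)\Rightarrow(1\otimes g)*(f\otimes1)$. Relations: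 $-\otimes b$ and $a\otimes-$ are 2-functors for all $a,b$; $\Sigma$ is natural in 2-cells of $f$ and $g$; $\Sigma_{1,g}$ and $\Sigma_{f,1}$ are identities; $\Sigma_{f'*f,g}=(\Sigma_{f',g}*1)(1*\Sigma_{f,g})$; $\Sigma_{f,g'*g}=(1*\Sigma_{f,g})(\Sigma_{f,g'}*1)$. For 2-functors $F,G$, the 2-functor $F\otimes G$ acts on generators in the evident way. It is known that this makes the ordinary category of 2-categories and 2-functors monoidal with unit the terminal 2-category. A strongly monoidal 2-category is a $\mathbf{Cat}$-enriched monoidal category: a 2-category $A$ with a 2-functor $\otimes:A\times A\to A$, an object $I$, and 2-natural isomorphisms $a_{x,y,z}:(x\otimes y)\otimes z\to x\otimes(y\otimes z)$, $l_x:I\otimes x\to x$, $r_x:x\otimes I\to x$ satisfying the usual monoidal category axioms (pentagon and triangle). *)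

theory Defs
  imports "HOL-Library.FuncSet"
begin

section \<open>Strict 2-categories\<close>

text \<open>Both composites of 1-cells and horizontal composites of 2-cells are written in applicative
  order: \<open>comp1 C f g\<close> and \<open>hcomp C \<alpha> \<beta>\<close> render \<open>f * g\<close> and \<open>\<alpha> * \<beta>\<close>, with \<open>g\<close> and \<open>\<beta>\<close> first;
  \<open>vcomp C \<alpha> \<beta>\<close> is the vertical composite, again with \<open>\<beta>\<close> first.\<close>

record ('o, 'm, 'c) twocat =
  Obj :: "'o set"
  Arr1 :: "'m set"
  Arr2 :: "'c set"
  src1 :: "'m \<Rightarrow> 'o"
  tgt1 :: "'m \<Rightarrow> 'o"
  src2 :: "'c \<Rightarrow> 'm"
  tgt2 :: "'c \<Rightarrow> 'm"
  id1 :: "'o \<Rightarrow> 'm"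
  comp1 :: "'m \<Rightarrow> 'm \<Rightarrow> 'm"
  id2 :: "'m \<Rightarrow> 'c"
  vcomp :: "'c \<Rightarrow> 'c \<Rightarrow> 'c"
  hcomp :: "'c \<Rightarrow> 'c \<Rightarrow> 'c"

locale two_category =
  fixes C :: "('o, 'm, 'c) twocat"
  assumes src1_in: "f \<in> Arr1 C \<Longrightarrow> src1 C f \<in> Obj C"
    and tgt1_in: "f \<in> Arr1 C \<Longrightarrow> tgt1 C f \<in> Obj C"
    and src2_in: "\<alpha> \<in> Arr2 C \<Longrightarrow> src2 C \<alpha> \<in> Arr1 C"
    and tgt2_in: "\<alpha> \<in> Arr2 C \<Longrightarrow> tgt2 C \<alpha> \<in> Arr1 C"
    and src1_tgt2: "\<alpha> \<in> Arr2 C \<Longrightarrow> src1 C (tgt2 C \<alpha>) = src1 C (src2 C \<alpha>)"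
    and tgt1_tgt2: "\<alpha> \<in> Arr2 C \<Longrightarrow> tgt1 C (tgt2 C \<alpha>) = tgt1 C (src2 C \<alpha>)"
    and id1: "x \<in> Obj C \<Longrightarrow> id1 C x \<in> Arr1 C \<and> src1 C (id1 C x) = x \<and> tgt1 C (id1 C x) = x"
    and comp1: "\<lbrakk>f \<in> Arr1 C; g \<in> Arr1 C; src1 C f = tgt1 C g\<rbrakk> \<Longrightarrow>
      comp1 C f g \<in> Arr1 C \<and> src1 C (comp1 C f g) = src1 C g \<and> tgt1 C (comp1 C f g) = tgt1 C f"
    and comp1_assoc: "\<lbrakk>f \<in> Arr1 C; g \<in> Arr1 C; h \<in> Arr1 C; src1 C f = tgt1 C g; src1 C g = tgt1 C h\<rbrakk> \<Longrightarrow>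
      comp1 C (comp1 C f g) h = comp1 C f (comp1 C g h)"
    and comp1_id1_left: "f \<in> Arr1 C \<Longrightarrow> comp1 C (id1 C (tgt1 C f)) f = f"
    and comp1_id1_right: "f \<in> Arr1 C \<Longrightarrow> comp1 C f (id1 C (src1 C f)) = f"
    and id2: "f \<in> Arr1 C \<Longrightarrow> id2 C f \<in> Arr2 C \<and> src2 C (id2 C f) = f \<and> tgt2 C (id2 C f) = f"
    and vcomp: "\<lbrakk>\<alpha> \<in> Arr2 C; \<beta> \<in> Arr2 C; src2 C \<alpha> = tgt2 C \<beta>\<rbrakk> \<Longrightarrow>
      vcomp C \<alpha> \<beta> \<in> Arr2 C \<and> src2 C (vcomp C \<alpha> \<beta>) = src2 C \<beta> \<and> tgt2 C (vcomp C \<alpha> \<beta>) = tgt2 C \<alpha>"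
    and vcomp_assoc: "\<lbrakk>\<alpha> \<in> Arr2 C; \<beta> \<in> Arr2 C; \<gamma> \<in> Arr2 C; src2 C \<alpha> = tgt2 C \<beta>; src2 C \<beta> = tgt2 C \<gamma>\<rbrakk> \<Longrightarrow>
      vcomp C (vcomp C \<alpha> \<beta>) \<gamma> = vcomp C \<alpha> (vcomp C \<beta> \<gamma>)"
    and vcomp_id2_left: "\<alpha> \<in> Arr2 C \<Longrightarrow> vcomp C (id2 C (tgt2 C \<alpha>)) \<alpha> = \<alpha>"
    and vcomp_id2_right: "\<alpha> \<in> Arr2 C \<Longrightarrow> vcomp C \<alpha> (id2 C (src2 C \<alpha>)) = \<alpha>"
    and hcomp: "\<lbrakk>\<alpha> \<in> Arr2 C; \<beta> \<in> Arr2 C; src1 C (src2 C \<alpha>) = tgt1 C (src2 C \<beta>)\<rbrakk> \<Longrightarrow>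
      hcomp C \<alpha> \<beta> \<in> Arr2 C \<and>
      src2 C (hcomp C \<alpha> \<beta>) = comp1 C (src2 C \<alpha>) (src2 C \<beta>) \<and>
      tgt2 C (hcomp C \<alpha> \<beta>) = comp1 C (tgt2 C \<alpha>) (tgt2 C \<beta>)"
    and hcomp_assoc: "\<lbrakk>\<alpha> \<in> Arr2 C; \<beta> \<in> Arr2 C; \<gamma> \<in> Arr2 C;
      src1 C (src2 C \<alpha>) = tgt1 C (src2 C \<beta>); src1 C (src2 C \<beta>) = tgt1 C (src2 C \<gamma>)\<rbrakk> \<Longrightarrow>
      hcomp C (hcomp C \<alpha> \<beta>) \<gamma> = hcomp C \<alpha> (hcomp C \<beta> \<gamma>)"
    and hcomp_id_left: "\<alpha> \<in> Arr2 C \<Longrightarrow> hcomp C (id2 C (id1 C (tgt1 C (src2 C \<alpha>)))) \<alpha> = \<alpha>"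
    and hcomp_id_right: "\<alpha> \<in> Arr2 C \<Longrightarrow> hcomp C \<alpha> (id2 C (id1 C (src1 C (src2 C \<alpha>)))) = \<alpha>"
    and hcomp_id2: "\<lbrakk>f \<in> Arr1 C; g \<in> Arr1 C; src1 C f = tgt1 C g\<rbrakk> \<Longrightarrow>
      hcomp C (id2 C f) (id2 C g) = id2 C (comp1 C f g)"
    and interchange: "\<lbrakk>\<alpha> \<in> Arr2 C; \<alpha>' \<in> Arr2 C; \<beta> \<in> Arr2 C; \<beta>' \<in> Arr2 C;
      src2 C \<alpha>' = tgt2 C \<alpha>; src2 C \<beta>' = tgt2 C \<beta>; src1 C (src2 C \<alpha>) = tgt1 C (src2 C \<beta>)\<rbrakk> \<Longrightarrow>
      hcomp C (vcomp C \<alpha>' \<alpha>) (vcomp C \<beta>' \<beta>) = vcomp C (hcomp C \<alpha>' \<beta>') (hcomp C \<alpha> \<beta>)"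

text \<open>The operations of a record are total functions, but a 2-category only determines them where
  they are defined. The following normalises the irrelevant values, so that two normalised
  records are equal exactly when they are the same 2-category.\<close>

definition restrict_twocat :: "('o, 'm, 'c) twocat \<Rightarrow> ('o, 'm, 'c) twocat" where
  "restrict_twocat C = \<lparr>
     Obj = Obj C, Arr1 = Arr1 C, Arr2 = Arr2 C,
     src1 = restrict (src1 C) (Arr1 C), tgt1 = restrict (tgt1 C) (Arr1 C),
     src2 = restrict (src2 C) (Arr2 C), tgt2 = restrict (tgt2 C) (Arr2 C),
     id1 = restrict (id1 C) (Obj C),
     comp1 = (\<lambda>f g. if f \<in> Arr1 C \<and> g \<in> Arr1 C \<and> src1 C f = tgt1 C g then comp1 C f g else undefined),
     id2 = restrict (id2 C) (Arr1 C),
     vcomp = (\<lambda>\<alpha> \<beta>. if \<alpha> \<in> Arr2 C \<and> \<beta> \<in> Arr2 C \<and> src2 C \<alpha> = tgt2 C \<beta> then vcomp C \<alpha> \<beta> else undefined),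
     hcomp = (\<lambda>\<alpha> \<beta>. if \<alpha> \<in> Arr2 C \<and> \<beta> \<in> Arr2 C \<and> src1 C (src2 C \<alpha>) = tgt1 C (src2 C \<beta>)
                     then hcomp C \<alpha> \<beta> else undefined)\<rparr>"

definition prod_twocat ::
  "('o, 'm, 'c) twocat \<Rightarrow> ('p, 'n, 'd) twocat \<Rightarrow> ('o \<times> 'p, 'm \<times> 'n, 'c \<times> 'd) twocat" where
  "prod_twocat A B = \<lparr>
     Obj = Obj A \<times> Obj B, Arr1 = Arr1 A \<times> Arr1 B, Arr2 = Arr2 A \<times> Arr2 B,
     src1 = map_prod (src1 A) (src1 B), tgt1 = map_prod (tgt1 A) (tgt1 B),
     src2 = map_prod (src2 A) (src2 B), tgt2 = map_prod (tgt2 A) (tgt2 B),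
     id1 = map_prod (id1 A) (id1 B),
     comp1 = (\<lambda>(f, g) (f', g'). (comp1 A f f', comp1 B g g')),
     id2 = map_prod (id2 A) (id2 B),
     vcomp = (\<lambda>(\<alpha>, \<beta>) (\<alpha>', \<beta>'). (vcomp A \<alpha> \<alpha>', vcomp B \<beta> \<beta>')),
     hcomp = (\<lambda>(\<alpha>, \<beta>) (\<alpha>', \<beta>'). (hcomp A \<alpha> \<alpha>', hcomp B \<beta> \<beta>'))\<rparr>"


section \<open>2-functors and 2-natural transformations\<close>

record ('o, 'm, 'c, 'p, 'n, 'd) twofun =
  Dom :: "('o, 'm, 'c) twocat"
  Cod :: "('p, 'n, 'd) twocat"
  map0 :: "'o \<Rightarrow> 'p"
  map1 :: "'m \<Rightarrow> 'n"
  map2 :: "'c \<Rightarrow> 'd"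

text \<open>The maps are extensional, so that equality of records is equality of 2-functors.\<close>

locale two_functor =
  A: two_category "Dom F" + B: two_category "Cod F"
  for F :: "('o, 'm, 'c, 'p, 'n, 'd) twofun" +
  assumes map0_in: "map0 F \<in> Obj (Dom F) \<rightarrow>\<^sub>E Obj (Cod F)"
    and map1_in: "map1 F \<in> Arr1 (Dom F) \<rightarrow>\<^sub>E Arr1 (Cod F)"
    and map2_in: "map2 F \<in> Arr2 (Dom F) \<rightarrow>\<^sub>E Arr2 (Cod F)"
    and map_src1: "f \<in> Arr1 (Dom F) \<Longrightarrow> src1 (Cod F) (map1 F f) = map0 F (src1 (Dom F) f)"
    and map_tgt1: "f \<in> Arr1 (Dom F) \<Longrightarrow> tgt1 (Cod F) (map1 F f) = map0 F (tgt1 (Dom F) f)"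
    and map_src2: "\<alpha> \<in> Arr2 (Dom F) \<Longrightarrow> src2 (Cod F) (map2 F \<alpha>) = map1 F (src2 (Dom F) \<alpha>)"
    and map_tgt2: "\<alpha> \<in> Arr2 (Dom F) \<Longrightarrow> tgt2 (Cod F) (map2 F \<alpha>) = map1 F (tgt2 (Dom F) \<alpha>)"
    and map_id1: "x \<in> Obj (Dom F) \<Longrightarrow> map1 F (id1 (Dom F) x) = id1 (Cod F) (map0 F x)"
    and map_comp1: "\<lbrakk>f \<in> Arr1 (Dom F); g \<in> Arr1 (Dom F); src1 (Dom F) f = tgt1 (Dom F) g\<rbrakk> \<Longrightarrow>
      map1 F (comp1 (Dom F) f g) = comp1 (Cod F) (map1 F f) (map1 F g)"
    and map_id2: "f \<in> Arr1 (Dom F) \<Longrightarrow> map2 F (id2 (Dom F) f) = id2 (Cod F) (map1 F f)"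
    and map_vcomp: "\<lbrakk>\<alpha> \<in> Arr2 (Dom F); \<beta> \<in> Arr2 (Dom F); src2 (Dom F) \<alpha> = tgt2 (Dom F) \<beta>\<rbrakk> \<Longrightarrow>
      map2 F (vcomp (Dom F) \<alpha> \<beta>) = vcomp (Cod F) (map2 F \<alpha>) (map2 F \<beta>)"
    and map_hcomp: "\<lbrakk>\<alpha> \<in> Arr2 (Dom F); \<beta> \<in> Arr2 (Dom F);
        src1 (Dom F) (src2 (Dom F) \<alpha>) = tgt1 (Dom F) (src2 (Dom F) \<beta>)\<rbrakk> \<Longrightarrow>
      map2 F (hcomp (Dom F) \<alpha> \<beta>) = hcomp (Cod F) (map2 F \<alpha>) (map2 F \<beta>)"

definition id_fun :: "('o, 'm, 'c) twocat \<Rightarrow> ('o, 'm, 'c, 'o, 'm, 'c) twofun" where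
  "id_fun A = \<lparr>Dom = A, Cod = A,
     map0 = (\<lambda>x\<in>Obj A. x), map1 = (\<lambda>f\<in>Arr1 A. f), map2 = (\<lambda>\<alpha>\<in>Arr2 A. \<alpha>)\<rparr>"

definition comp_fun ::
  "('p, 'n, 'd, 'q, 'l, 'e) twofun \<Rightarrow> ('o, 'm, 'c, 'p, 'n, 'd) twofun \<Rightarrow> ('o, 'm, 'c, 'q, 'l, 'e) twofun" where
  "comp_fun G F = \<lparr>Dom = Dom F, Cod = Cod G,
     map0 = compose (Obj (Dom F)) (map0 G) (map0 F),
     map1 = compose (Arr1 (Dom F)) (map1 G) (map1 F),
     map2 = compose (Arr2 (Dom F)) (map2 G) (map2 F)\<rparr>"

definition const_fun ::
  "('o, 'm, 'c) twocat \<Rightarrow> ('p, 'n, 'd) twocat \<Rightarrow> 'p \<Rightarrow> ('o, 'm, 'c, 'p, 'n, 'd) twofun" where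
  "const_fun A B y = \<lparr>Dom = A, Cod = B,
     map0 = (\<lambda>_\<in>Obj A. y), map1 = (\<lambda>_\<in>Arr1 A. id1 B y), map2 = (\<lambda>_\<in>Arr2 A. id2 B (id1 B y))\<rparr>"

definition fst_fun ::
  "('o, 'm, 'c) twocat \<Rightarrow> ('p, 'n, 'd) twocat \<Rightarrow> ('o \<times> 'p, 'm \<times> 'n, 'c \<times> 'd, 'o, 'm, 'c) twofun" where
  "fst_fun A B = \<lparr>Dom = prod_twocat A B, Cod = A,
     map0 = restrict fst (Obj A \<times> Obj B), map1 = restrict fst (Arr1 A \<times> Arr1 B),
     map2 = restrict fst (Arr2 A \<times> Arr2 B)\<rparr>"

definition snd_fun ::
  "('o, 'm, 'c) twocat \<Rightarrow> ('p, 'n, 'd) twocat \<Rightarrow> ('o \<times> 'p, 'm \<times> 'n, 'c \<times> 'd, 'p, 'n, 'd) twofun" where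
  "snd_fun A B = \<lparr>Dom = prod_twocat A B, Cod = B,
     map0 = restrict snd (Obj A \<times> Obj B), map1 = restrict snd (Arr1 A \<times> Arr1 B),
     map2 = restrict snd (Arr2 A \<times> Arr2 B)\<rparr>"

definition pair_fun ::
  "('o, 'm, 'c, 'p, 'n, 'd) twofun \<Rightarrow> ('o, 'm, 'c, 'q, 'l, 'e) twofun \<Rightarrow>
   ('o, 'm, 'c, 'p \<times> 'q, 'n \<times> 'l, 'd \<times> 'e) twofun" where
  "pair_fun F G = \<lparr>Dom = Dom F, Cod = prod_twocat (Cod F) (Cod G),
     map0 = (\<lambda>x\<in>Obj (Dom F). (map0 F x, map0 G x)),
     map1 = (\<lambda>f\<in>Arr1 (Dom F). (map1 F f, map1 G f)),
     map2 = (\<lambda>\<alpha>\<in>Arr2 (Dom F). (map2 F \<alpha>, map2 G \<alpha>))\<rparr>"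

definition prod_fun ::
  "('o, 'm, 'c, 'p, 'n, 'd) twofun \<Rightarrow> ('o', 'm', 'c', 'p', 'n', 'd') twofun \<Rightarrow>
   ('o \<times> 'o', 'm \<times> 'm', 'c \<times> 'c', 'p \<times> 'p', 'n \<times> 'n', 'd \<times> 'd') twofun" where
  "prod_fun F G =
     pair_fun (comp_fun F (fst_fun (Dom F) (Dom G))) (comp_fun G (snd_fun (Dom F) (Dom G)))"

text \<open>The canonical isomorphism from \<open>(A \<times> B) \<times> C\<close> to \<open>A \<times> (B \<times> C)\<close>.\<close>

definition assoc_fun ::
  "('o, 'm, 'c) twocat \<Rightarrow> ('p, 'n, 'd) twocat \<Rightarrow> ('q, 'l, 'e) twocat \<Rightarrow>
   (('o \<times> 'p) \<times> 'q, ('m \<times> 'n) \<times> 'l, ('c \<times> 'd) \<times> 'e,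
    'o \<times> ('p \<times> 'q), 'm \<times> ('n \<times> 'l), 'c \<times> ('d \<times> 'e)) twofun" where
  "assoc_fun A B C =
     (let p = fst_fun (prod_twocat A B) C
      in pair_fun (comp_fun (fst_fun A B) p)
           (pair_fun (comp_fun (snd_fun A B) p) (snd_fun (prod_twocat A B) C)))"

locale two_natural =
  F: two_functor F + G: two_functor G
  for F G :: "('o, 'm, 'c, 'p, 'n, 'd) twofun" +
  fixes \<tau> :: "'o \<Rightarrow> 'n"
  assumes same_Dom: "Dom G = Dom F"
    and same_Cod: "Cod G = Cod F"
    and component: "x \<in> Obj (Dom F) \<Longrightarrow>
      \<tau> x \<in> Arr1 (Cod F) \<and> src1 (Cod F) (\<tau> x) = map0 F x \<and> tgt1 (Cod F) (\<tau> x) = map0 G x"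
    and natural1: "f \<in> Arr1 (Dom F) \<Longrightarrow>
      comp1 (Cod F) (map1 G f) (\<tau> (src1 (Dom F) f)) = comp1 (Cod F) (\<tau> (tgt1 (Dom F) f)) (map1 F f)"
    and natural2: "\<theta> \<in> Arr2 (Dom F) \<Longrightarrow>
      hcomp (Cod F) (map2 G \<theta>) (id2 (Cod F) (\<tau> (src1 (Dom F) (src2 (Dom F) \<theta>)))) =
      hcomp (Cod F) (id2 (Cod F) (\<tau> (tgt1 (Dom F) (src2 (Dom F) \<theta>)))) (map2 F \<theta>)"

definition two_natural_iso ::
  "('o, 'm, 'c, 'p, 'n, 'd) twofun \<Rightarrow> ('o, 'm, 'c, 'p, 'n, 'd) twofun \<Rightarrow> ('o \<Rightarrow> 'n) \<Rightarrow> bool" where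
  "two_natural_iso F G \<tau> \<longleftrightarrow> two_natural F G \<tau> \<and>
     (\<exists>\<sigma>. two_natural G F \<sigma> \<and>
       (\<forall>x\<in>Obj (Dom F). comp1 (Cod F) (\<sigma> x) (\<tau> x) = id1 (Cod F) (map0 F x) \<and>
                         comp1 (Cod F) (\<tau> x) (\<sigma> x) = id1 (Cod F) (map0 G x)))"


section \<open>Strongly monoidal 2-categories\<close>

locale strongly_monoidal_two_category = two_category V
  for V :: "('o, 'm, 'c) twocat" +
  fixes T :: "('o \<times> 'o, 'm \<times> 'm, 'c \<times> 'c, 'o, 'm, 'c) twofun"
    and I :: 'o
    and a :: "'o \<Rightarrow> 'o \<Rightarrow> 'o \<Rightarrow> 'm"
    and l :: "'o \<Rightarrow> 'm"
    and r :: "'o \<Rightarrow> 'm"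
  assumes tensor: "two_functor T" "Dom T = prod_twocat V V" "Cod T = V"
    and unit: "I \<in> Obj V"
    and associator: "two_natural_iso
      (comp_fun T (prod_fun T (id_fun V)))
      (comp_fun T (comp_fun (prod_fun (id_fun V) T) (assoc_fun V V V)))
      (\<lambda>((x, y), z). a x y z)"
    and left_unitor: "two_natural_iso
      (comp_fun T (pair_fun (const_fun V V I) (id_fun V))) (id_fun V) l"
    and right_unitor: "two_natural_iso
      (comp_fun T (pair_fun (id_fun V) (const_fun V V I))) (id_fun V) r"
    and pentagon: "\<lbrakk>w \<in> Obj V; x \<in> Obj V; y \<in> Obj V; z \<in> Obj V\<rbrakk> \<Longrightarrow>
      comp1 V (a w x (map0 T (y, z))) (a (map0 T (w, x)) y z) =
      comp1 V (map1 T (id1 V w, a x y z))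
        (comp1 V (a w (map0 T (x, y)) z) (map1 T (a w x y, id1 V z)))"
    and triangle: "\<lbrakk>x \<in> Obj V; y \<in> Obj V\<rbrakk> \<Longrightarrow>
      comp1 V (map1 T (id1 V x, l y)) (a x I y) = map1 T (r x, id1 V y)"


section \<open>Icons between 2-functors\<close>

record ('o, 'm, 'c, 'p, 'n, 'd) icon =
  iDom :: "('o, 'm, 'c, 'p, 'n, 'd) twofun"
  iCod :: "('o, 'm, 'c, 'p, 'n, 'd) twofun"
  icomp :: "'m \<Rightarrow> 'd"

text \<open>The constraints \<open>\<phi>\<^sub>0, \<phi>\<^sub>2, \<psi>\<^sub>0, \<psi>\<^sub>2\<close> of 2-functors are identities, which reduces the two icon
  axioms to \<open>icon_id1\<close> and \<open>icon_comp1\<close>.\<close>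

locale is_icon =
  F: two_functor "iDom \<alpha>" + G: two_functor "iCod \<alpha>"
  for \<alpha> :: "('o, 'm, 'c, 'p, 'n, 'd) icon" +
  assumes same_Dom: "Dom (iCod \<alpha>) = Dom (iDom \<alpha>)"
    and same_Cod: "Cod (iCod \<alpha>) = Cod (iDom \<alpha>)"
    and same_map0: "map0 (iCod \<alpha>) = map0 (iDom \<alpha>)"
    and icomp_in: "icomp \<alpha> \<in> Arr1 (Dom (iDom \<alpha>)) \<rightarrow>\<^sub>E Arr2 (Cod (iDom \<alpha>))"
    and icomp_src2: "f \<in> Arr1 (Dom (iDom \<alpha>)) \<Longrightarrow> src2 (Cod (iDom \<alpha>)) (icomp \<alpha> f) = map1 (iDom \<alpha>) f"
    and icomp_tgt2: "f \<in> Arr1 (Dom (iDom \<alpha>)) \<Longrightarrow> tgt2 (Cod (iDom \<alpha>)) (icomp \<alpha> f) = map1 (iCod \<alpha>) f"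
    and icon_natural: "\<theta> \<in> Arr2 (Dom (iDom \<alpha>)) \<Longrightarrow>
      vcomp (Cod (iDom \<alpha>)) (icomp \<alpha> (tgt2 (Dom (iDom \<alpha>)) \<theta>)) (map2 (iDom \<alpha>) \<theta>) =
      vcomp (Cod (iDom \<alpha>)) (map2 (iCod \<alpha>) \<theta>) (icomp \<alpha> (src2 (Dom (iDom \<alpha>)) \<theta>))"
    and icon_id1: "x \<in> Obj (Dom (iDom \<alpha>)) \<Longrightarrow>
      icomp \<alpha> (id1 (Dom (iDom \<alpha>)) x) = id2 (Cod (iDom \<alpha>)) (id1 (Cod (iDom \<alpha>)) (map0 (iDom \<alpha>) x))"
    and icon_comp1: "\<lbrakk>f \<in> Arr1 (Dom (iDom \<alpha>)); g \<in> Arr1 (Dom (iDom \<alpha>));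
        src1 (Dom (iDom \<alpha>)) f = tgt1 (Dom (iDom \<alpha>)) g\<rbrakk> \<Longrightarrow>
      icomp \<alpha> (comp1 (Dom (iDom \<alpha>)) f g) = hcomp (Cod (iDom \<alpha>)) (icomp \<alpha> f) (icomp \<alpha> g)"

definition id_icon :: "('o, 'm, 'c, 'p, 'n, 'd) twofun \<Rightarrow> ('o, 'm, 'c, 'p, 'n, 'd) icon" where
  "id_icon F = \<lparr>iDom = F, iCod = F, icomp = (\<lambda>f\<in>Arr1 (Dom F). id2 (Cod F) (map1 F f))\<rparr>"

definition vcomp_icon ::
  "('o, 'm, 'c, 'p, 'n, 'd) icon \<Rightarrow> ('o, 'm, 'c, 'p, 'n, 'd) icon \<Rightarrow> ('o, 'm, 'c, 'p, 'n, 'd) icon" where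
  "vcomp_icon \<beta> \<alpha> = \<lparr>iDom = iDom \<alpha>, iCod = iCod \<beta>,
     icomp = (\<lambda>f\<in>Arr1 (Dom (iDom \<alpha>)). vcomp (Cod (iDom \<alpha>)) (icomp \<beta> f) (icomp \<alpha> f))\<rparr>"

text \<open>For \<open>\<alpha> : F \<Rightarrow> G\<close> and \<open>\<beta> : H \<Rightarrow> K\<close>, the component of \<open>\<beta> * \<alpha>\<close> at \<open>f\<close> is \<open>\<beta>\<close> at \<open>G f\<close> after \<open>H\<close> applied to
  the component of \<open>\<alpha>\<close> at \<open>f\<close>.\<close>

definition hcomp_icon ::
  "('p, 'n, 'd, 'q, 'l, 'e) icon \<Rightarrow> ('o, 'm, 'c, 'p, 'n, 'd) icon \<Rightarrow> ('o, 'm, 'c, 'q, 'l, 'e) icon" where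
  "hcomp_icon \<beta> \<alpha> = \<lparr>iDom = comp_fun (iDom \<beta>) (iDom \<alpha>), iCod = comp_fun (iCod \<beta>) (iCod \<alpha>),
     icomp = (\<lambda>f\<in>Arr1 (Dom (iDom \<alpha>)).
       vcomp (Cod (iDom \<beta>)) (icomp \<beta> (map1 (iCod \<alpha>) f)) (map2 (iDom \<beta>) (icomp \<alpha> f)))\<rparr>"


section \<open>The 2-category of 2-categories, 2-functors and icons\<close>

text \<open>A type \<open>'u\<close> plays the role of a universe: the small 2-categories are those whose objects,
  1-cells and 2-cells are elements of \<open>'u\<close>.\<close>

type_synonym 'u cat2 = "('u, 'u, 'u) twocat"
type_synonym 'u fun2 = "('u, 'u, 'u, 'u, 'u, 'u) twofun"
type_synonym 'u icon2 = "('u, 'u, 'u, 'u, 'u, 'u) icon"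

definition gray_icon :: "('u cat2, 'u fun2, 'u icon2) twocat" where
  "gray_icon =
     (let cats = {A. two_category A \<and> restrict_twocat A = A};
          funs = {F. two_functor F \<and> Dom F \<in> cats \<and> Cod F \<in> cats}
      in \<lparr>Obj = cats, Arr1 = funs,
          Arr2 = {\<alpha>. is_icon \<alpha> \<and> iDom \<alpha> \<in> funs \<and> iCod \<alpha> \<in> funs},
          src1 = Dom, tgt1 = Cod, src2 = iDom, tgt2 = iCod,
          id1 = id_fun, comp1 = comp_fun, id2 = id_icon,
          vcomp = vcomp_icon, hcomp = hcomp_icon\<rparr>)"


section \<open>Expressions for the cells of the Gray tensor product\<close>

text \<open>\<open>LGen f b\<close> and \<open>RGen a g\<close> stand for the generating 1-cells \<open>f \<otimes> 1 : a \<otimes> b \<rightarrow> a' \<otimes> b\<close> and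
  \<open>1 \<otimes> g : a \<otimes> b \<rightarrow> a \<otimes> b'\<close>; likewise \<open>LCell \<alpha> b\<close> and \<open>RCell a \<beta>\<close> for \<open>\<alpha> \<otimes> 1\<close> and \<open>1 \<otimes> \<beta>\<close>.
  \<open>SigInv f g\<close> is the formal inverse of \<open>Sig f g\<close>.\<close>

datatype 'u gexp1 =
    LGen 'u 'u
  | RGen 'u 'u
  | IdE 'u 'u
  | CompE "'u gexp1" "'u gexp1"

datatype 'u gexp2 =
    LCell 'u 'u
  | RCell 'u 'u
  | Sig 'u 'u
  | SigInv 'u 'u
  | IdC "'u gexp1"
  | VComp "'u gexp2" "'u gexp2"
  | HComp "'u gexp2" "'u gexp2"

primrec esrc :: "'u cat2 \<Rightarrow> 'u cat2 \<Rightarrow> 'u gexp1 \<Rightarrow> 'u \<times> 'u" where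
  "esrc A B (LGen f b) = (src1 A f, b)"
| "esrc A B (RGen a g) = (a, src1 B g)"
| "esrc A B (IdE a b) = (a, b)"
| "esrc A B (CompE d e) = esrc A B e"

primrec etgt :: "'u cat2 \<Rightarrow> 'u cat2 \<Rightarrow> 'u gexp1 \<Rightarrow> 'u \<times> 'u" where
  "etgt A B (LGen f b) = (tgt1 A f, b)"
| "etgt A B (RGen a g) = (a, tgt1 B g)"
| "etgt A B (IdE a b) = (a, b)"
| "etgt A B (CompE d e) = etgt A B d"

primrec wf1 :: "'u cat2 \<Rightarrow> 'u cat2 \<Rightarrow> 'u gexp1 \<Rightarrow> bool" where
  "wf1 A B (LGen f b) \<longleftrightarrow> f \<in> Arr1 A \<and> b \<in> Obj B"
| "wf1 A B (RGen a g) \<longleftrightarrow> a \<in> Obj A \<and> g \<in> Arr1 B"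
| "wf1 A B (IdE a b) \<longleftrightarrow> a \<in> Obj A \<and> b \<in> Obj B"
| "wf1 A B (CompE d e) \<longleftrightarrow> wf1 A B d \<and> wf1 A B e \<and> esrc A B d = etgt A B e"

inductive eq1 :: "'u cat2 \<Rightarrow> 'u cat2 \<Rightarrow> 'u gexp1 \<Rightarrow> 'u gexp1 \<Rightarrow> bool" for A B where
  eq1_refl: "wf1 A B e \<Longrightarrow> eq1 A B e e"
| eq1_sym: "eq1 A B d e \<Longrightarrow> eq1 A B e d"
| eq1_trans: "\<lbrakk>eq1 A B c d; eq1 A B d e\<rbrakk> \<Longrightarrow> eq1 A B c e"
| eq1_cong: "\<lbrakk>eq1 A B d d'; eq1 A B e e'; esrc A B d = etgt A B e\<rbrakk> \<Longrightarrow>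
    eq1 A B (CompE d e) (CompE d' e')"
| eq1_assoc: "wf1 A B (CompE (CompE c d) e) \<Longrightarrow> eq1 A B (CompE (CompE c d) e) (CompE c (CompE d e))"
| eq1_id_left: "\<lbrakk>wf1 A B e; etgt A B e = (a, b)\<rbrakk> \<Longrightarrow> eq1 A B (CompE (IdE a b) e) e"
| eq1_id_right: "\<lbrakk>wf1 A B e; esrc A B e = (a, b)\<rbrakk> \<Longrightarrow> eq1 A B (CompE e (IdE a b)) e"
| eq1_L_id: "\<lbrakk>a \<in> Obj A; b \<in> Obj B\<rbrakk> \<Longrightarrow> eq1 A B (LGen (id1 A a) b) (IdE a b)"
| eq1_L_comp: "\<lbrakk>f \<in> Arr1 A; f' \<in> Arr1 A; src1 A f' = tgt1 A f; b \<in> Obj B\<rbrakk> \<Longrightarrow>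
    eq1 A B (LGen (comp1 A f' f) b) (CompE (LGen f' b) (LGen f b))"
| eq1_R_id: "\<lbrakk>a \<in> Obj A; b \<in> Obj B\<rbrakk> \<Longrightarrow> eq1 A B (RGen a (id1 B b)) (IdE a b)"
| eq1_R_comp: "\<lbrakk>a \<in> Obj A; g \<in> Arr1 B; g' \<in> Arr1 B; src1 B g' = tgt1 B g\<rbrakk> \<Longrightarrow>
    eq1 A B (RGen a (comp1 B g' g)) (CompE (RGen a g') (RGen a g))"

primrec edom :: "'u cat2 \<Rightarrow> 'u cat2 \<Rightarrow> 'u gexp2 \<Rightarrow> 'u gexp1" where
  "edom A B (LCell \<alpha> b) = LGen (src2 A \<alpha>) b"
| "edom A B (RCell a \<beta>) = RGen a (src2 B \<beta>)"
| "edom A B (Sig f g) = CompE (LGen f (tgt1 B g)) (RGen (src1 A f) g)"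
| "edom A B (SigInv f g) = CompE (RGen (tgt1 A f) g) (LGen f (src1 B g))"
| "edom A B (IdC e) = e"
| "edom A B (VComp s t) = edom A B t"
| "edom A B (HComp s t) = CompE (edom A B s) (edom A B t)"

primrec ecod :: "'u cat2 \<Rightarrow> 'u cat2 \<Rightarrow> 'u gexp2 \<Rightarrow> 'u gexp1" where
  "ecod A B (LCell \<alpha> b) = LGen (tgt2 A \<alpha>) b"
| "ecod A B (RCell a \<beta>) = RGen a (tgt2 B \<beta>)"
| "ecod A B (Sig f g) = CompE (RGen (tgt1 A f) g) (LGen f (src1 B g))"
| "ecod A B (SigInv f g) = CompE (LGen f (tgt1 B g)) (RGen (src1 A f) g)"
| "ecod A B (IdC e) = e"
| "ecod A B (VComp s t) = ecod A B s"
| "ecod A B (HComp s t) = CompE (ecod A B s) (ecod A B t)"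

text \<open>Vertical composability is tested up to \<open>eq1\<close>, since 1-cells are expressions modulo \<open>eq1\<close>.\<close>

primrec wf2 :: "'u cat2 \<Rightarrow> 'u cat2 \<Rightarrow> 'u gexp2 \<Rightarrow> bool" where
  "wf2 A B (LCell \<alpha> b) \<longleftrightarrow> \<alpha> \<in> Arr2 A \<and> b \<in> Obj B"
| "wf2 A B (RCell a \<beta>) \<longleftrightarrow> a \<in> Obj A \<and> \<beta> \<in> Arr2 B"
| "wf2 A B (Sig f g) \<longleftrightarrow> f \<in> Arr1 A \<and> g \<in> Arr1 B"
| "wf2 A B (SigInv f g) \<longleftrightarrow> f \<in> Arr1 A \<and> g \<in> Arr1 B"
| "wf2 A B (IdC e) \<longleftrightarrow> wf1 A B e"
| "wf2 A B (VComp s t) \<longleftrightarrow> wf2 A B s \<and> wf2 A B t \<and> eq1 A B (edom A B s) (ecod A B t)"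
| "wf2 A B (HComp s t) \<longleftrightarrow> wf2 A B s \<and> wf2 A B t \<and>
     esrc A B (edom A B s) = etgt A B (edom A B t)"

text \<open>The rules up to \<open>eq2_interchange\<close> impose the axioms of a 2-category, those up to
  \<open>eq2_R_hcomp\<close> that \<open>- \<otimes> b\<close> and \<open>a \<otimes> -\<close> are 2-functors, the rest the relations for \<open>\<Sigma>\<close>.\<close>

inductive eq2 :: "'u cat2 \<Rightarrow> 'u cat2 \<Rightarrow> 'u gexp2 \<Rightarrow> 'u gexp2 \<Rightarrow> bool" for A B where
  eq2_refl: "wf2 A B t \<Longrightarrow> eq2 A B t t"
| eq2_sym: "eq2 A B s t \<Longrightarrow> eq2 A B t s"
| eq2_trans: "\<lbrakk>eq2 A B s t; eq2 A B t u\<rbrakk> \<Longrightarrow> eq2 A B s u"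
| eq2_id_cong: "eq1 A B d e \<Longrightarrow> eq2 A B (IdC d) (IdC e)"
| eq2_vcomp_cong: "\<lbrakk>eq2 A B s s'; eq2 A B t t'; eq1 A B (edom A B s) (ecod A B t)\<rbrakk> \<Longrightarrow>
    eq2 A B (VComp s t) (VComp s' t')"
| eq2_hcomp_cong: "\<lbrakk>eq2 A B s s'; eq2 A B t t'; esrc A B (edom A B s) = etgt A B (edom A B t)\<rbrakk> \<Longrightarrow>
    eq2 A B (HComp s t) (HComp s' t')"
| eq2_vcomp_assoc: "wf2 A B (VComp (VComp s t) u) \<Longrightarrow>
    eq2 A B (VComp (VComp s t) u) (VComp s (VComp t u))"
| eq2_vcomp_id_left: "wf2 A B t \<Longrightarrow> eq2 A B (VComp (IdC (ecod A B t)) t) t"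
| eq2_vcomp_id_right: "wf2 A B t \<Longrightarrow> eq2 A B (VComp t (IdC (edom A B t))) t"
| eq2_hcomp_assoc: "wf2 A B (HComp (HComp s t) u) \<Longrightarrow>
    eq2 A B (HComp (HComp s t) u) (HComp s (HComp t u))"
| eq2_hcomp_id_left: "\<lbrakk>wf2 A B t; etgt A B (edom A B t) = (a, b)\<rbrakk> \<Longrightarrow>
    eq2 A B (HComp (IdC (IdE a b)) t) t"
| eq2_hcomp_id_right: "\<lbrakk>wf2 A B t; esrc A B (edom A B t) = (a, b)\<rbrakk> \<Longrightarrow>
    eq2 A B (HComp t (IdC (IdE a b))) t"
| eq2_hcomp_id: "wf1 A B (CompE d e) \<Longrightarrow> eq2 A B (HComp (IdC d) (IdC e)) (IdC (CompE d e))"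
| eq2_interchange: "\<lbrakk>wf2 A B (VComp s' s); wf2 A B (VComp t' t); wf2 A B (HComp s t)\<rbrakk> \<Longrightarrow>
    eq2 A B (HComp (VComp s' s) (VComp t' t)) (VComp (HComp s' t') (HComp s t))"
| eq2_L_id: "\<lbrakk>f \<in> Arr1 A; b \<in> Obj B\<rbrakk> \<Longrightarrow> eq2 A B (LCell (id2 A f) b) (IdC (LGen f b))"
| eq2_L_vcomp: "\<lbrakk>\<alpha> \<in> Arr2 A; \<alpha>' \<in> Arr2 A; src2 A \<alpha>' = tgt2 A \<alpha>; b \<in> Obj B\<rbrakk> \<Longrightarrow>
    eq2 A B (LCell (vcomp A \<alpha>' \<alpha>) b) (VComp (LCell \<alpha>' b) (LCell \<alpha> b))"
| eq2_L_hcomp: "\<lbrakk>\<alpha> \<in> Arr2 A; \<alpha>' \<in> Arr2 A; src1 A (src2 A \<alpha>') = tgt1 A (src2 A \<alpha>); b \<in> Obj B\<rbrakk> \<Longrightarrow>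
    eq2 A B (LCell (hcomp A \<alpha>' \<alpha>) b) (HComp (LCell \<alpha>' b) (LCell \<alpha> b))"
| eq2_R_id: "\<lbrakk>a \<in> Obj A; g \<in> Arr1 B\<rbrakk> \<Longrightarrow> eq2 A B (RCell a (id2 B g)) (IdC (RGen a g))"
| eq2_R_vcomp: "\<lbrakk>a \<in> Obj A; \<beta> \<in> Arr2 B; \<beta>' \<in> Arr2 B; src2 B \<beta>' = tgt2 B \<beta>\<rbrakk> \<Longrightarrow>
    eq2 A B (RCell a (vcomp B \<beta>' \<beta>)) (VComp (RCell a \<beta>') (RCell a \<beta>))"
| eq2_R_hcomp: "\<lbrakk>a \<in> Obj A; \<beta> \<in> Arr2 B; \<beta>' \<in> Arr2 B; src1 B (src2 B \<beta>') = tgt1 B (src2 B \<beta>)\<rbrakk> \<Longrightarrow>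
    eq2 A B (RCell a (hcomp B \<beta>' \<beta>)) (HComp (RCell a \<beta>') (RCell a \<beta>))"
| eq2_Sig_inv_right: "\<lbrakk>f \<in> Arr1 A; g \<in> Arr1 B\<rbrakk> \<Longrightarrow>
    eq2 A B (VComp (Sig f g) (SigInv f g)) (IdC (CompE (RGen (tgt1 A f) g) (LGen f (src1 B g))))"
| eq2_Sig_inv_left: "\<lbrakk>f \<in> Arr1 A; g \<in> Arr1 B\<rbrakk> \<Longrightarrow>
    eq2 A B (VComp (SigInv f g) (Sig f g)) (IdC (CompE (LGen f (tgt1 B g)) (RGen (src1 A f) g)))"
| eq2_Sig_natural: "\<lbrakk>\<alpha> \<in> Arr2 A; \<beta> \<in> Arr2 B;
      src2 A \<alpha> = f; tgt2 A \<alpha> = f'; src1 A f = a; tgt1 A f = a';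
      src2 B \<beta> = g; tgt2 B \<beta> = g'; src1 B g = b; tgt1 B g = b'\<rbrakk> \<Longrightarrow>
    eq2 A B (VComp (Sig f' g') (HComp (LCell \<alpha> b') (RCell a \<beta>)))
            (VComp (HComp (RCell a' \<beta>) (LCell \<alpha> b)) (Sig f g))"
| eq2_Sig_id_left: "\<lbrakk>a \<in> Obj A; g \<in> Arr1 B\<rbrakk> \<Longrightarrow> eq2 A B (Sig (id1 A a) g) (IdC (RGen a g))"
| eq2_Sig_id_right: "\<lbrakk>f \<in> Arr1 A; b \<in> Obj B\<rbrakk> \<Longrightarrow> eq2 A B (Sig f (id1 B b)) (IdC (LGen f b))"
| eq2_Sig_comp_left: "\<lbrakk>f \<in> Arr1 A; f' \<in> Arr1 A; src1 A f' = tgt1 A f; g \<in> Arr1 B\<rbrakk> \<Longrightarrow>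
    eq2 A B (Sig (comp1 A f' f) g)
            (VComp (HComp (Sig f' g) (IdC (LGen f (src1 B g))))
                   (HComp (IdC (LGen f' (tgt1 B g))) (Sig f g)))"
| eq2_Sig_comp_right: "\<lbrakk>f \<in> Arr1 A; g \<in> Arr1 B; g' \<in> Arr1 B; src1 B g' = tgt1 B g\<rbrakk> \<Longrightarrow>
    eq2 A B (Sig f (comp1 B g' g))
            (VComp (HComp (IdC (RGen (tgt1 A f) g')) (Sig f g))
                   (HComp (Sig f g') (IdC (RGen (src1 A f) g))))"


section \<open>Coding in an infinite type\<close>

text \<open>The cells of a Gray tensor product are again to be elements of \<open>'u\<close>. When \<open>'u\<close> is infinite,
  \<open>code\<close> is injective on pairs and on expressions over \<open>'u\<close>.\<close>

definition code :: "'a \<Rightarrow> 'u" where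
  "code = (SOME h. inj h)"

definition decode :: "'u \<Rightarrow> 'a" where
  "decode = inv code"

lemma inj_code:
  assumes "inj (h :: 'a \<Rightarrow> 'u)"
  shows "inj (code :: 'a \<Rightarrow> 'u)"
  unfolding code_def using assms by (rule someI[of inj])

lemma exists_inj_pair:
  assumes "infinite (UNIV :: 'u set)"
  shows "\<exists>p :: 'u \<times> 'u \<Rightarrow> 'u. inj p"
proof -
  have "\<exists>p. bij_betw p (UNIV :: 'u set) (UNIV \<times> UNIV :: ('u \<times> 'u) set)"
    using card_of_Times_same_infinite[OF assms] ordIso_symmetric card_of_ordIso by blast
  then obtain p where "bij_betw p (UNIV :: 'u set) (UNIV :: ('u \<times> 'u) set)" by auto
  then have "inj (inv p)" by (simp add: bij_betw_def surj_imp_inj_inv)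
  then show ?thesis by blast
qed

lemma inj_code_pair:
  assumes "infinite (UNIV :: 'u set)"
  shows "inj (code :: 'u \<times> 'u \<Rightarrow> 'u)"
  using exists_inj_pair[OF assms] inj_code by blast

primrec flatten1 :: "('u \<times> 'u \<Rightarrow> 'u) \<Rightarrow> (nat \<Rightarrow> 'u) \<Rightarrow> 'u gexp1 \<Rightarrow> 'u" where
  "flatten1 p n (LGen f b) = p (n 0, p (f, b))"
| "flatten1 p n (RGen a g) = p (n 1, p (a, g))"
| "flatten1 p n (IdE a b) = p (n 2, p (a, b))"
| "flatten1 p n (CompE d e) = p (n 3, p (flatten1 p n d, flatten1 p n e))"

primrec flatten2 :: "('u \<times> 'u \<Rightarrow> 'u) \<Rightarrow> (nat \<Rightarrow> 'u) \<Rightarrow> 'u gexp2 \<Rightarrow> 'u" where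
  "flatten2 p n (LCell \<alpha> b) = p (n 0, p (\<alpha>, b))"
| "flatten2 p n (RCell a \<beta>) = p (n 1, p (a, \<beta>))"
| "flatten2 p n (Sig f g) = p (n 2, p (f, g))"
| "flatten2 p n (SigInv f g) = p (n 3, p (f, g))"
| "flatten2 p n (IdC e) = p (n 4, flatten1 p n e)"
| "flatten2 p n (VComp s t) = p (n 5, p (flatten2 p n s, flatten2 p n t))"
| "flatten2 p n (HComp s t) = p (n 6, p (flatten2 p n s, flatten2 p n t))"

lemma inj_flatten1:
  assumes p: "inj p" and n: "inj n"
  shows "inj (flatten1 p n)"
proof -
  have "d = e" if "flatten1 p n d = flatten1 p n e" for d e
    using that
  proof (induction d arbitrary: e)
    case (LGen f b) then show ?case by (cases e) (auto simp: inj_eq[OF p] inj_eq[OF n])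
  next
    case (RGen a g) then show ?case by (cases e) (auto simp: inj_eq[OF p] inj_eq[OF n])
  next
    case (IdE a b) then show ?case by (cases e) (auto simp: inj_eq[OF p] inj_eq[OF n])
  next
    case (CompE c d) then show ?case by (cases e) (auto simp: inj_eq[OF p] inj_eq[OF n])
  qed
  then show ?thesis by (rule injI)
qed

lemma inj_flatten2:
  assumes p: "inj p" and n: "inj n"
  shows "inj (flatten2 p n)"
proof -
  note inj = inj_eq[OF p] inj_eq[OF n] inj_eq[OF inj_flatten1[OF p n]]
  have "s = t" if "flatten2 p n s = flatten2 p n t" for s t
    using that
  proof (induction s arbitrary: t)
    case (LCell \<alpha> b) then show ?case by (cases t) (auto simp: inj)
  next
    case (RCell a \<beta>) then show ?case by (cases t) (auto simp: inj)
  next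
    case (Sig f g) then show ?case by (cases t) (auto simp: inj)
  next
    case (SigInv f g) then show ?case by (cases t) (auto simp: inj)
  next
    case (IdC e) then show ?case by (cases t) (auto simp: inj)
  next
    case (VComp s s') then show ?case by (cases t) (auto simp: inj)
  next
    case (HComp s s') then show ?case by (cases t) (auto simp: inj)
  qed
  then show ?thesis by (rule injI)
qed

lemma inj_code_gexp:
  assumes "infinite (UNIV :: 'u set)"
  shows "inj (code :: 'u gexp1 \<Rightarrow> 'u)" and "inj (code :: 'u gexp2 \<Rightarrow> 'u)"
proof -
  obtain p :: "'u \<times> 'u \<Rightarrow> 'u" where p: "inj p"
    using exists_inj_pair[OF assms] by blast
  obtain n :: "nat \<Rightarrow> 'u" where n: "inj n"
    using infinite_countable_subset[OF assms] by blast
  show "inj (code :: 'u gexp1 \<Rightarrow> 'u)" and "inj (code :: 'u gexp2 \<Rightarrow> 'u)"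
    using inj_code[OF inj_flatten1[OF p n]] inj_code[OF inj_flatten2[OF p n]] .
qed


section \<open>The Gray tensor product\<close>

text \<open>A cell of \<open>A \<otimes> B\<close> is an equivalence class of expressions, recorded in \<open>'u\<close> as the code of a
  chosen member of the class.\<close>

definition cell1 :: "'u cat2 \<Rightarrow> 'u cat2 \<Rightarrow> 'u gexp1 \<Rightarrow> 'u" where
  "cell1 A B e = code (SOME d. eq1 A B e d)"

definition cell2 :: "'u cat2 \<Rightarrow> 'u cat2 \<Rightarrow> 'u gexp2 \<Rightarrow> 'u" where
  "cell2 A B t = code (SOME s. eq2 A B t s)"

definition gray_tensor :: "'u cat2 \<Rightarrow> 'u cat2 \<Rightarrow> 'u cat2" where
  "gray_tensor A B = restrict_twocat \<lparr>
     Obj = code ` (Obj A \<times> Obj B),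
     Arr1 = cell1 A B ` {e. wf1 A B e},
     Arr2 = cell2 A B ` {t. wf2 A B t},
     src1 = (\<lambda>x. code (esrc A B (decode x))),
     tgt1 = (\<lambda>x. code (etgt A B (decode x))),
     src2 = (\<lambda>x. cell1 A B (edom A B (decode x))),
     tgt2 = (\<lambda>x. cell1 A B (ecod A B (decode x))),
     id1 = (\<lambda>x. cell1 A B (case decode x of (a, b) \<Rightarrow> IdE a b)),
     comp1 = (\<lambda>x y. cell1 A B (CompE (decode x) (decode y))),
     id2 = (\<lambda>x. cell2 A B (IdC (decode x))),
     vcomp = (\<lambda>x y. cell2 A B (VComp (decode x) (decode y))),
     hcomp = (\<lambda>x y. cell2 A B (HComp (decode x) (decode y)))\<rparr>"

primrec emap1 :: "'u fun2 \<Rightarrow> 'u fun2 \<Rightarrow> 'u gexp1 \<Rightarrow> 'u gexp1" where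
  "emap1 F G (LGen f b) = LGen (map1 F f) (map0 G b)"
| "emap1 F G (RGen a g) = RGen (map0 F a) (map1 G g)"
| "emap1 F G (IdE a b) = IdE (map0 F a) (map0 G b)"
| "emap1 F G (CompE d e) = CompE (emap1 F G d) (emap1 F G e)"

primrec emap2 :: "'u fun2 \<Rightarrow> 'u fun2 \<Rightarrow> 'u gexp2 \<Rightarrow> 'u gexp2" where
  "emap2 F G (LCell \<alpha> b) = LCell (map2 F \<alpha>) (map0 G b)"
| "emap2 F G (RCell a \<beta>) = RCell (map0 F a) (map2 G \<beta>)"
| "emap2 F G (Sig f g) = Sig (map1 F f) (map1 G g)"
| "emap2 F G (SigInv f g) = SigInv (map1 F f) (map1 G g)"
| "emap2 F G (IdC e) = IdC (emap1 F G e)"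
| "emap2 F G (VComp s t) = VComp (emap2 F G s) (emap2 F G t)"
| "emap2 F G (HComp s t) = HComp (emap2 F G s) (emap2 F G t)"

definition gray_tensor_fun :: "'u fun2 \<Rightarrow> 'u fun2 \<Rightarrow> 'u fun2" where
  "gray_tensor_fun F G = \<lparr>
     Dom = gray_tensor (Dom F) (Dom G),
     Cod = gray_tensor (Cod F) (Cod G),
     map0 = (\<lambda>x\<in>Obj (gray_tensor (Dom F) (Dom G)). code (map_prod (map0 F) (map0 G) (decode x))),
     map1 = (\<lambda>x\<in>Arr1 (gray_tensor (Dom F) (Dom G)). cell1 (Cod F) (Cod G) (emap1 F G (decode x))),
     map2 = (\<lambda>x\<in>Arr2 (gray_tensor (Dom F) (Dom G)). cell2 (Cod F) (Cod G) (emap2 F G (decode x)))\<rparr>"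

definition terminal_twocat :: "'u cat2" where
  "terminal_twocat = restrict_twocat (let u = code () in \<lparr>
     Obj = {u}, Arr1 = {u}, Arr2 = {u},
     src1 = (\<lambda>_. u), tgt1 = (\<lambda>_. u), src2 = (\<lambda>_. u), tgt2 = (\<lambda>_. u),
     id1 = (\<lambda>_. u), comp1 = (\<lambda>_ _. u), id2 = (\<lambda>_. u), vcomp = (\<lambda>_ _. u), hcomp = (\<lambda>_ _. u)\<rparr>)"

end

theory Submission
  imports Defs
begin

text \<open>A 2-functor out of \<open>A \<otimes> B\<close> is determined by its values on generators, and the data that extend to one
  are families of 2-functors \<open>P b : A \<rightarrow> D\<close> and \<open>Q a : B \<rightarrow> D\<close> with invertible 2-cells \<open>S f g\<close> such that
  \<open>S\<close> is pseudonatural in \<open>f\<close> and its inverse is pseudonatural in \<open>g\<close>. Pseudonatural transformations and icons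
  between 2-functors out of \<open>A \<otimes> B\<close> extend from generators as well, since on 1-cells they are functors into
  an arrow category and into the category of 2-cells under horizontal composition. The \<open>\<Sigma>\<close> of the associator is
  such an extension; the compatibility it needs with \<open>\<Sigma>\<^bsub>f,g\<^esub>\<close> is naturality of \<open>\<Sigma>\<^bsub>f,-\<^esub>\<close> at the 2-cell
  \<open>\<Sigma>\<^bsub>g,h\<^esub>\<close>. As \<open>\<Sigma>\<close> is invertible, \<open>\<otimes>\<close> is symmetric, so the inverse associator is a conjugate of the
  associator by symmetries. The remaining equations between 2-functors and
  between icons are checked on generators.\<close>

text \<open>The obstacle is that cells of A \<otimes> B have no normal form: a cell is the code of
  an arbitrarily chosen expression, and equality of expressions is an inductively generated
  relation. Maps out of A \<otimes> B are therefore evaluated on expressions inside the universal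
  property and afterwards known by their values on generators; even the prescribed formula of
  \<open>gray_tensor_fun\<close> is identified with such an extension. The underlying category of A
  \<otimes> B is the funny tensor product of the underlying categories: no relation of 1-cells mixes
  the two kinds of generators, so any two families of functors agreeing on objects extend. All
  interaction sits in \<Sigma>, and costs transformations and icons one equation for each pair f, g.
  For a tensor product of icons that equation is naturality of \<Sigma> at a pair of components,
  available because these are 2-cells and objects are fixed. The associator is the one constraint
  whose \<Sigma>-datum has no formula at a general 1-cell of A \<otimes> B. It is extended from
  generators for each fixed 1-cell of C; pseudonaturality in the variable of C must then be proved
  by induction on the 1-cell of A \<otimes> B.\<close>

notation gray_tensor (infixl "\<otimes>" 70)
notation terminal_twocat ("\<one>")

section \<open>2-categories\<close>

context two_category
begin

lemmas in_simps [simp] = src1_in tgt1_in src2_in tgt2_in src1_tgt2 tgt1_tgt2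

lemma id1_simps [simp]:
  assumes "x \<in> Obj C"
  shows "id1 C x \<in> Arr1 C" "src1 C (id1 C x) = x" "tgt1 C (id1 C x) = x"
  using id1[OF assms] by auto

lemma comp1_simps [simp]:
  assumes "f \<in> Arr1 C" "g \<in> Arr1 C" "src1 C f = tgt1 C g"
  shows "comp1 C f g \<in> Arr1 C" "src1 C (comp1 C f g) = src1 C g" "tgt1 C (comp1 C f g) = tgt1 C f"
  using comp1[OF assms] by auto

lemma id2_simps [simp]:
  assumes "f \<in> Arr1 C"
  shows "id2 C f \<in> Arr2 C" "src2 C (id2 C f) = f" "tgt2 C (id2 C f) = f"
  using id2[OF assms] by auto

lemma vcomp_simps [simp]:
  assumes "\<alpha> \<in> Arr2 C" "\<beta> \<in> Arr2 C" "src2 C \<alpha> = tgt2 C \<beta>"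
  shows "vcomp C \<alpha> \<beta> \<in> Arr2 C" "src2 C (vcomp C \<alpha> \<beta>) = src2 C \<beta>" "tgt2 C (vcomp C \<alpha> \<beta>) = tgt2 C \<alpha>"
  using vcomp[OF assms] by auto

lemma hcomp_simps [simp]:
  assumes "\<alpha> \<in> Arr2 C" "\<beta> \<in> Arr2 C" "src1 C (src2 C \<alpha>) = tgt1 C (src2 C \<beta>)"
  shows "hcomp C \<alpha> \<beta> \<in> Arr2 C" "src2 C (hcomp C \<alpha> \<beta>) = comp1 C (src2 C \<alpha>) (src2 C \<beta>)"
    "tgt2 C (hcomp C \<alpha> \<beta>) = comp1 C (tgt2 C \<alpha>) (tgt2 C \<beta>)"
  using hcomp[OF assms] by auto

lemma comp1_id1_left' [simp]: "\<lbrakk>f \<in> Arr1 C; tgt1 C f = x\<rbrakk> \<Longrightarrow> comp1 C (id1 C x) f = f"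
  using comp1_id1_left by blast

lemma comp1_id1_right' [simp]: "\<lbrakk>f \<in> Arr1 C; src1 C f = x\<rbrakk> \<Longrightarrow> comp1 C f (id1 C x) = f"
  using comp1_id1_right by blast

lemma vcomp_id2_left' [simp]: "\<lbrakk>\<alpha> \<in> Arr2 C; tgt2 C \<alpha> = f\<rbrakk> \<Longrightarrow> vcomp C (id2 C f) \<alpha> = \<alpha>"
  using vcomp_id2_left by blast

lemma vcomp_id2_right' [simp]: "\<lbrakk>\<alpha> \<in> Arr2 C; src2 C \<alpha> = f\<rbrakk> \<Longrightarrow> vcomp C \<alpha> (id2 C f) = \<alpha>"
  using vcomp_id2_right by blast

lemma hcomp_id_left' [simp]: "\<lbrakk>\<alpha> \<in> Arr2 C; tgt1 C (src2 C \<alpha>) = x\<rbrakk> \<Longrightarrow> hcomp C (id2 C (id1 C x)) \<alpha> = \<alpha>"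
  using hcomp_id_left by blast

lemma hcomp_id_right' [simp]: "\<lbrakk>\<alpha> \<in> Arr2 C; src1 C (src2 C \<alpha>) = x\<rbrakk> \<Longrightarrow> hcomp C \<alpha> (id2 C (id1 C x)) = \<alpha>"
  using hcomp_id_right by blast

lemma whisker_left_vcomp:
  assumes "f \<in> Arr1 C" "\<alpha> \<in> Arr2 C" "\<beta> \<in> Arr2 C" "src2 C \<alpha> = tgt2 C \<beta>" "src1 C f = tgt1 C (src2 C \<beta>)"
  shows "hcomp C (id2 C f) (vcomp C \<alpha> \<beta>) = vcomp C (hcomp C (id2 C f) \<alpha>) (hcomp C (id2 C f) \<beta>)"
  using interchange[of "id2 C f" "id2 C f" \<beta> \<alpha>] assms by simp

lemma whisker_right_vcomp:
  assumes "f \<in> Arr1 C" "\<alpha> \<in> Arr2 C" "\<beta> \<in> Arr2 C" "src2 C \<alpha> = tgt2 C \<beta>" "src1 C (src2 C \<beta>) = tgt1 C f"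
  shows "hcomp C (vcomp C \<alpha> \<beta>) (id2 C f) = vcomp C (hcomp C \<alpha> (id2 C f)) (hcomp C \<beta> (id2 C f))"
  using interchange[of \<beta> \<alpha> "id2 C f" "id2 C f"] assms by simp

text \<open>Interchange against identities: a horizontal composite can be performed one factor at a
  time, here with \<beta> first. Together with \<open>hcomp_eq_left_right\<close>, the other order,
  it lets adjacent 2-cells slide past each other.\<close>

lemma hcomp_eq_right_left:
  assumes "\<alpha> \<in> Arr2 C" "\<beta> \<in> Arr2 C" "src1 C (src2 C \<alpha>) = tgt1 C (src2 C \<beta>)"
  shows "vcomp C (hcomp C \<alpha> (id2 C (tgt2 C \<beta>))) (hcomp C (id2 C (src2 C \<alpha>)) \<beta>) = hcomp C \<alpha> \<beta>"
  using interchange[of "id2 C (src2 C \<alpha>)" \<alpha> \<beta> "id2 C (tgt2 C \<beta>)"] assms by simp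

lemma hcomp_eq_left_right:
  assumes "\<alpha> \<in> Arr2 C" "\<beta> \<in> Arr2 C" "src1 C (src2 C \<alpha>) = tgt1 C (src2 C \<beta>)"
  shows "vcomp C (hcomp C (id2 C (tgt2 C \<alpha>)) \<beta>) (hcomp C \<alpha> (id2 C (src2 C \<beta>))) = hcomp C \<alpha> \<beta>"
  using interchange[of \<alpha> "id2 C (tgt2 C \<alpha>)" "id2 C (src2 C \<beta>)" \<beta>] assms by simp

end

section \<open>Invertible 2-cells\<close>

definition inverse2 :: "('o, 'm, 'c) twocat \<Rightarrow> 'c \<Rightarrow> 'c \<Rightarrow> bool" where
  "inverse2 C \<alpha> \<beta> \<longleftrightarrow> \<alpha> \<in> Arr2 C \<and> \<beta> \<in> Arr2 C \<and> src2 C \<beta> = tgt2 C \<alpha> \<and> tgt2 C \<beta> = src2 C \<alpha> \<and>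
     vcomp C \<beta> \<alpha> = id2 C (src2 C \<alpha>) \<and> vcomp C \<alpha> \<beta> = id2 C (tgt2 C \<alpha>)"

definition inv2 :: "('o, 'm, 'c) twocat \<Rightarrow> 'c \<Rightarrow> 'c" where
  "inv2 C \<alpha> = (SOME \<beta>. inverse2 C \<alpha> \<beta>)"

definition iso2 :: "('o, 'm, 'c) twocat \<Rightarrow> 'c \<Rightarrow> bool" where
  "iso2 C \<alpha> \<longleftrightarrow> (\<exists>\<beta>. inverse2 C \<alpha> \<beta>)"

context two_category
begin

lemma inverse2_unique:
  assumes "inverse2 C \<alpha> \<beta>" "inverse2 C \<alpha> \<gamma>"
  shows "\<beta> = \<gamma>"
proof -
  have "\<beta> = vcomp C \<beta> (vcomp C \<alpha> \<gamma>)" using assms by (simp add: inverse2_def)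
  also have "\<dots> = vcomp C (vcomp C \<beta> \<alpha>) \<gamma>"
    by (rule vcomp_assoc[symmetric]) (use assms in \<open>simp_all add: inverse2_def\<close>)
  also have "\<dots> = \<gamma>" using assms by (simp add: inverse2_def)
  finally show ?thesis .
qed

lemma inverse2_sym: "inverse2 C \<alpha> \<beta> \<Longrightarrow> inverse2 C \<beta> \<alpha>"
  by (auto simp: inverse2_def)

lemma inv2_eqI: "inverse2 C \<alpha> \<beta> \<Longrightarrow> inv2 C \<alpha> = \<beta>"
  unfolding inv2_def by (rule inverse2_unique) (auto intro: someI)

lemma inverse2_inv2: "iso2 C \<alpha> \<Longrightarrow> inverse2 C \<alpha> (inv2 C \<alpha>)"
  unfolding inv2_def iso2_def by (rule someI_ex)

lemma inv2_simps [simp]: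
  assumes "iso2 C \<alpha>"
  shows "inv2 C \<alpha> \<in> Arr2 C" "src2 C (inv2 C \<alpha>) = tgt2 C \<alpha>" "tgt2 C (inv2 C \<alpha>) = src2 C \<alpha>"
    "vcomp C (inv2 C \<alpha>) \<alpha> = id2 C (src2 C \<alpha>)" "vcomp C \<alpha> (inv2 C \<alpha>) = id2 C (tgt2 C \<alpha>)"
    "iso2 C (inv2 C \<alpha>)" "inv2 C (inv2 C \<alpha>) = \<alpha>"
  using inverse2_inv2[OF assms] inv2_eqI[OF inverse2_sym[OF inverse2_inv2[OF assms]]] inverse2_sym
  by (auto simp: inverse2_def iso2_def)

lemma iso2_in: "iso2 C \<alpha> \<Longrightarrow> \<alpha> \<in> Arr2 C"
  by (auto simp: inverse2_def iso2_def)

lemma inverse2_id2: "f \<in> Arr1 C \<Longrightarrow> inverse2 C (id2 C f) (id2 C f)"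
  by (simp add: inverse2_def)

lemma inverse2_vcomp:
  assumes "inverse2 C \<alpha> \<alpha>'" "inverse2 C \<beta> \<beta>'" "src2 C \<alpha> = tgt2 C \<beta>"
  shows "inverse2 C (vcomp C \<alpha> \<beta>) (vcomp C \<beta>' \<alpha>')"
proof -
  have "vcomp C \<alpha>' (vcomp C \<alpha> \<beta>) = vcomp C (vcomp C \<alpha>' \<alpha>) \<beta>"
    by (rule vcomp_assoc[symmetric]) (use assms in \<open>simp_all add: inverse2_def\<close>)
  moreover have "vcomp C \<beta> (vcomp C \<beta>' \<alpha>') = vcomp C (vcomp C \<beta> \<beta>') \<alpha>'"
    by (rule vcomp_assoc[symmetric]) (use assms in \<open>simp_all add: inverse2_def\<close>)
  ultimately show ?thesis using assms by (simp add: inverse2_def vcomp_assoc)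
qed

lemma inverse2_hcomp:
  assumes "inverse2 C \<alpha> \<alpha>'" "inverse2 C \<beta> \<beta>'" "src1 C (src2 C \<alpha>) = tgt1 C (src2 C \<beta>)"
  shows "inverse2 C (hcomp C \<alpha> \<beta>) (hcomp C \<alpha>' \<beta>')"
  using assms interchange[of \<alpha> \<alpha>' \<beta> \<beta>'] interchange[of \<alpha>' \<alpha> \<beta>' \<beta>]
  by (simp add: inverse2_def hcomp_id2)

lemma iso2_id2 [simp]: "f \<in> Arr1 C \<Longrightarrow> iso2 C (id2 C f)"
  and iso2_vcomp [simp]: "\<lbrakk>iso2 C \<alpha>; iso2 C \<beta>; src2 C \<alpha> = tgt2 C \<beta>\<rbrakk> \<Longrightarrow> iso2 C (vcomp C \<alpha> \<beta>)"
  and iso2_hcomp [simp]: "\<lbrakk>iso2 C \<alpha>; iso2 C \<beta>; src1 C (src2 C \<alpha>) = tgt1 C (src2 C \<beta>)\<rbrakk> \<Longrightarrow> iso2 C (hcomp C \<alpha> \<beta>)"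
  using inverse2_id2 inverse2_vcomp inverse2_hcomp unfolding iso2_def by blast+

lemma inv2_id2 [simp]: "f \<in> Arr1 C \<Longrightarrow> inv2 C (id2 C f) = id2 C f"
  and inv2_vcomp: "\<lbrakk>iso2 C \<alpha>; iso2 C \<beta>; src2 C \<alpha> = tgt2 C \<beta>\<rbrakk> \<Longrightarrow>
    inv2 C (vcomp C \<alpha> \<beta>) = vcomp C (inv2 C \<beta>) (inv2 C \<alpha>)"
  and inv2_hcomp: "\<lbrakk>iso2 C \<alpha>; iso2 C \<beta>; src1 C (src2 C \<alpha>) = tgt1 C (src2 C \<beta>)\<rbrakk> \<Longrightarrow>
    inv2 C (hcomp C \<alpha> \<beta>) = hcomp C (inv2 C \<alpha>) (inv2 C \<beta>)"
  by (auto intro!: inv2_eqI intro: inverse2_id2 inverse2_vcomp inverse2_hcomp inverse2_inv2)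

text \<open>Inverting two opposite sides of a commuting square of 2-cells. This passes between
  naturality of \<Sigma> and of its inverse, and settles the inverse generators in inductions over
  2-cells.\<close>

lemma vcomp_inv2_commute:
  assumes "iso2 C \<sigma>" "iso2 C \<tau>" "\<alpha> \<in> Arr2 C" "\<beta> \<in> Arr2 C"
    "src2 C \<tau> = tgt2 C \<alpha>" "src2 C \<alpha> = src2 C \<sigma>" "src2 C \<beta> = tgt2 C \<sigma>" "tgt2 C \<beta> = tgt2 C \<tau>"
    "vcomp C \<tau> \<alpha> = vcomp C \<beta> \<sigma>"
  shows "vcomp C (inv2 C \<tau>) \<beta> = vcomp C \<alpha> (inv2 C \<sigma>)"
proof -
  note [simp] = iso2_in assms(1-8)
  have "vcomp C (inv2 C \<tau>) \<beta> = vcomp C (inv2 C \<tau>) (vcomp C (vcomp C \<beta> \<sigma>) (inv2 C \<sigma>))"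
    by (simp add: vcomp_assoc)
  also have "\<dots> = vcomp C (vcomp C (inv2 C \<tau>) \<tau>) (vcomp C \<alpha> (inv2 C \<sigma>))"
    unfolding assms(9)[symmetric] by (simp add: vcomp_assoc del: inv2_simps(4))
  also have "\<dots> = vcomp C \<alpha> (inv2 C \<sigma>)" by simp
  finally show ?thesis .
qed

end

section \<open>2-functors\<close>

context two_functor
begin

lemma map_in [simp]:
  "x \<in> Obj (Dom F) \<Longrightarrow> map0 F x \<in> Obj (Cod F)"
  "f \<in> Arr1 (Dom F) \<Longrightarrow> map1 F f \<in> Arr1 (Cod F)"
  "\<alpha> \<in> Arr2 (Dom F) \<Longrightarrow> map2 F \<alpha> \<in> Arr2 (Cod F)"
  using map0_in map1_in map2_in by auto

lemmas map_st [simp] = map_src1 map_tgt1 map_src2 map_tgt2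

lemma map_inverse2:
  assumes "inverse2 (Dom F) \<alpha> \<beta>"
  shows "inverse2 (Cod F) (map2 F \<alpha>) (map2 F \<beta>)"
  using assms map_vcomp[of \<alpha> \<beta>] map_vcomp[of \<beta> \<alpha>]
  by (auto simp: inverse2_def map_id2)

lemma map_iso2: "iso2 (Dom F) \<alpha> \<Longrightarrow> iso2 (Cod F) (map2 F \<alpha>)"
  using map_inverse2 by (auto simp: iso2_def)

lemma map_inv2: "iso2 (Dom F) \<alpha> \<Longrightarrow> map2 F (inv2 (Dom F) \<alpha>) = inv2 (Cod F) (map2 F \<alpha>)"
  by (rule B.inv2_eqI[symmetric], rule map_inverse2, rule A.inverse2_inv2)

end

text \<open>The codomain is a separate variable equated by a premise, so that the rules apply in
  whatever form the codomain is written.\<close>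

lemma two_functor_simps [simp]:
  assumes "two_functor F"
  shows "Cod F = D \<Longrightarrow> x \<in> Obj (Dom F) \<Longrightarrow> map0 F x \<in> Obj D"
    and "Cod F = D \<Longrightarrow> f \<in> Arr1 (Dom F) \<Longrightarrow> map1 F f \<in> Arr1 D"
    and "Cod F = D \<Longrightarrow> \<alpha> \<in> Arr2 (Dom F) \<Longrightarrow> map2 F \<alpha> \<in> Arr2 D"
    and "Cod F = D \<Longrightarrow> f \<in> Arr1 (Dom F) \<Longrightarrow> src1 D (map1 F f) = map0 F (src1 (Dom F) f)"
    and "Cod F = D \<Longrightarrow> f \<in> Arr1 (Dom F) \<Longrightarrow> tgt1 D (map1 F f) = map0 F (tgt1 (Dom F) f)"
    and "Cod F = D \<Longrightarrow> \<alpha> \<in> Arr2 (Dom F) \<Longrightarrow> src2 D (map2 F \<alpha>) = map1 F (src2 (Dom F) \<alpha>)"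
    and "Cod F = D \<Longrightarrow> \<alpha> \<in> Arr2 (Dom F) \<Longrightarrow> tgt2 D (map2 F \<alpha>) = map1 F (tgt2 (Dom F) \<alpha>)"
    and "Cod F = D \<Longrightarrow> iso2 (Dom F) \<alpha> \<Longrightarrow> iso2 D (map2 F \<alpha>)"
  using assms two_functor.map_in two_functor.map_st two_functor.map_iso2 by auto

lemma two_functor_maps:
  assumes "two_functor F"
  shows "Dom F = A \<Longrightarrow> x \<in> Obj A \<Longrightarrow> map1 F (id1 A x) = id1 (Cod F) (map0 F x)"
    and "\<lbrakk>Dom F = A; f \<in> Arr1 A; g \<in> Arr1 A; src1 A f = tgt1 A g\<rbrakk> \<Longrightarrow>
      map1 F (comp1 A f g) = comp1 (Cod F) (map1 F f) (map1 F g)"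
    and "Dom F = A \<Longrightarrow> f \<in> Arr1 A \<Longrightarrow> map2 F (id2 A f) = id2 (Cod F) (map1 F f)"
    and "\<lbrakk>Dom F = A; \<alpha> \<in> Arr2 A; \<beta> \<in> Arr2 A; src2 A \<alpha> = tgt2 A \<beta>\<rbrakk> \<Longrightarrow>
      map2 F (vcomp A \<alpha> \<beta>) = vcomp (Cod F) (map2 F \<alpha>) (map2 F \<beta>)"
    and "\<lbrakk>Dom F = A; \<alpha> \<in> Arr2 A; \<beta> \<in> Arr2 A; src1 A (src2 A \<alpha>) = tgt1 A (src2 A \<beta>)\<rbrakk> \<Longrightarrow>
      map2 F (hcomp A \<alpha> \<beta>) = hcomp (Cod F) (map2 F \<alpha>) (map2 F \<beta>)"
    and "Dom F = A \<Longrightarrow> iso2 A \<alpha> \<Longrightarrow> map2 F (inv2 A \<alpha>) = inv2 (Cod F) (map2 F \<alpha>)"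
  using assms two_functor.map_id1 two_functor.map_comp1 two_functor.map_id2 two_functor.map_vcomp
    two_functor.map_hcomp two_functor.map_inv2 by auto

lemma two_functor_eqI:
  assumes "two_functor F" "two_functor G" "Dom F = A" "Dom G = A" "Cod F = Cod G"
    and "\<And>x. x \<in> Obj A \<Longrightarrow> map0 F x = map0 G x"
    and "\<And>f. f \<in> Arr1 A \<Longrightarrow> map1 F f = map1 G f"
    and "\<And>\<alpha>. \<alpha> \<in> Arr2 A \<Longrightarrow> map2 F \<alpha> = map2 G \<alpha>"
  shows "F = G"
proof -
  interpret F: two_functor F by fact
  interpret G: two_functor G by fact
  have "map0 F = map0 G" "map1 F = map1 G" "map2 F = map2 G"
    using assms PiE_ext[OF F.map0_in, of "map0 G"] PiE_ext[OF F.map1_in, of "map1 G"]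
      PiE_ext[OF F.map2_in, of "map2 G"] G.map0_in G.map1_in G.map2_in by auto
  then show ?thesis using assms(3-5) by (auto intro: twofun.equality)
qed

lemma id_fun_simps [simp]:
  "Dom (id_fun A) = A" "Cod (id_fun A) = A"
  "x \<in> Obj A \<Longrightarrow> map0 (id_fun A) x = x"
  "f \<in> Arr1 A \<Longrightarrow> map1 (id_fun A) f = f"
  "\<alpha> \<in> Arr2 A \<Longrightarrow> map2 (id_fun A) \<alpha> = \<alpha>"
  by (simp_all add: id_fun_def)

lemma comp_fun_simps [simp]:
  "Dom (comp_fun G F) = Dom F" "Cod (comp_fun G F) = Cod G"
  "x \<in> Obj (Dom F) \<Longrightarrow> map0 (comp_fun G F) x = map0 G (map0 F x)"
  "f \<in> Arr1 (Dom F) \<Longrightarrow> map1 (comp_fun G F) f = map1 G (map1 F f)"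
  "\<alpha> \<in> Arr2 (Dom F) \<Longrightarrow> map2 (comp_fun G F) \<alpha> = map2 G (map2 F \<alpha>)"
  by (simp_all add: comp_fun_def compose_def)

lemma two_functor_id_fun [simp]:
  assumes "two_category A"
  shows "two_functor (id_fun A)"
proof -
  interpret two_category A by fact
  show ?thesis
    by (intro two_functor.intro two_functor_axioms.intro) (simp_all add: two_category_axioms, simp_all add: id_fun_def)
qed

lemma two_functor_comp_fun [simp]:
  assumes "two_functor G" "two_functor F" "Dom G = Cod F"
  shows "two_functor (comp_fun G F)"
proof -
  interpret F: two_functor F by fact
  interpret G: two_functor G by fact
  show ?thesis
    by (intro two_functor.intro two_functor_axioms.intro)
      (use F.A.two_category_axioms G.B.two_category_axioms assms in
        \<open>auto simp: two_functor_maps comp_fun_def compose_def\<close>)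
qed

lemma comp_fun_assoc:
  assumes "two_functor F" "Cod F = Dom G"
  shows "comp_fun (comp_fun H G) F = comp_fun H (comp_fun G F)"
proof -
  interpret two_functor F by fact
  show ?thesis using assms map_in by (auto simp: comp_fun_def compose_def fun_eq_iff)
qed

lemma comp_fun_id_right:
  assumes "two_functor F" "Dom F = A"
  shows "comp_fun F (id_fun A) = F"
  using assms by (auto intro!: two_functor_eqI[where A = A] simp: two_functor.axioms)

lemma comp_fun_id_left:
  assumes "two_functor F" "Cod F = A"
  shows "comp_fun (id_fun A) F = F"
proof -
  interpret two_functor F by fact
  show ?thesis using assms map_in B.two_category_axioms
    by (auto intro!: two_functor_eqI[where A = "Dom F"])
qed

section \<open>Categories and functors on 1-cells\<close>

text \<open>Carriers and operations are arbitrary because three categories serve as targets for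
  functors out of the 1-cells of a Gray tensor product: 1-cells, 2-cells under horizontal
  composition, and squares.\<close>

locale one_category =
  fixes Ob :: "'o set" and Ar :: "'m set" and dm cd :: "'m \<Rightarrow> 'o"
    and idt :: "'o \<Rightarrow> 'm" and cmp :: "'m \<Rightarrow> 'm \<Rightarrow> 'm"
  assumes dm_in [simp]: "f \<in> Ar \<Longrightarrow> dm f \<in> Ob"
    and cd_in [simp]: "f \<in> Ar \<Longrightarrow> cd f \<in> Ob"
    and idt_in [simp]: "x \<in> Ob \<Longrightarrow> idt x \<in> Ar"
    and dm_idt [simp]: "x \<in> Ob \<Longrightarrow> dm (idt x) = x"
    and cd_idt [simp]: "x \<in> Ob \<Longrightarrow> cd (idt x) = x"
    and cmp_in [simp]: "\<lbrakk>f \<in> Ar; g \<in> Ar; dm f = cd g\<rbrakk> \<Longrightarrow> cmp f g \<in> Ar"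
    and dm_cmp [simp]: "\<lbrakk>f \<in> Ar; g \<in> Ar; dm f = cd g\<rbrakk> \<Longrightarrow> dm (cmp f g) = dm g"
    and cd_cmp [simp]: "\<lbrakk>f \<in> Ar; g \<in> Ar; dm f = cd g\<rbrakk> \<Longrightarrow> cd (cmp f g) = cd f"
    and cmp_assoc: "\<lbrakk>f \<in> Ar; g \<in> Ar; h \<in> Ar; dm f = cd g; dm g = cd h\<rbrakk> \<Longrightarrow> cmp (cmp f g) h = cmp f (cmp g h)"
    and cmp_idt_left [simp]: "\<lbrakk>f \<in> Ar; cd f = x\<rbrakk> \<Longrightarrow> cmp (idt x) f = f"
    and cmp_idt_right [simp]: "\<lbrakk>f \<in> Ar; dm f = x\<rbrakk> \<Longrightarrow> cmp f (idt x) = f"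

lemma (in two_category) one_category_cells1:
  "one_category (Obj C) (Arr1 C) (src1 C) (tgt1 C) (id1 C) (comp1 C)"
  by standard (simp_all add: comp1_assoc)

text \<open>The two icon axioms \<open>icon_id1\<close> and \<open>icon_comp1\<close> say exactly
  that the components of an icon form a functor into this category.\<close>

lemma (in two_category) one_category_cells2:
  "one_category (Obj C) (Arr2 C) (\<lambda>\<alpha>. src1 C (src2 C \<alpha>)) (\<lambda>\<alpha>. tgt1 C (src2 C \<alpha>)) (\<lambda>x. id2 C (id1 C x)) (hcomp C)"
  by standard (simp_all add: hcomp_assoc)

section \<open>The cells of the Gray tensor product\<close>

text \<open>The 2-functors \<open>- \<otimes> b\<close> and, below, \<open>a \<otimes> -\<close>.
  Treating generators as their values replaces the functoriality relations of the presentation by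
  preservation properties of 2-functors.\<close>

definition Lfun :: "'u cat2 \<Rightarrow> 'u cat2 \<Rightarrow> 'u \<Rightarrow> 'u fun2" where
  "Lfun A B b = \<lparr>Dom = A, Cod = A \<otimes> B,
     map0 = (\<lambda>a\<in>Obj A. code (a, b)),
     map1 = (\<lambda>f\<in>Arr1 A. cell1 A B (LGen f b)),
     map2 = (\<lambda>\<alpha>\<in>Arr2 A. cell2 A B (LCell \<alpha> b))\<rparr>"

definition Rfun :: "'u cat2 \<Rightarrow> 'u cat2 \<Rightarrow> 'u \<Rightarrow> 'u fun2" where
  "Rfun A B a = \<lparr>Dom = B, Cod = A \<otimes> B,
     map0 = (\<lambda>b\<in>Obj B. code (a, b)),
     map1 = (\<lambda>g\<in>Arr1 B. cell1 A B (RGen a g)),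
     map2 = (\<lambda>\<beta>\<in>Arr2 B. cell2 A B (RCell a \<beta>))\<rparr>"

definition gsig :: "'u cat2 \<Rightarrow> 'u cat2 \<Rightarrow> 'u \<Rightarrow> 'u \<Rightarrow> 'u" where
  "gsig A B f g = cell2 A B (Sig f g)"

lemma LRfun_simps [simp]:
  "Dom (Lfun A B b) = A" "Cod (Lfun A B b) = A \<otimes> B"
  "Dom (Rfun A B a) = B" "Cod (Rfun A B a) = A \<otimes> B"
  "a \<in> Obj A \<Longrightarrow> map0 (Lfun A B b) a = code (a, b)"
  "b \<in> Obj B \<Longrightarrow> map0 (Rfun A B a) b = code (a, b)"
  by (simp_all add: Lfun_def Rfun_def)

locale gray_pair = A: two_category A + B: two_category B for A B :: "'u cat2" +
  assumes infinite_UNIV: "infinite (UNIV :: 'u set)"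
begin

abbreviation AB :: "'u cat2" where
  "AB \<equiv> A \<otimes> B"

section \<open>Boundaries and classes of expressions\<close>

lemma decode_code [simp]:
  "decode (code p :: 'u) = (p :: 'u \<times> 'u)"
  "decode (code d :: 'u) = (d :: 'u gexp1)"
  "decode (code s :: 'u) = (s :: 'u gexp2)"
  by (simp_all add: decode_def inj_code_pair[OF infinite_UNIV] inj_code_gexp[OF infinite_UNIV])

lemma code_eq_iff [simp]: "(code p :: 'u) = code q \<longleftrightarrow> p = q" for p q :: "'u \<times> 'u"
  using inj_code_pair[OF infinite_UNIV] by (simp add: inj_eq)

lemma wf1_esrc_etgt:
  "wf1 A B e \<Longrightarrow> esrc A B e \<in> Obj A \<times> Obj B \<and> etgt A B e \<in> Obj A \<times> Obj B"
  by (induction e) auto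

lemma eq1_wf:
  "eq1 A B d e \<Longrightarrow> wf1 A B d \<and> wf1 A B e \<and> esrc A B d = esrc A B e \<and> etgt A B d = etgt A B e"
proof (induction rule: eq1.induct)
  case (eq1_id_left e a b) then show ?case using wf1_esrc_etgt[of e] by simp
next
  case (eq1_id_right e a b) then show ?case using wf1_esrc_etgt[of e] by simp
qed auto

lemma wf2_edom_ecod:
  "wf2 A B t \<Longrightarrow> wf1 A B (edom A B t) \<and> wf1 A B (ecod A B t) \<and>
     esrc A B (ecod A B t) = esrc A B (edom A B t) \<and> etgt A B (ecod A B t) = etgt A B (edom A B t)"
  by (induction t) (auto dest: eq1_wf)

text \<open>Related 2-cell expressions need not have identical boundaries: associativity, unit laws
  and the relations for \<Sigma> rebracket or contract them. So boundaries are compared up to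
  \<open>eq1\<close>, and the \<Sigma> cases carry the content.\<close>

lemma eq2_wf:
  "eq2 A B s t \<Longrightarrow> wf2 A B s \<and> wf2 A B t \<and> eq1 A B (edom A B s) (edom A B t) \<and> eq1 A B (ecod A B s) (ecod A B t)"
proof (induction rule: eq2.induct)
  case (eq2_refl t) then show ?case using wf2_edom_ecod by (auto intro: eq1_refl)
next
  case (eq2_sym s t) then show ?case by (auto intro: eq1_sym)
next
  case (eq2_trans s t u) then show ?case by (auto intro: eq1_trans)
next
  case (eq2_id_cong d e) then show ?case by (auto dest: eq1_wf)
next
  case (eq2_vcomp_cong s s' t t')
  then show ?case by (auto intro: eq1_trans eq1_sym)
next
  case (eq2_hcomp_cong s s' t t')
  then have "esrc A B (edom A B s') = etgt A B (edom A B t')"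
    using eq1_wf[of "edom A B s" "edom A B s'"] eq1_wf[of "edom A B t" "edom A B t'"] by auto
  then show ?case using eq2_hcomp_cong wf2_edom_ecod by (auto intro!: eq1_cong)
next
  case (eq2_vcomp_assoc s t u)
  then show ?case using wf2_edom_ecod[of s] wf2_edom_ecod[of u] by (auto intro: eq1_refl)
next
  case (eq2_vcomp_id_left t) then show ?case using wf2_edom_ecod[of t] by (auto intro: eq1_refl)
next
  case (eq2_vcomp_id_right t) then show ?case using wf2_edom_ecod[of t] by (auto intro: eq1_refl)
next
  case (eq2_hcomp_assoc s t u)
  then show ?case using wf2_edom_ecod[of s] wf2_edom_ecod[of t] wf2_edom_ecod[of u]
    by (auto intro!: eq1_assoc)
next
  case (eq2_hcomp_id_left t a b)
  then show ?case using wf2_edom_ecod[of t] wf1_esrc_etgt[of "edom A B t"] by (auto intro!: eq1_id_left)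
next
  case (eq2_hcomp_id_right t a b)
  then show ?case using wf2_edom_ecod[of t] wf1_esrc_etgt[of "edom A B t"] by (auto intro!: eq1_id_right)
next
  case (eq2_hcomp_id d e)
  then show ?case by (auto intro!: eq1_refl)
next
  case (eq2_interchange s' s t' t)
  \<comment> \<open>Endpoints are invariant under \<open>eq1\<close>, so horizontal composability of
    the lower cells s and t passes to the upper cells s' and t'.\<close>
  have *: "esrc A B (edom A B s') = esrc A B (edom A B s)"
    using eq2_interchange wf2_edom_ecod[of s] eq1_wf[of "edom A B s'" "ecod A B s"] by auto
  have **: "etgt A B (edom A B t') = etgt A B (edom A B t)"
    using eq2_interchange wf2_edom_ecod[of t] eq1_wf[of "edom A B t'" "ecod A B t"] by auto
  show ?case using eq2_interchange * ** wf2_edom_ecod[of s] wf2_edom_ecod[of t] wf2_edom_ecod[of s'] wf2_edom_ecod[of t']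
    by (auto intro!: eq1_refl eq1_cong)
next
  case (eq2_Sig_natural \<alpha> \<beta> f f' a a' g g' b b')
  then have "src1 A f' = a" "tgt1 A f' = a'" "src1 B g' = b" "tgt1 B g' = b'"
    "f \<in> Arr1 A" "f' \<in> Arr1 A" "g \<in> Arr1 B" "g' \<in> Arr1 B" by auto
  then show ?case using eq2_Sig_natural by (auto intro!: eq1_refl eq1_cong)
next
  case (eq2_Sig_comp_left f f' g)
  \<comment> \<open>Three rebracketings: the common middle boundary of the two pasted cells, which
    makes their vertical composite well formed, then the domains and the codomains of the two sides.
    The dual case below has the same shape.\<close>
  have 1: "eq1 A B (CompE (CompE (LGen f' (tgt1 B g)) (RGen (tgt1 A f) g)) (LGen f (src1 B g)))
     (CompE (LGen f' (tgt1 B g)) (CompE (RGen (tgt1 A f) g) (LGen f (src1 B g))))"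
    using eq2_Sig_comp_left by (intro eq1_assoc) simp
  have 2: "eq1 A B (CompE (LGen (comp1 A f' f) (tgt1 B g)) (RGen (src1 A f) g))
     (CompE (LGen f' (tgt1 B g)) (CompE (LGen f (tgt1 B g)) (RGen (src1 A f) g)))"
    using eq2_Sig_comp_left by (intro eq1_trans[OF eq1_cong[OF eq1_L_comp eq1_refl] eq1_assoc]) simp_all
  have 3: "eq1 A B (CompE (RGen (tgt1 A f') g) (LGen (comp1 A f' f) (src1 B g)))
     (CompE (CompE (RGen (tgt1 A f') g) (LGen f' (src1 B g))) (LGen f (src1 B g)))"
    using eq2_Sig_comp_left by (intro eq1_trans[OF eq1_cong[OF eq1_refl eq1_L_comp] eq1_sym[OF eq1_assoc]]) simp_all
  show ?case using eq2_Sig_comp_left 1 2 3 by simp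
next
  case (eq2_Sig_comp_right f g g')
  have 1: "eq1 A B (CompE (RGen (tgt1 A f) g') (CompE (LGen f (tgt1 B g)) (RGen (src1 A f) g)))
     (CompE (CompE (RGen (tgt1 A f) g') (LGen f (src1 B g'))) (RGen (src1 A f) g))"
    using eq2_Sig_comp_right
      eq1_sym[OF eq1_assoc[of A B "RGen (tgt1 A f) g'" "LGen f (tgt1 B g)" "RGen (src1 A f) g"]] by simp
  have 2: "eq1 A B (CompE (LGen f (tgt1 B g')) (RGen (src1 A f) (comp1 B g' g)))
     (CompE (CompE (LGen f (tgt1 B g')) (RGen (src1 A f) g')) (RGen (src1 A f) g))"
    using eq2_Sig_comp_right by (intro eq1_trans[OF eq1_cong[OF eq1_refl eq1_R_comp] eq1_sym[OF eq1_assoc]]) simp_all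
  have 3: "eq1 A B (CompE (RGen (tgt1 A f) (comp1 B g' g)) (LGen f (src1 B g)))
     (CompE (RGen (tgt1 A f) g') (CompE (RGen (tgt1 A f) g) (LGen f (src1 B g))))"
    using eq2_Sig_comp_right by (intro eq1_trans[OF eq1_cong[OF eq1_R_comp eq1_refl] eq1_assoc]) simp_all
  show ?case using eq2_Sig_comp_right 1 2 3 by (simp add: eq1_sym)
next
  case (eq2_Sig_id_left a g)
  then show ?case using eq1_trans[OF eq1_cong[OF eq1_L_id eq1_refl] eq1_id_left[of A B "RGen a g" a "tgt1 B g"]]
     eq1_trans[OF eq1_cong[OF eq1_refl eq1_L_id] eq1_id_right[of A B "RGen a g" a "src1 B g"]]
    by simp
next
  case (eq2_Sig_id_right f b)
  then show ?case using eq1_trans[OF eq1_cong[OF eq1_R_id eq1_refl] eq1_id_left[of A B "LGen f b" "tgt1 A f" b]]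
     eq1_trans[OF eq1_cong[OF eq1_refl eq1_R_id] eq1_id_right[of A B "LGen f b" "src1 A f" b]]
    by simp
qed (auto intro: eq1_refl eq1_L_id eq1_L_comp eq1_R_id eq1_R_comp)

text \<open>Symmetry and transitivity turn equivalent expressions into equal predicates, and choice
  from equal predicates gives the same member.\<close>

lemma cell1_eqI: "eq1 A B d e \<Longrightarrow> cell1 A B d = cell1 A B e"
proof -
  assume "eq1 A B d e"
  then have "eq1 A B d c = eq1 A B e c" for c by (blast intro: eq1_sym eq1_trans)
  then show ?thesis by (simp add: cell1_def)
qed

lemma cell2_eqI: "eq2 A B s t \<Longrightarrow> cell2 A B s = cell2 A B t"
proof -
  assume "eq2 A B s t"
  then have "eq2 A B s u = eq2 A B t u" for u by (blast intro: eq2_sym eq2_trans)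
  then show ?thesis by (simp add: cell2_def)
qed

lemma eq1_decode_cell1: "wf1 A B e \<Longrightarrow> eq1 A B e (decode (cell1 A B e))"
  unfolding cell1_def by (simp, rule someI, rule eq1_refl)

lemma eq2_decode_cell2: "wf2 A B t \<Longrightarrow> eq2 A B t (decode (cell2 A B t))"
  unfolding cell2_def by (simp, rule someI, rule eq2_refl)

lemma cell1_eq_iff: "wf1 A B d \<Longrightarrow> wf1 A B e \<Longrightarrow> cell1 A B d = cell1 A B e \<longleftrightarrow> eq1 A B d e"
  by (metis cell1_eqI eq1_decode_cell1 eq1_sym eq1_trans)

lemma wf1_decode [simp]: "wf1 A B e \<Longrightarrow> wf1 A B (decode (cell1 A B e))"
  and esrc_decode [simp]: "wf1 A B e \<Longrightarrow> esrc A B (decode (cell1 A B e)) = esrc A B e"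
  and etgt_decode [simp]: "wf1 A B e \<Longrightarrow> etgt A B (decode (cell1 A B e)) = etgt A B e"
  and cell1_decode [simp]: "wf1 A B e \<Longrightarrow> cell1 A B (decode (cell1 A B e)) = cell1 A B e"
  using eq1_wf[OF eq1_decode_cell1[of e]] cell1_eqI[OF eq1_decode_cell1[of e]] by auto

lemma wf2_decode [simp]: "wf2 A B t \<Longrightarrow> wf2 A B (decode (cell2 A B t))"
  and cell1_edom_decode: "wf2 A B t \<Longrightarrow> cell1 A B (edom A B (decode (cell2 A B t))) = cell1 A B (edom A B t)"
  and cell1_ecod_decode: "wf2 A B t \<Longrightarrow> cell1 A B (ecod A B (decode (cell2 A B t))) = cell1 A B (ecod A B t)"
  and cell2_decode [simp]: "wf2 A B t \<Longrightarrow> cell2 A B (decode (cell2 A B t)) = cell2 A B t"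
  using eq2_wf[OF eq2_decode_cell2[of t]] cell1_eqI[of "edom A B t"] cell1_eqI[of "ecod A B t"]
    cell2_eqI[OF eq2_decode_cell2[of t]] by auto

section \<open>Operations of A \<otimes> B computed on representatives\<close>

lemma Obj_gray: "Obj AB = code ` (Obj A \<times> Obj B)"
  and Arr1_gray: "Arr1 AB = cell1 A B ` {e. wf1 A B e}"
  and Arr2_gray: "Arr2 AB = cell2 A B ` {t. wf2 A B t}"
  by (simp_all add: gray_tensor_def restrict_twocat_def)

lemma cell1_in: "wf1 A B e \<Longrightarrow> cell1 A B e \<in> Arr1 AB"
  and cell2_in: "wf2 A B t \<Longrightarrow> cell2 A B t \<in> Arr2 AB"
  by (simp_all add: Arr1_gray Arr2_gray)

lemma src1_cell1: "wf1 A B e \<Longrightarrow> src1 AB (cell1 A B e) = code (esrc A B e)"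
  and tgt1_cell1: "wf1 A B e \<Longrightarrow> tgt1 AB (cell1 A B e) = code (etgt A B e)"
  and src2_cell2: "wf2 A B t \<Longrightarrow> src2 AB (cell2 A B t) = cell1 A B (edom A B t)"
  and tgt2_cell2: "wf2 A B t \<Longrightarrow> tgt2 AB (cell2 A B t) = cell1 A B (ecod A B t)"
  and id1_code: "a \<in> Obj A \<Longrightarrow> b \<in> Obj B \<Longrightarrow> id1 AB (code (a, b)) = cell1 A B (IdE a b)"
  by (auto simp: gray_tensor_def restrict_twocat_def cell1_edom_decode cell1_ecod_decode image_iff)

lemma id2_cell1: "wf1 A B e \<Longrightarrow> id2 AB (cell1 A B e) = cell2 A B (IdC e)"
  by (auto simp: gray_tensor_def restrict_twocat_def image_iff intro!: cell2_eqI eq2_id_cong eq1_sym[OF eq1_decode_cell1])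

text \<open>The operation is defined through decoded representatives; the congruence rule allows any
  representative to be used instead. The vertical and horizontal composites below follow the same
  pattern.\<close>

lemma comp1_cell1:
  assumes "wf1 A B (CompE d e)"
  shows "comp1 AB (cell1 A B d) (cell1 A B e) = cell1 A B (CompE d e)"
proof -
  have "cell1 A B (CompE d e) = cell1 A B (CompE (decode (cell1 A B d)) (decode (cell1 A B e)))"
    using assms by (auto intro!: cell1_eqI eq1_cong eq1_decode_cell1)
  then show ?thesis
    using assms by (auto simp: gray_tensor_def restrict_twocat_def)
qed

lemma vcomp_cell2:
  assumes "wf2 A B (VComp s t)"
  shows "vcomp AB (cell2 A B s) (cell2 A B t) = cell2 A B (VComp s t)"
proof -
  have "cell2 A B (VComp s t) = cell2 A B (VComp (decode (cell2 A B s)) (decode (cell2 A B t)))"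
    using assms by (auto intro!: cell2_eqI eq2_vcomp_cong eq2_decode_cell2)
  moreover have "cell1 A B (edom A B s) = cell1 A B (ecod A B t)"
    using assms by (auto intro: cell1_eqI)
  ultimately show ?thesis
    using assms by (auto simp: gray_tensor_def restrict_twocat_def cell1_edom_decode cell1_ecod_decode)
qed

lemma hcomp_cell2:
  assumes "wf2 A B (HComp s t)"
  shows "hcomp AB (cell2 A B s) (cell2 A B t) = cell2 A B (HComp s t)"
proof -
  have "cell2 A B (HComp s t) = cell2 A B (HComp (decode (cell2 A B s)) (decode (cell2 A B t)))"
    using assms by (auto intro!: cell2_eqI eq2_hcomp_cong eq2_decode_cell2)
  then show ?thesis
    using assms wf2_edom_ecod[of s] wf2_edom_ecod[of t]
    by (auto simp: gray_tensor_def restrict_twocat_def cell1_edom_decode cell1_ecod_decode)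
qed

lemma Obj_grayE:
  assumes "x \<in> Obj AB"
  obtains a b where "x = code (a, b)" "a \<in> Obj A" "b \<in> Obj B"
  using assms by (auto simp: Obj_gray)

lemma Arr1_grayE:
  assumes "x \<in> Arr1 AB"
  obtains e where "x = cell1 A B e" "wf1 A B e"
  using assms by (auto simp: Arr1_gray)

lemma Arr2_grayE:
  assumes "x \<in> Arr2 AB"
  obtains t where "x = cell2 A B t" "wf2 A B t"
  using assms by (auto simp: Arr2_gray)

lemmas cell_simps = src1_cell1 tgt1_cell1 src2_cell2 tgt2_cell2 id1_code id2_cell1 comp1_cell1
  vcomp_cell2 hcomp_cell2 cell1_in cell2_in

text \<open>Each axiom becomes, on representatives, a rule of \<open>eq1\<close> or
  \<open>eq2\<close>. Vertical composability is an equality of classes and has to be read back as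
  \<open>eq1\<close> by \<open>cell1_eq_iff\<close> before the rules apply.\<close>

lemma two_category_gray: "two_category AB"
proof
  note [simp] = cell_simps
  let ?C = "AB"
  have wf_edom [simp]: "wf1 A B (edom A B t)" "wf1 A B (ecod A B t)"
    "esrc A B (ecod A B t) = esrc A B (edom A B t)" "etgt A B (ecod A B t) = etgt A B (edom A B t)"
      if "wf2 A B t" for t
    using wf2_edom_ecod that by auto
  {
    fix x assume "x \<in> Arr1 ?C"
    then obtain e where [simp]: "x = cell1 A B e" "wf1 A B e" by (rule Arr1_grayE)
    obtain a b where s: "esrc A B e = (a, b)" "a \<in> Obj A" "b \<in> Obj B" using wf1_esrc_etgt[of e] by auto
    obtain a' b' where t: "etgt A B e = (a', b')" "a' \<in> Obj A" "b' \<in> Obj B" using wf1_esrc_etgt[of e] by auto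
    show "src1 ?C x \<in> Obj ?C" "tgt1 ?C x \<in> Obj ?C" using s t by (simp_all add: Obj_gray)
    show "comp1 ?C (id1 ?C (tgt1 ?C x)) x = x" "comp1 ?C x (id1 ?C (src1 ?C x)) = x"
      using s t by (auto intro!: cell1_eqI eq1_id_left eq1_id_right)
    show "id2 ?C x \<in> Arr2 ?C \<and> src2 ?C (id2 ?C x) = x \<and> tgt2 ?C (id2 ?C x) = x" by simp
  }
  {
    fix x assume "x \<in> Arr2 ?C"
    then obtain t where [simp]: "x = cell2 A B t" "wf2 A B t" by (rule Arr2_grayE)
    show "src2 ?C x \<in> Arr1 ?C" "tgt2 ?C x \<in> Arr1 ?C" by simp_all
    show "src1 ?C (tgt2 ?C x) = src1 ?C (src2 ?C x)" "tgt1 ?C (tgt2 ?C x) = tgt1 ?C (src2 ?C x)" by simp_all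
    have [simp]: "eq1 A B (edom A B t) (edom A B t)" "eq1 A B (ecod A B t) (ecod A B t)"
      by (simp_all add: eq1_refl)
    show "vcomp ?C (id2 ?C (tgt2 ?C x)) x = x" "vcomp ?C x (id2 ?C (src2 ?C x)) = x"
      by (auto intro!: cell2_eqI eq2_vcomp_id_left eq2_vcomp_id_right)
    obtain a b where s: "esrc A B (edom A B t) = (a, b)" "a \<in> Obj A" "b \<in> Obj B"
      using wf1_esrc_etgt[of "edom A B t"] by auto
    obtain a' b' where t: "etgt A B (edom A B t) = (a', b')" "a' \<in> Obj A" "b' \<in> Obj B"
      using wf1_esrc_etgt[of "edom A B t"] by auto
    show "hcomp ?C (id2 ?C (id1 ?C (tgt1 ?C (src2 ?C x)))) x
      = x" "hcomp ?C x (id2 ?C (id1 ?C (src1 ?C (src2 ?C x)))) = x"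
      using s t by (auto intro!: cell2_eqI eq2_hcomp_id_left eq2_hcomp_id_right)
  }
  {
    fix x assume "x \<in> Obj ?C"
    then obtain a b where "x = code (a, b)" "a \<in> Obj A" "b \<in> Obj B" by (rule Obj_grayE)
    then show "id1 ?C x \<in> Arr1 ?C \<and> src1 ?C (id1 ?C x) = x \<and> tgt1 ?C (id1 ?C x) = x" by simp
  }
  {
    fix x y assume "x \<in> Arr1 ?C" "y \<in> Arr1 ?C" and st: "src1 ?C x = tgt1 ?C y"
    then obtain d e where [simp]: "x = cell1 A B d" "wf1 A B d" "y = cell1 A B e" "wf1 A B e" by (auto
      elim!: Arr1_grayE)
    have [simp]: "esrc A B d = etgt A B e" using st by simp
    show "comp1 ?C x y \<in> Arr1 ?C \<and> src1 ?C (comp1 ?C x y) = src1 ?C y \<and> tgt1 ?C (comp1 ?C x y) = tgt1 ?C x" by simp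
    show "hcomp ?C (id2 ?C x) (id2 ?C y) = id2 ?C (comp1 ?C x y)"
      by (simp, rule cell2_eqI, rule eq2_hcomp_id) simp
  }
  {
    fix x y z assume "x \<in> Arr1 ?C" "y \<in> Arr1 ?C" "z \<in> Arr1 ?C" and st: "src1 ?C x = tgt1 ?C y" "src1 ?C y
      = tgt1 ?C z"
    then obtain c d e where [simp]: "x = cell1 A B c" "wf1 A B c" "y = cell1 A B d" "wf1 A B d" "z
      = cell1 A B e" "wf1 A B e"
      by (auto elim!: Arr1_grayE)
    show "comp1 ?C (comp1 ?C x y) z = comp1 ?C x (comp1 ?C y z)"
      using st by (auto intro!: cell1_eqI eq1_assoc)
  }
  {
    fix x y assume "x \<in> Arr2 ?C" "y \<in> Arr2 ?C" and st: "src2 ?C x = tgt2 ?C y"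
    then obtain s t where [simp]: "x = cell2 A B s" "wf2 A B s" "y = cell2 A B t" "wf2 A B t" by (auto
      elim!: Arr2_grayE)
    have [simp]: "eq1 A B (edom A B s) (ecod A B t)" using st by (simp add: cell1_eq_iff)
    show "vcomp ?C x y \<in> Arr2 ?C \<and> src2 ?C (vcomp ?C x y) = src2 ?C y \<and> tgt2 ?C (vcomp ?C x y) = tgt2 ?C x" by simp
  }
  {
    fix x y z assume "x \<in> Arr2 ?C" "y \<in> Arr2 ?C" "z \<in> Arr2 ?C" and st: "src2 ?C x = tgt2 ?C y" "src2 ?C y
      = tgt2 ?C z"
    then obtain r s t where [simp]: "x = cell2 A B r" "wf2 A B r" "y = cell2 A B s" "wf2 A B s" "z
      = cell2 A B t" "wf2 A B t"
      by (auto elim!: Arr2_grayE)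
    show "vcomp ?C (vcomp ?C x y) z = vcomp ?C x (vcomp ?C y z)"
      using st by (auto simp: cell1_eq_iff intro!: cell2_eqI eq2_vcomp_assoc)
  }
  {
    fix x y assume "x \<in> Arr2 ?C" "y \<in> Arr2 ?C" and st: "src1 ?C (src2 ?C x) = tgt1 ?C (src2 ?C y)"
    then obtain s t where [simp]: "x = cell2 A B s" "wf2 A B s" "y = cell2 A B t" "wf2 A B t" by (auto
      elim!: Arr2_grayE)
    show "hcomp ?C x y \<in> Arr2 ?C \<and> src2 ?C (hcomp ?C x y) = comp1 ?C (src2 ?C x) (src2 ?C y) \<and>
       tgt2 ?C (hcomp ?C x y) = comp1 ?C (tgt2 ?C x) (tgt2 ?C y)" using st by simp
  }
  {
    fix x y z assume "x \<in> Arr2 ?C" "y \<in> Arr2 ?C" "z \<in> Arr2 ?C" and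
      st: "src1 ?C (src2 ?C x) = tgt1 ?C (src2 ?C y)" "src1 ?C (src2 ?C y) = tgt1 ?C (src2 ?C z)"
    then obtain r s t where [simp]: "x = cell2 A B r" "wf2 A B r" "y = cell2 A B s" "wf2 A B s" "z
      = cell2 A B t" "wf2 A B t"
      by (auto elim!: Arr2_grayE)
    show "hcomp ?C (hcomp ?C x y) z = hcomp ?C x (hcomp ?C y z)"
      using st by (auto intro!: cell2_eqI eq2_hcomp_assoc)
  }
  {
    fix x x' y y' assume "x \<in> Arr2 ?C" "x' \<in> Arr2 ?C" "y \<in> Arr2 ?C" "y' \<in> Arr2 ?C" and
      st: "src2 ?C x' = tgt2 ?C x" "src2 ?C y' = tgt2 ?C y" "src1 ?C (src2 ?C x) = tgt1 ?C (src2 ?C y)"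
    then obtain s s' t t' where [simp]: "x = cell2 A B s" "wf2 A B s" "y = cell2 A B t" "wf2 A B t"
      "x' = cell2 A B s'" "wf2 A B s'" "y' = cell2 A B t'" "wf2 A B t'"
      by (auto elim!: Arr2_grayE)
    have e [simp]: "eq1 A B (edom A B s') (ecod A B s)" "eq1 A B (edom A B t') (ecod A B t)" using st
      by (simp_all add: cell1_eq_iff)
    have [simp]: "esrc A B (edom A B s) = etgt A B (edom A B t)" using st by simp
    have [simp]: "esrc A B (edom A B s') = etgt A B (edom A B t)" "etgt A B (edom A B t') = etgt A B (edom A B t)"
      using eq1_wf[OF e(1)] eq1_wf[OF e(2)] by simp_all
    show "hcomp ?C (vcomp ?C x' x) (vcomp ?C y' y) = vcomp ?C (hcomp ?C x' y') (hcomp ?C x y)"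
      by (simp add: eq1_cong) (auto intro!: cell2_eqI eq2_interchange)
  }
qed

lemma restrict_gray: "restrict_twocat AB = AB"
proof -
  interpret two_category "AB" by (rule two_category_gray)
  \<comment> \<open>The guard of \<open>hcomp\<close> applies \<open>src1\<close> and
    \<open>tgt1\<close> to source 1-cells of 2-cells. The restricted maps keep their values there
    only if those 1-cells belong to \<open>Arr1\<close>, hence the hypothesis.\<close>
  have *: "restrict_twocat (restrict_twocat C) = restrict_twocat C"
    if "\<And>\<alpha>. \<alpha> \<in> Arr2 C \<Longrightarrow> src2 C \<alpha> \<in> Arr1 C" for C :: "'u cat2"
    using that by (auto simp: restrict_twocat_def fun_eq_iff)
  show ?thesis using src2_in
    unfolding gray_tensor_def by (intro *) (auto simp: restrict_twocat_def)
qed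

text \<open>Identities need no case of their own: the identity of a \<otimes> b is the generator
  given by the identity of a.\<close>

lemma Arr1_gray_induct [consumes 1, case_names L R comp]:
  assumes "x \<in> Arr1 AB"
    and L: "\<And>f b. f \<in> Arr1 A \<Longrightarrow> b \<in> Obj B \<Longrightarrow> P (map1 (Lfun A B b) f)"
    and R: "\<And>a g. a \<in> Obj A \<Longrightarrow> g \<in> Arr1 B \<Longrightarrow> P (map1 (Rfun A B a) g)"
    and comp: "\<And>x y. x \<in> Arr1 AB \<Longrightarrow> y \<in> Arr1 AB \<Longrightarrow>
      src1 AB x = tgt1 AB y \<Longrightarrow> P x \<Longrightarrow> P y \<Longrightarrow> P (comp1 AB x y)"
  shows "P x"
proof -
  have "P (cell1 A B e)" if "wf1 A B e" for e
    using that
  proof (induction e)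
    case (LGen f b)
    then show ?case using L[of f b] by (simp add: Lfun_def)
  next
    case (RGen a g)
    then show ?case using R[of a g] by (simp add: Rfun_def)
  next
    case (IdE a b)
    then have "cell1 A B (IdE a b) = cell1 A B (LGen (id1 A a) b)"
      by (intro cell1_eqI eq1_sym[OF eq1_L_id]) simp_all
    then show ?case using L[of "id1 A a" b] IdE by (simp add: Lfun_def)
  next
    case (CompE d e)
    then show ?case using comp[of "cell1 A B d" "cell1 A B e"] by (simp add: cell_simps)
  qed
  then show ?thesis using assms(1) by (auto elim: Arr1_grayE)
qed

text \<open>The formal inverse of \<Sigma> is the inverse 2-cell by uniqueness of inverses. Its case
  also receives the property for \<Sigma> itself, so that a statement can be transported along
  inversion.\<close>

lemma Arr2_gray_induct [consumes 1, case_names L R Sig SigInv id vcomp hcomp]: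
  assumes "x \<in> Arr2 AB"
    and L: "\<And>\<alpha> b. \<alpha> \<in> Arr2 A \<Longrightarrow> b \<in> Obj B \<Longrightarrow> P (map2 (Lfun A B b) \<alpha>)"
    and R: "\<And>a \<beta>. a \<in> Obj A \<Longrightarrow> \<beta> \<in> Arr2 B \<Longrightarrow> P (map2 (Rfun A B a) \<beta>)"
    and Sig: "\<And>f g. f \<in> Arr1 A \<Longrightarrow> g \<in> Arr1 B \<Longrightarrow> P (gsig A B f g)"
    and SigInv: "\<And>f g. f \<in> Arr1 A \<Longrightarrow> g \<in> Arr1 B \<Longrightarrow> P (gsig A B f g) \<Longrightarrow>
      P (inv2 AB (gsig A B f g))"
    and id: "\<And>x. x \<in> Arr1 AB \<Longrightarrow> P (id2 AB x)"
    and vcomp: "\<And>x y. x \<in> Arr2 AB \<Longrightarrow> y \<in> Arr2 AB \<Longrightarrow>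
      src2 AB x = tgt2 AB y \<Longrightarrow> P x \<Longrightarrow> P y \<Longrightarrow> P (vcomp AB x y)"
    and hcomp: "\<And>x y. x \<in> Arr2 AB \<Longrightarrow> y \<in> Arr2 AB \<Longrightarrow>
      src1 AB (src2 AB x) = tgt1 AB (src2 AB y) \<Longrightarrow>
      P x \<Longrightarrow> P y \<Longrightarrow> P (hcomp AB x y)"
  shows "P x"
proof -
  interpret AB: two_category "AB" by (rule two_category_gray)
  have "P (cell2 A B t)" if "wf2 A B t" for t
    using that
  proof (induction t)
    case (LCell \<alpha> b)
    then show ?case using L[of \<alpha> b] by (simp add: Lfun_def)
  next
    case (RCell a \<beta>)
    then show ?case using R[of a \<beta>] by (simp add: Rfun_def)
  next
    case (Sig f g)
    then show ?case using assms(4)[of f g] by (simp add: gsig_def)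
  next
    case (SigInv f g)
    have "inverse2 AB (cell2 A B (Sig f g)) (cell2 A B (SigInv f g))"
      using SigInv by (auto simp: inverse2_def cell_simps eq1_refl intro!: cell2_eqI eq2_Sig_inv_left eq2_Sig_inv_right)
    then show ?case using assms(5)[of f g] Sig[of f g] SigInv by (simp add: AB.inv2_eqI gsig_def)
  next
    case (IdC e)
    then show ?case using id[of "cell1 A B e"] by (simp add: cell_simps)
  next
    case (VComp s t)
    moreover have "cell1 A B (edom A B s) = cell1 A B (ecod A B t)"
      using VComp by (simp add: cell1_eqI)
    ultimately show ?case using vcomp[of "cell2 A B s" "cell2 A B t"] by (simp add: cell_simps)
  next
    case (HComp s t)
    then show ?case using hcomp[of "cell2 A B s" "cell2 A B t"] by (simp add: cell_simps wf2_edom_ecod)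
  qed
  then show ?thesis using assms(1) by (auto elim: Arr2_grayE)
qed

end

section \<open>Pseudonatural transformations\<close>

text \<open>The orientation of the cells is that of \<Sigma>: with F and G equal to
  \<open>- \<otimes> b\<close> and \<open>- \<otimes> b'\<close>, and u given by
  \<open>1 \<otimes> g\<close>, the cell at f is \<Sigma>_{f,g}. In the other variable the same
  orientation forces the inverse of \<Sigma>_{f,g}.\<close>

locale pseudonat =
  F: two_functor F + G: two_functor G
  for F G :: "('o, 'm, 'c, 'p, 'n, 'd) twofun" +
  fixes u :: "'o \<Rightarrow> 'n" and s :: "'m \<Rightarrow> 'd"
  assumes same_Dom: "Dom G = Dom F"
    and same_Cod: "Cod G = Cod F"
    and u_in: "x \<in> Obj (Dom F) \<Longrightarrow> u x \<in> Arr1 (Cod F)"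
    and src1_u: "x \<in> Obj (Dom F) \<Longrightarrow> src1 (Cod F) (u x) = map0 F x"
    and tgt1_u: "x \<in> Obj (Dom F) \<Longrightarrow> tgt1 (Cod F) (u x) = map0 G x"
    and s_iso: "f \<in> Arr1 (Dom F) \<Longrightarrow> iso2 (Cod F) (s f)"
    and src2_s: "f \<in> Arr1 (Dom F) \<Longrightarrow> src2 (Cod F) (s f) = comp1 (Cod F) (map1 G f) (u (src1 (Dom F) f))"
    and tgt2_s: "f \<in> Arr1 (Dom F) \<Longrightarrow> tgt2 (Cod F) (s f) = comp1 (Cod F) (u (tgt1 (Dom F) f)) (map1 F f)"
    and s_id1: "x \<in> Obj (Dom F) \<Longrightarrow> s (id1 (Dom F) x) = id2 (Cod F) (u x)"
    and s_comp1: "\<lbrakk>f \<in> Arr1 (Dom F); g \<in> Arr1 (Dom F); src1 (Dom F) f = tgt1 (Dom F) g\<rbrakk> \<Longrightarrow>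
      s (comp1 (Dom F) f g) = vcomp (Cod F) (hcomp (Cod F) (s f) (id2 (Cod F) (map1 F g)))
                                            (hcomp (Cod F) (id2 (Cod F) (map1 G f)) (s g))"
    and s_natural: "\<theta> \<in> Arr2 (Dom F) \<Longrightarrow>
      vcomp (Cod F) (s (tgt2 (Dom F) \<theta>)) (hcomp (Cod F) (map2 G \<theta>) (id2 (Cod F) (u (src1 (Dom F) (src2 (Dom F) \<theta>))))) =
      vcomp (Cod F) (hcomp (Cod F) (id2 (Cod F) (u (tgt1 (Dom F) (src2 (Dom F) \<theta>)))) (map2 F \<theta>)) (s (src2 (Dom F) \<theta>))"
begin

lemmas s_in = F.B.iso2_in[OF s_iso]

lemma G_in [simp]:
  "x \<in> Obj (Dom F) \<Longrightarrow> map0 G x \<in> Obj (Cod F)"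
  "f \<in> Arr1 (Dom F) \<Longrightarrow> map1 G f \<in> Arr1 (Cod F)"
  "\<alpha> \<in> Arr2 (Dom F) \<Longrightarrow> map2 G \<alpha> \<in> Arr2 (Cod F)"
  "f \<in> Arr1 (Dom F) \<Longrightarrow> src1 (Cod F) (map1 G f) = map0 G (src1 (Dom F) f)"
  "f \<in> Arr1 (Dom F) \<Longrightarrow> tgt1 (Cod F) (map1 G f) = map0 G (tgt1 (Dom F) f)"
  "\<alpha> \<in> Arr2 (Dom F) \<Longrightarrow> src2 (Cod F) (map2 G \<alpha>) = map1 G (src2 (Dom F) \<alpha>)"
  "\<alpha> \<in> Arr2 (Dom F) \<Longrightarrow> tgt2 (Cod F) (map2 G \<alpha>) = map1 G (tgt2 (Dom F) \<alpha>)"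
  using G.map_in G.map_st by (simp_all add: same_Dom same_Cod)

lemmas s_simps [simp] = u_in src1_u tgt1_u s_iso src2_s tgt2_s s_in

lemma cong:
  assumes "\<And>x. x \<in> Obj (Dom F) \<Longrightarrow> u' x = u x" "\<And>f. f \<in> Arr1 (Dom F) \<Longrightarrow> s' f = s f"
  shows "pseudonat F G u' s'"
  using s_id1 s_comp1 s_natural
  by unfold_locales (auto simp: assms same_Dom same_Cod)

lemma comp_left:
  assumes "two_functor K" "Dom K = Cod F"
  shows "pseudonat (comp_fun K F) (comp_fun K G) (\<lambda>x. map1 K (u x)) (\<lambda>f. map2 K (s f))"
proof -
  let ?A = "Dom F" and ?C = "Cod K"
  note [simp] = assms same_Dom same_Cod F.B.comp1_assoc F.two_functor_axioms G.two_functor_axioms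
  have natural: "vcomp ?C (map2 K (s (tgt2 ?A \<theta>))) (hcomp ?C (map2 K (map2 G \<theta>)) (id2 ?C (map1 K (u (src1 ?A (src2 ?A \<theta>)))))) =
      vcomp ?C (hcomp ?C (id2 ?C (map1 K (u (tgt1 ?A (src2 ?A \<theta>))))) (map2 K (map2 F \<theta>))) (map2 K (s (src2 ?A \<theta>)))"
    if "\<theta> \<in> Arr2 ?A" for \<theta>
    using arg_cong[OF s_natural[OF that], of "map2 K"] that by (simp add: two_functor_maps)
  show ?thesis
    by (intro pseudonat.intro pseudonat_axioms.intro) (use natural
      in \<open>simp_all add: two_functor_maps s_id1 s_comp1\<close>)
qed

lemma comp_right:
  assumes "two_functor H" "Cod H = Dom F"
  shows "pseudonat (comp_fun F H) (comp_fun G H) (\<lambda>x. u (map0 H x)) (\<lambda>f. s (map1 H f))"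
proof -
  interpret H: two_functor H by fact
  note [simp] = assms same_Dom same_Cod F.two_functor_axioms G.two_functor_axioms
  have "vcomp (Cod F) (s (map1 H (tgt2 (Dom H) \<theta>))) (hcomp (Cod F) (map2 G (map2 H \<theta>)) (id2 (Cod F) (u (map0 H (src1 (Dom H) (src2 (Dom H) \<theta>)))))) =
      vcomp (Cod F) (hcomp (Cod F) (id2 (Cod F) (u (map0 H (tgt1 (Dom H) (src2 (Dom H) \<theta>))))) (map2 F (map2 H \<theta>))) (s (map1 H (src2 (Dom H) \<theta>)))"
    if "\<theta> \<in> Arr2 (Dom H)" for \<theta>
    using s_natural[of "map2 H \<theta>"] that by simp
  then show ?thesis
    by (intro pseudonat.intro pseudonat_axioms.intro) (simp_all add: two_functor_maps s_id1 s_comp1)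
qed

end

text \<open>Vertical pasting of the squares of s and t. It supplies the composite case when
  pseudonaturality of the associator datum is proved by induction on a 1-cell of A \<otimes>
  B.\<close>

lemma pseudonat_vcomp:
  assumes "pseudonat F G u s" "pseudonat G H v t"
  shows "pseudonat F H (\<lambda>x. comp1 (Cod F) (v x) (u x))
    (\<lambda>f. vcomp (Cod F) (hcomp (Cod F) (id2 (Cod F) (v (tgt1 (Dom F) f))) (s f))
                       (hcomp (Cod F) (t f) (id2 (Cod F) (u (src1 (Dom F) f)))))"
proof -
  interpret s: pseudonat F G u s by fact
  interpret t: pseudonat G H v t by fact
  let ?C = "Cod F" and ?D = "Dom F"
  let ?st = "\<lambda>f. vcomp ?C (hcomp ?C (id2 ?C (v (tgt1 ?D f))) (s f)) (hcomp ?C (t f) (id2 ?C (u (src1 ?D f))))"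
  note [simp] = s.same_Dom s.same_Cod t.same_Dom t.same_Cod s.F.B.comp1_assoc
  note [simp] = t.s_simps[simplified] t.G_in[simplified]
  note normalize = s.F.B.whisker_left_vcomp s.F.B.whisker_right_vcomp s.F.B.hcomp_assoc s.F.B.vcomp_assoc
  have comp: "?st (comp1 ?D f g) = vcomp ?C (hcomp ?C (?st f) (id2 ?C (map1 F g))) (hcomp ?C (id2 ?C (map1 H f)) (?st g))"
    if fg [simp]: "f \<in> Arr1 ?D" "g \<in> Arr1 ?D" "src1 ?D f = tgt1 ?D g" for f g
  proof -
    let ?a = "hcomp ?C (id2 ?C (v (tgt1 ?D f))) (hcomp ?C (s f) (id2 ?C (map1 F g)))"
      and ?d = "hcomp ?C (id2 ?C (map1 H f)) (hcomp ?C (t g) (id2 ?C (u (src1 ?D g))))"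
    have "?st (comp1 ?D f g) =
       vcomp ?C ?a (vcomp ?C (vcomp ?C (hcomp ?C (id2 ?C (comp1 ?C (v (tgt1 ?D f)) (map1 G f))) (s g))
          (hcomp ?C (t f) (id2 ?C (comp1 ?C (map1 G g) (u (src1 ?D g)))))) ?d)"
      using t.s_comp1[of f g] by (simp add: s.s_comp1 normalize flip: s.F.B.hcomp_id2)
    \<comment> \<open>The cells \<open>t f\<close> and \<open>s g\<close> occupy adjacent positions;
      both sides are the two factorisations of their horizontal composite.\<close>
    also have "vcomp ?C (hcomp ?C (id2 ?C (comp1 ?C (v (tgt1 ?D f)) (map1 G f))) (s g))
          (hcomp ?C (t f) (id2 ?C (comp1 ?C (map1 G g) (u (src1 ?D g))))) =
       vcomp ?C (hcomp ?C (t f) (id2 ?C (comp1 ?C (u (tgt1 ?D g)) (map1 F g))))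
          (hcomp ?C (id2 ?C (comp1 ?C (map1 H f) (v (src1 ?D f)))) (s g))"
      using s.F.B.hcomp_eq_left_right[of "t f" "s g"] s.F.B.hcomp_eq_right_left[of "t f" "s g"] by simp
    also have "vcomp ?C ?a (vcomp ?C \<dots> ?d) =
        vcomp ?C (hcomp ?C (?st f) (id2 ?C (map1 F g))) (hcomp ?C (id2 ?C (map1 H f)) (?st g))"
      by (simp add: normalize flip: s.F.B.hcomp_id2)
    finally show ?thesis .
  qed
  have natural: "vcomp ?C (?st (tgt2 ?D \<theta>)) (hcomp ?C (map2 H \<theta>) (id2 ?C (comp1 ?C (v (src1 ?D (src2 ?D \<theta>))) (u (src1 ?D (src2 ?D \<theta>)))))) =
      vcomp ?C (hcomp ?C (id2 ?C (comp1 ?C (v (tgt1 ?D (src2 ?D \<theta>))) (u (tgt1 ?D (src2 ?D \<theta>))))) (map2 F \<theta>)) (?st (src2 ?D \<theta>))"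
    if [simp]: "\<theta> \<in> Arr2 ?D" for \<theta>
  proof -
    let ?f = "src2 ?D \<theta>" and ?g = "tgt2 ?D \<theta>"
    let ?x = "src1 ?D ?f" and ?y = "tgt1 ?D ?f"
    have "vcomp ?C (?st ?g) (hcomp ?C (map2 H \<theta>) (id2 ?C (comp1 ?C (v ?x) (u ?x)))) =
      vcomp ?C (hcomp ?C (id2 ?C (v ?y)) (s ?g)) (hcomp ?C (vcomp ?C (t ?g) (hcomp ?C (map2 H \<theta>) (id2 ?C (v ?x)))) (id2 ?C (u ?x)))"
      by (simp add: normalize flip: s.F.B.hcomp_id2)
    also have "vcomp ?C (t ?g) (hcomp ?C (map2 H \<theta>) (id2 ?C (v ?x)))
      = vcomp ?C (hcomp ?C (id2 ?C (v ?y)) (map2 G \<theta>)) (t ?f)"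
      using t.s_natural[of \<theta>] by simp
    also have "vcomp ?C (hcomp ?C (id2 ?C (v ?y)) (s ?g)) (hcomp ?C \<dots> (id2 ?C (u ?x))) =
      vcomp ?C (hcomp ?C (id2 ?C (v ?y)) (vcomp ?C (s ?g) (hcomp ?C (map2 G \<theta>) (id2 ?C (u ?x))))) (hcomp ?C (t ?f) (id2 ?C (u ?x)))"
      by (simp add: normalize)
    also have "vcomp ?C (s ?g) (hcomp ?C (map2 G \<theta>) (id2 ?C (u ?x)))
      = vcomp ?C (hcomp ?C (id2 ?C (u ?y)) (map2 F \<theta>)) (s ?f)"
      using s.s_natural[of \<theta>] by simp
    also have "vcomp ?C (hcomp ?C (id2 ?C (v ?y)) \<dots>) (hcomp ?C (t ?f) (id2 ?C (u ?x))) =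
        vcomp ?C (hcomp ?C (id2 ?C (comp1 ?C (v ?y) (u ?y))) (map2 F \<theta>)) (?st ?f)"
      by (simp add: normalize flip: s.F.B.hcomp_id2)
    finally show ?thesis .
  qed
  show ?thesis
    by (intro pseudonat.intro pseudonat_axioms.intro s.F.two_functor_axioms t.G.two_functor_axioms)
      (use comp natural t.s_id1 in \<open>simp_all add: s.s_id1 s.F.B.hcomp_id2\<close>)
qed

text \<open>The arrow category of a 2-category: its morphisms \<open>(u, u', p, q, \<sigma>)\<close> from the 1-cell \<open>u\<close> to the 1-cell \<open>u'\<close>
  are squares filled by an invertible \<open>\<sigma> : q * u \<Rightarrow> u' * p\<close>.\<close>

definition squares :: "('o, 'm, 'c) twocat \<Rightarrow> ('m \<times> 'm \<times> 'm \<times> 'm \<times> 'c) set" where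
  "squares C = {(u, u', p, q, \<sigma>). u \<in> Arr1 C \<and> u' \<in> Arr1 C \<and> p \<in> Arr1 C \<and> q \<in> Arr1 C \<and>
     src1 C p = src1 C u \<and> tgt1 C p = src1 C u' \<and> src1 C q = tgt1 C u \<and> tgt1 C q = tgt1 C u' \<and>
     iso2 C \<sigma> \<and> src2 C \<sigma> = comp1 C q u \<and> tgt2 C \<sigma> = comp1 C u' p}"

definition paste :: "('o, 'm, 'c) twocat \<Rightarrow> 'm \<times> 'm \<times> 'm \<times> 'm \<times> 'c \<Rightarrow> 'm \<times> 'm \<times> 'm \<times> 'm \<times> 'c \<Rightarrow> 'm \<times> 'm \<times> 'm \<times> 'm \<times> 'c" where
  "paste C = (\<lambda>(v, v', p', q', \<tau>) (u, u', p, q, \<sigma>). (u, v', comp1 C p' p, comp1 C q' q,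
     vcomp C (hcomp C \<tau> (id2 C p)) (hcomp C (id2 C q') \<sigma>)))"

text \<open>The last component of \<open>paste\<close> is the right-hand side of
  \<open>s_comp1\<close>. Hence the conditions of a pseudonatural transformation on 1-cells amount
  to functoriality into this category, and only naturality at 2-cells remains.\<close>

lemma (in two_category) one_category_squares:
  "one_category (Arr1 C) (squares C) fst (fst \<circ> snd)
     (\<lambda>u. (u, u, id1 C (src1 C u), id1 C (tgt1 C u), id2 C u)) (paste C)"
proof
  fix f g h assume "f \<in> squares C" "g \<in> squares C" "h \<in> squares C" "fst f = (fst \<circ> snd) g" "fst g = (fst \<circ> snd) h"
  then show "paste C (paste C f g) h = paste C f (paste C g h)"
    by (auto simp: squares_def paste_def comp1_assoc iso2_in whisker_left_vcomp whisker_right_vcomp hcomp_assoc vcomp_assoc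
           simp flip: hcomp_id2)
qed (auto simp: squares_def paste_def comp1_assoc iso2_in hcomp_id2)

section \<open>The universal property of the Gray tensor product\<close>

text \<open>The data and axioms of a 2-functor out of \<open>A \<otimes> B\<close>, the relations for \<open>\<Sigma>\<close> being stated as
  pseudonaturality of \<open>\<Sigma>\<close> in each variable; this form is symmetric in \<open>A\<close> and \<open>B\<close>.\<close>

locale cubical = A: two_category A + B: two_category B + D: two_category D
  for A B :: "'u cat2" and D :: "('p, 'n, 'd) twocat" +
  fixes P Q :: "'u \<Rightarrow> ('u, 'u, 'u, 'p, 'n, 'd) twofun" and S :: "'u \<Rightarrow> 'u \<Rightarrow> 'd"
  assumes P: "b \<in> Obj B \<Longrightarrow> two_functor (P b) \<and> Dom (P b) = A \<and> Cod (P b) = D"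
    and Q: "a \<in> Obj A \<Longrightarrow> two_functor (Q a) \<and> Dom (Q a) = B \<and> Cod (Q a) = D"
    and PQ: "a \<in> Obj A \<Longrightarrow> b \<in> Obj B \<Longrightarrow> map0 (Q a) b = map0 (P b) a"
    and natP: "g \<in> Arr1 B \<Longrightarrow> pseudonat (P (src1 B g)) (P (tgt1 B g)) (\<lambda>a. map1 (Q a) g) (\<lambda>f. S f g)"
    and natQ: "f \<in> Arr1 A \<Longrightarrow> pseudonat (Q (src1 A f)) (Q (tgt1 A f)) (\<lambda>b. map1 (P b) f) (\<lambda>g. inv2 D (S f g))"
begin

lemma P_simps [simp]:
  assumes "b \<in> Obj B"
  shows "two_functor (P b)" "Dom (P b) = A" "Cod (P b) = D"
  using P[OF assms] by auto

lemma Q_simps [simp]: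
  assumes "a \<in> Obj A"
  shows "two_functor (Q a)" "Dom (Q a) = B" "Cod (Q a) = D"
    and "b \<in> Obj B \<Longrightarrow> map0 (Q a) b = map0 (P b) a"
  using Q[OF assms] PQ[OF assms] by auto

lemma S_simps [simp]:
  assumes "f \<in> Arr1 A" "g \<in> Arr1 B"
  shows "iso2 D (S f g)" "S f g \<in> Arr2 D"
    and "src2 D (S f g) = comp1 D (map1 (P (tgt1 B g)) f) (map1 (Q (src1 A f)) g)"
    and "tgt2 D (S f g) = comp1 D (map1 (Q (tgt1 A f)) g) (map1 (P (src1 B g)) f)"
proof -
  interpret pseudonat "P (src1 B g)" "P (tgt1 B g)" "\<lambda>a. map1 (Q a) g" "\<lambda>f. S f g" by (rule natP) fact
  show "iso2 D (S f g)" "S f g \<in> Arr2 D"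
    "src2 D (S f g) = comp1 D (map1 (P (tgt1 B g)) f) (map1 (Q (src1 A f)) g)"
    "tgt2 D (S f g) = comp1 D (map1 (Q (tgt1 A f)) g) (map1 (P (src1 B g)) f)"
    using assms s_iso s_in src2_s tgt2_s by simp_all
qed

lemma S_natural_left:
  assumes "\<alpha> \<in> Arr2 A" "g \<in> Arr1 B"
  shows "vcomp D (S (tgt2 A \<alpha>) g) (hcomp D (map2 (P (tgt1 B g)) \<alpha>) (id2 D (map1 (Q (src1 A (src2 A \<alpha>))) g))) =
    vcomp D (hcomp D (id2 D (map1 (Q (tgt1 A (src2 A \<alpha>))) g)) (map2 (P (src1 B g)) \<alpha>)) (S (src2 A \<alpha>) g)"
  using pseudonat.s_natural[OF natP[OF assms(2)]] assms by simp

text \<open>\<open>natQ\<close> concerns the inverse of S, so its naturality square is inverted once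
  more.\<close>

lemma S_natural_right:
  assumes "f \<in> Arr1 A" "\<beta> \<in> Arr2 B"
  shows "vcomp D (S f (tgt2 B \<beta>)) (hcomp D (id2 D (map1 (P (tgt1 B (src2 B \<beta>))) f)) (map2 (Q (src1 A f)) \<beta>)) =
    vcomp D (hcomp D (map2 (Q (tgt1 A f)) \<beta>) (id2 D (map1 (P (src1 B (src2 B \<beta>))) f))) (S f (src2 B \<beta>))"
proof -
  have "vcomp D (inv2 D (S f (tgt2 B \<beta>))) (hcomp D (map2 (Q (tgt1 A f)) \<beta>) (id2 D (map1 (P (src1 B (src2 B \<beta>))) f))) =
     vcomp D (hcomp D (id2 D (map1 (P (tgt1 B (src2 B \<beta>))) f)) (map2 (Q (src1 A f)) \<beta>)) (inv2 D (S f (src2 B \<beta>)))"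
    using pseudonat.s_natural[OF natQ[OF assms(1)]] assms by simp
  from D.vcomp_inv2_commute[OF _ _ _ _ _ _ _ _ this] show ?thesis using assms by simp
qed

text \<open>Recovers the two-variable relation of the presentation from the one-variable squares:
  the horizontal composite of the images of \<alpha> and \<beta> factors into whiskerings, and S is
  moved across one of them at a time.\<close>

lemma S_natural:
  assumes "\<alpha> \<in> Arr2 A" "\<beta> \<in> Arr2 B"
  shows "vcomp D (S (tgt2 A \<alpha>) (tgt2 B \<beta>)) (hcomp D (map2 (P (tgt1 B (src2 B \<beta>))) \<alpha>) (map2 (Q (src1 A (src2 A \<alpha>))) \<beta>)) =
    vcomp D (hcomp D (map2 (Q (tgt1 A (src2 A \<alpha>))) \<beta>) (map2 (P (src1 B (src2 B \<beta>))) \<alpha>)) (S (src2 A \<alpha>) (src2 B \<beta>))"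
proof -
  note [simp] = assms
  let ?f = "src2 A \<alpha>" and ?f' = "tgt2 A \<alpha>" and ?g = "src2 B \<beta>" and ?g' = "tgt2 B \<beta>"
  let ?P = "P (src1 B ?g)" and ?P' = "P (tgt1 B ?g)" and ?Q = "Q (src1 A ?f)" and ?Q' = "Q (tgt1 A ?f)"
  have "vcomp D (S ?f' ?g') (hcomp D (map2 ?P' \<alpha>) (map2 ?Q \<beta>)) =
    vcomp D (vcomp D (S ?f' ?g') (hcomp D (map2 ?P' \<alpha>) (id2 D (map1 ?Q ?g')))) (hcomp D (id2 D (map1 ?P' ?f)) (map2 ?Q \<beta>))"
    using D.hcomp_eq_right_left[of "map2 ?P' \<alpha>" "map2 ?Q \<beta>"] by (simp add: D.vcomp_assoc)
  also have "\<dots> = vcomp D (hcomp D (id2 D (map1 ?Q' ?g')) (map2 ?P \<alpha>)) (vcomp D (S ?f ?g') (hcomp D (id2 D (map1 ?P' ?f)) (map2 ?Q \<beta>)))"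
    using S_natural_left[of \<alpha> ?g'] by (simp add: D.vcomp_assoc)
  also have "\<dots> = vcomp D (vcomp D (hcomp D (id2 D (map1 ?Q' ?g')) (map2 ?P \<alpha>)) (hcomp D (map2 ?Q' \<beta>) (id2 D (map1 ?P ?f)))) (S ?f ?g)"
    using S_natural_right[of ?f \<beta>] by (simp add: D.vcomp_assoc)
  also have "vcomp D (hcomp D (id2 D (map1 ?Q' ?g')) (map2 ?P \<alpha>)) (hcomp D (map2 ?Q' \<beta>) (id2 D (map1 ?P ?f))) =
      hcomp D (map2 ?Q' \<beta>) (map2 ?P \<alpha>)"
    using D.hcomp_eq_left_right[of "map2 ?Q' \<beta>" "map2 ?P \<alpha>"] by simp
  finally show ?thesis .
qed

lemma S_id_left: "a \<in> Obj A \<Longrightarrow> g \<in> Arr1 B \<Longrightarrow> S (id1 A a) g = id2 D (map1 (Q a) g)"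
  using pseudonat.s_id1[OF natP] by simp

lemma S_comp_left:
  assumes "f \<in> Arr1 A" "f' \<in> Arr1 A" "src1 A f' = tgt1 A f" "g \<in> Arr1 B"
  shows "S (comp1 A f' f) g = vcomp D (hcomp D (S f' g) (id2 D (map1 (P (src1 B g)) f)))
                                      (hcomp D (id2 D (map1 (P (tgt1 B g)) f')) (S f g))"
  using pseudonat.s_comp1[OF natP] assms by simp

lemma S_id_right:
  assumes "f \<in> Arr1 A" "b \<in> Obj B"
  shows "S f (id1 B b) = id2 D (map1 (P b) f)"
proof -
  have *: "inv2 D (S f (id1 B b)) = id2 D (map1 (P b) f)"
    using pseudonat.s_id1[OF natQ[OF assms(1)]] assms by simp
  have "S f (id1 B b) = inv2 D (inv2 D (S f (id1 B b)))" using assms by simp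
  also have "\<dots> = id2 D (map1 (P b) f)" unfolding * using assms by simp
  finally show ?thesis .
qed

lemma S_comp_right:
  assumes "f \<in> Arr1 A" "g \<in> Arr1 B" "g' \<in> Arr1 B" "src1 B g' = tgt1 B g"
  shows "S f (comp1 B g' g) = vcomp D (hcomp D (id2 D (map1 (Q (tgt1 A f)) g')) (S f g))
                                      (hcomp D (S f g') (id2 D (map1 (Q (src1 A f)) g)))"
proof -
  have *: "inv2 D (S f (comp1 B g' g)) = vcomp D (hcomp D (inv2 D (S f g')) (id2 D (map1 (Q (src1 A f)) g)))
      (hcomp D (id2 D (map1 (Q (tgt1 A f)) g')) (inv2 D (S f g)))"
    using pseudonat.s_comp1[OF natQ[OF assms(1)]] assms by simp
  have "S f (comp1 B g' g) = inv2 D (inv2 D (S f (comp1 B g' g)))" using assms by simp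
  then show ?thesis
    unfolding * using assms by (simp add: D.inv2_vcomp D.inv2_hcomp D.comp1_assoc)
qed

text \<open>The axioms are symmetric under exchanging the two variables and inverting S, since S and
  its inverse enter them in the same way. This is the source of the symmetry of \<otimes>.\<close>

lemma cubical_swap: "cubical B A D Q P (\<lambda>g f. inv2 D (S f g))"
proof (intro cubical.intro cubical_axioms.intro A.two_category_axioms B.two_category_axioms D.two_category_axioms)
  fix f assume "f \<in> Arr1 A"
  then show "pseudonat (Q (src1 A f)) (Q (tgt1 A f)) (\<lambda>b. map1 (P b) f) (\<lambda>g. inv2 D (S f g))" by (rule natQ)
next
  fix g assume "g \<in> Arr1 B"
  then show "pseudonat (P (src1 B g)) (P (tgt1 B g)) (\<lambda>a. map1 (Q a) g) (\<lambda>f. inv2 D (inv2 D (S f g)))"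
    by (intro pseudonat.cong[OF natP]) simp_all
qed simp_all

text \<open>Restriction along a pair of 2-functors. Applied to the universal data of the codomain it
  yields the data of F \<otimes> G.\<close>

lemma cubical_comp_right:
  assumes "two_functor F" "two_functor G" "Dom F = A'" "Cod F = A" "Dom G = B'" "Cod G = B"
  shows "cubical A' B' D (\<lambda>b. comp_fun (P (map0 G b)) F) (\<lambda>a. comp_fun (Q (map0 F a)) G) (\<lambda>f g. S (map1 F f) (map1 G g))"
proof -
  interpret F: two_functor F by fact
  interpret G: two_functor G by fact
  note [simp] = assms
  interpret A': two_category A' using F.A.two_category_axioms by simp
  interpret B': two_category B' using G.A.two_category_axioms by simp
  show ?thesis
  proof (intro cubical.intro cubical_axioms.intro A'.two_category_axioms B'.two_category_axioms D.two_category_axioms)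
    fix g assume g: "g \<in> Arr1 B'"
    show "pseudonat (comp_fun (P (map0 G (src1 B' g))) F) (comp_fun (P (map0 G (tgt1 B' g))) F)
          (\<lambda>a. map1 (comp_fun (Q (map0 F a)) G) g) (\<lambda>f. S (map1 F f) (map1 G g))"
      using pseudonat.cong[OF pseudonat.comp_right[OF natP[of "map1 G g"] assms(1)]] g by simp
  next
    fix f assume f: "f \<in> Arr1 A'"
    show "pseudonat (comp_fun (Q (map0 F (src1 A' f))) G) (comp_fun (Q (map0 F (tgt1 A' f))) G)
          (\<lambda>b. map1 (comp_fun (P (map0 G b)) F) f) (\<lambda>g. inv2 D (S (map1 F f) (map1 G g)))"
      using pseudonat.cong[OF pseudonat.comp_right[OF natQ[of "map1 F f"] assms(2)]] f by simp
  qed simp_all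
qed

end

section \<open>Existence of extensions from generators\<close>

primrec eval1 :: "('o \<Rightarrow> 'm) \<Rightarrow> ('m \<Rightarrow> 'm \<Rightarrow> 'm) \<Rightarrow> ('u \<Rightarrow> 'o) \<Rightarrow> ('u \<Rightarrow> 'u \<Rightarrow> 'm) \<Rightarrow> ('u \<Rightarrow> 'u \<Rightarrow> 'm) \<Rightarrow> 'u gexp1 \<Rightarrow> 'm" where
  "eval1 idt cmp ob L R (LGen f b) = L f b"
| "eval1 idt cmp ob L R (RGen a g) = R a g"
| "eval1 idt cmp ob L R (IdE a b) = idt (ob (code (a, b)))"
| "eval1 idt cmp ob L R (CompE d e) = cmp (eval1 idt cmp ob L R d) (eval1 idt cmp ob L R e)"

text \<open>The argument E is the action on 1-cells already lifted to classes, which makes the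
  clause for identity 2-cells invariant under \<open>eq1\<close>.\<close>

primrec eval2 :: "('u \<Rightarrow> 'n) \<Rightarrow> 'u cat2 \<Rightarrow> 'u cat2 \<Rightarrow> ('p, 'n, 'd) twocat \<Rightarrow> ('u \<Rightarrow> ('u, 'u, 'u, 'p, 'n, 'd) twofun) \<Rightarrow>
    ('u \<Rightarrow> ('u, 'u, 'u, 'p, 'n, 'd) twofun) \<Rightarrow> ('u \<Rightarrow> 'u \<Rightarrow> 'd) \<Rightarrow> 'u gexp2 \<Rightarrow> 'd" where
  "eval2 E A B D P Q S (LCell \<alpha> b) = map2 (P b) \<alpha>"
| "eval2 E A B D P Q S (RCell a \<beta>) = map2 (Q a) \<beta>"
| "eval2 E A B D P Q S (Sig f g) = S f g"
| "eval2 E A B D P Q S (SigInv f g) = inv2 D (S f g)"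
| "eval2 E A B D P Q S (IdC e) = id2 D (E (cell1 A B e))"
| "eval2 E A B D P Q S (VComp s t) = vcomp D (eval2 E A B D P Q S s) (eval2 E A B D P Q S t)"
| "eval2 E A B D P Q S (HComp s t) = hcomp D (eval2 E A B D P Q S s) (eval2 E A B D P Q S t)"

locale lifts_cells1 =
  fixes A B :: "'u cat2" and Ar :: "'m set" and dm cd :: "'m \<Rightarrow> 'o" and idt :: "'o \<Rightarrow> 'm" and cmp :: "'m \<Rightarrow> 'm \<Rightarrow> 'm"
    and ob :: "'u \<Rightarrow> 'o" and L R :: "'u \<Rightarrow> 'u \<Rightarrow> 'm" and E :: "'u \<Rightarrow> 'm"
  assumes in_Ar: "x \<in> Arr1 (A \<otimes> B) \<Longrightarrow> E x \<in> Ar"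
    and dm: "x \<in> Arr1 (A \<otimes> B) \<Longrightarrow> dm (E x) = ob (src1 (A \<otimes> B) x)"
    and cd: "x \<in> Arr1 (A \<otimes> B) \<Longrightarrow> cd (E x) = ob (tgt1 (A \<otimes> B) x)"
    and id1: "x \<in> Obj (A \<otimes> B) \<Longrightarrow> E (id1 (A \<otimes> B) x) = idt (ob x)"
    and comp1: "\<lbrakk>x \<in> Arr1 (A \<otimes> B); y \<in> Arr1 (A \<otimes> B); src1 (A \<otimes> B) x = tgt1 (A \<otimes> B) y\<rbrakk> \<Longrightarrow>
      E (comp1 (A \<otimes> B) x y) = cmp (E x) (E y)"
    and L: "f \<in> Arr1 A \<Longrightarrow> b \<in> Obj B \<Longrightarrow> E (map1 (Lfun A B b) f) = L f b"
    and R: "a \<in> Obj A \<Longrightarrow> g \<in> Arr1 B \<Longrightarrow> E (map1 (Rfun A B a) g) = R a g"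

text \<open>Constraints chosen by \<open>SOME\<close> below have no other defining property than
  this one; functoriality and values on generators are all that is used of them.\<close>

locale lifts_cubical =
  fixes A B :: "'u cat2" and D :: "('p, 'n, 'd) twocat" and P Q :: "'u \<Rightarrow> ('u, 'u, 'u, 'p, 'n, 'd) twofun"
    and S :: "'u \<Rightarrow> 'u \<Rightarrow> 'd" and K :: "('u, 'u, 'u, 'p, 'n, 'd) twofun"
  assumes functor_K: "two_functor K" "Dom K = A \<otimes> B" "Cod K = D"
    and ob: "a \<in> Obj A \<Longrightarrow> b \<in> Obj B \<Longrightarrow> map0 K (code (a, b)) = map0 (P b) a"
    and L1: "f \<in> Arr1 A \<Longrightarrow> b \<in> Obj B \<Longrightarrow> map1 K (map1 (Lfun A B b) f) = map1 (P b) f"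
    and R1: "a \<in> Obj A \<Longrightarrow> g \<in> Arr1 B \<Longrightarrow> map1 K (map1 (Rfun A B a) g) = map1 (Q a) g"
    and L2: "\<alpha> \<in> Arr2 A \<Longrightarrow> b \<in> Obj B \<Longrightarrow> map2 K (map2 (Lfun A B b) \<alpha>) = map2 (P b) \<alpha>"
    and R2: "a \<in> Obj A \<Longrightarrow> \<beta> \<in> Arr2 B \<Longrightarrow> map2 K (map2 (Rfun A B a) \<beta>) = map2 (Q a) \<beta>"
    and S: "f \<in> Arr1 A \<Longrightarrow> g \<in> Arr1 B \<Longrightarrow> map2 K (gsig A B f g) = S f g"
begin

lemmas maps = functor_K ob L1 R1 L2 R2 S

end

context gray_pair
begin

text \<open>L and R only have to agree on objects and be functorial separately: \<Sigma> is a 2-cell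
  and imposes no equation on 1-cells.\<close>

lemma lift_cells1:
  assumes "one_category Ob Ar dm cd idt cmp"
    and ob: "\<And>x. x \<in> Obj AB \<Longrightarrow> ob x \<in> Ob"
    and L: "\<And>f b. f \<in> Arr1 A \<Longrightarrow> b \<in> Obj B \<Longrightarrow>
      L f b \<in> Ar \<and> dm (L f b) = ob (code (src1 A f, b)) \<and> cd (L f b) = ob (code (tgt1 A f, b))"
    and L_id: "\<And>a b. a \<in> Obj A \<Longrightarrow> b \<in> Obj B \<Longrightarrow> L (id1 A a) b = idt (ob (code (a, b)))"
    and L_comp: "\<And>f f' b. f \<in> Arr1 A \<Longrightarrow> f' \<in> Arr1 A \<Longrightarrow> src1 A f' = tgt1 A f \<Longrightarrow> b \<in> Obj B \<Longrightarrow>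
      L (comp1 A f' f) b = cmp (L f' b) (L f b)"
    and R: "\<And>a g. a \<in> Obj A \<Longrightarrow> g \<in> Arr1 B \<Longrightarrow>
      R a g \<in> Ar \<and> dm (R a g) = ob (code (a, src1 B g)) \<and> cd (R a g) = ob (code (a, tgt1 B g))"
    and R_id: "\<And>a b. a \<in> Obj A \<Longrightarrow> b \<in> Obj B \<Longrightarrow> R a (id1 B b) = idt (ob (code (a, b)))"
    and R_comp: "\<And>a g g'. a \<in> Obj A \<Longrightarrow> g \<in> Arr1 B \<Longrightarrow> g' \<in> Arr1 B \<Longrightarrow> src1 B g' = tgt1 B g \<Longrightarrow>
      R a (comp1 B g' g) = cmp (R a g') (R a g)"
  obtains E where "lifts_cells1 A B Ar dm cd idt cmp ob L R E"
proof -
  interpret one_category Ob Ar dm cd idt cmp by fact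
  let ?E = "eval1 idt cmp ob L R"
  have [simp]: "ob (code (a, b)) \<in> Ob" if "a \<in> Obj A" "b \<in> Obj B" for a b
    using that by (intro ob) (simp add: Obj_gray)
  have wt: "?E e \<in> Ar \<and> dm (?E e) = ob (code (esrc A B e)) \<and> cd (?E e) = ob (code (etgt A B e))" if "wf1 A B e"
    for e
    using that by (induction e) (simp_all add: L R)
  have eq: "?E d = ?E e" if "eq1 A B d e" for d e
    using that
  proof (induction rule: eq1.induct)
    case (eq1_assoc c d e)
    then show ?case using wt[of c] wt[of d] wt[of e] by (simp add: cmp_assoc)
  next
    case (eq1_id_left e a b)
    then show ?case using wt[of e] by simp
  next
    case (eq1_id_right e a b)
    then show ?case using wt[of e] by simp
  qed (simp_all add: L_id L_comp R_id R_comp)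
  \<comment> \<open>Evaluation respects \<open>eq1\<close>, so its value at the chosen
    representative is its value at any expression of the class.\<close>
  have cell: "?E (decode (cell1 A B e)) = ?E e" if "wf1 A B e" for e
    using eq[OF eq1_decode_cell1[OF that]] by simp
  show thesis
  proof (rule that[of "\<lambda>x. ?E (decode x)"], intro lifts_cells1.intro)
    fix x assume "x \<in> Arr1 AB"
    then show "?E (decode x) \<in> Ar" "dm (?E (decode x)) = ob (src1 AB x)" "cd (?E (decode x)) = ob (tgt1 AB x)"
      by (elim Arr1_grayE; simp add: cell wt cell_simps)+
  next
    fix x assume "x \<in> Obj AB"
    then show "?E (decode (id1 AB x)) = idt (ob x)"
      by (elim Obj_grayE) (simp add: cell id1_code)
  next
    fix x y assume "x \<in> Arr1 AB" "y \<in> Arr1 AB" "src1 AB x = tgt1 AB y"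
    then show "?E (decode (comp1 AB x y)) = cmp (?E (decode x)) (?E (decode y))"
      by (elim Arr1_grayE) (simp add: cell cell_simps)
  qed (simp_all add: Lfun_def Rfun_def cell)
qed

text \<open>Existence half of the universal property. 1-cells are lifted first, because typing of
  2-cell values and the clause for identities already mention them; every rule of \<open>eq2\<close>
  then holds by an axiom of D, by functoriality of P and Q, or by a property of S.\<close>

lemma lift_cubical:
  assumes "cubical A B D P Q S"
  obtains K where "lifts_cubical A B D P Q S K"
proof -
  interpret cubical A B D P Q S by fact
  let ?ob = "\<lambda>x. case decode x of (a, b) \<Rightarrow> map0 (P b) a"
  have ob: "?ob x \<in> Obj D" if "x \<in> Obj AB" for x
    using that by (elim Obj_grayE) simp
  obtain E where E: "lifts_cells1 A B (Arr1 D) (src1 D) (tgt1 D) (id1 D) (comp1 D) ?ob (\<lambda>f b. map1 (P b) f) (\<lambda>a g. map1 (Q a) g) E"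
    by (rule lift_cells1[OF D.one_category_cells1, of ?ob "\<lambda>f b. map1 (P b) f" "\<lambda>a g. map1 (Q a) g"])
      (simp_all add: ob two_functor_maps)
  interpret E: lifts_cells1 A B "Arr1 D" "src1 D" "tgt1 D" "id1 D" "comp1 D" ?ob "\<lambda>f b. map1 (P b) f" "\<lambda>a g. map1 (Q a) g" E
    by (rule E)
  note E_in = E.in_Ar E.dm E.cd and E_id = E.id1 and E_comp = E.comp1 and EL = E.L and ER = E.R
  let ?E = "\<lambda>e. E (cell1 A B e)" and ?F = "eval2 E A B D P Q S"
  have E_cell [simp]: "?E (LGen f b) = map1 (P b) f" if "f \<in> Arr1 A" "b \<in> Obj B" for f b
    using EL[OF that] that by (simp add: Lfun_def)
  have E_cell2 [simp]: "?E (RGen a g) = map1 (Q a) g" if "g \<in> Arr1 B" "a \<in> Obj A" for a g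
    using ER[OF that(2,1)] that by (simp add: Rfun_def)
  have E_cell3 [simp]: "?E (IdE a b) = id1 D (map0 (P b) a)" if "a \<in> Obj A" "b \<in> Obj B" for a b
    using E_id[of "code (a, b)"] that by (simp add: id1_code Obj_gray)
  have E_cell4 [simp]: "?E (CompE d e) = comp1 D (?E d) (?E e)" if "wf1 A B (CompE d e)" for d e
    using E_comp[of "cell1 A B d" "cell1 A B e"] that by (simp add: cell_simps)
  have E_typ [simp]: "?E e \<in> Arr1 D" "src1 D (?E e) = (case esrc A B e of (a, b) \<Rightarrow> map0 (P b) a)"
     "tgt1 D (?E e) = (case etgt A B e of (a, b) \<Rightarrow> map0 (P b) a)" if "wf1 A B e" for e
    using E_in[of "cell1 A B e"] that by (simp_all add: cell_simps)
  \<comment> \<open>Vertically composable expressions have boundaries that agree only up to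
    \<open>eq1\<close>. After passing to classes they are equal, so E sends them to the same 1-cell
    of D.\<close>
  have wt: "?F t \<in> Arr2 D \<and> src2 D (?F t) = ?E (edom A B t) \<and> tgt2 D (?F t) = ?E (ecod A B t)" if "wf2 A B t" for t
    using that
  proof (induction t)
    case (VComp s t)
    then show ?case using cell1_eqI[of "edom A B s" "ecod A B t"] by simp
  next
    case (HComp s t)
    then show ?case using wf2_edom_ecod[of s] wf2_edom_ecod[of t] by simp
  qed simp_all
  note wf [simp] = wf2_edom_ecod
  have eq: "?F s = ?F t" if "eq2 A B s t" for s t
    using that
  proof (induction rule: eq2.induct)
    case (eq2_id_cong d e)
    then show ?case using cell1_eqI by simp
  next
    case (eq2_vcomp_assoc s t u)
    then show ?case using wt[of s] wt[of t] wt[of u] cell1_eqI[of "edom A B s" "ecod A B t"]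
      cell1_eqI[of "edom A B t" "ecod A B u"] by (simp add: D.vcomp_assoc)
  next
    case (eq2_vcomp_id_left t)
    then show ?case using wt[of t] by simp
  next
    case (eq2_vcomp_id_right t)
    then show ?case using wt[of t] by simp
  next
    case (eq2_hcomp_assoc s t u)
    then show ?case using wt[of s] wt[of t] wt[of u] by (simp add: D.hcomp_assoc)
  next
    case (eq2_hcomp_id_left t a b)
    then show ?case using wt[of t] wf1_esrc_etgt[of "edom A B t"] by simp
  next
    case (eq2_hcomp_id_right t a b)
    then show ?case using wt[of t] wf1_esrc_etgt[of "edom A B t"] by simp
  next
    case (eq2_hcomp_id d e)
    then show ?case by (simp add: D.hcomp_id2)
  next
    case (eq2_interchange s' s t' t)
    then show ?case using wt[of s] wt[of t] wt[of s'] wt[of t'] cell1_eqI[of "edom A B s'" "ecod A B s"]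
      cell1_eqI[of "edom A B t'" "ecod A B t"] by (simp add: D.interchange)
  next
    case (eq2_Sig_natural \<alpha> \<beta> f f' a a' g g' b b')
    then show ?case using S_natural[of \<alpha> \<beta>] by simp
  next
    case (eq2_Sig_comp_left f f' g)
    then show ?case by (simp add: S_comp_left)
  next
    case (eq2_Sig_comp_right f g g')
    then show ?case by (simp add: S_comp_right)
  qed (simp_all add: two_functor_maps S_id_left S_id_right)
  have cell: "?F (decode (cell2 A B t)) = ?F t" if "wf2 A B t" for t
    using eq[OF eq2_decode_cell2[OF that]] by simp
  define K where "K = \<lparr>Dom = AB, Cod = D, map0 = restrict ?ob (Obj AB),
    map1 = restrict E (Arr1 AB), map2 = (\<lambda>x\<in>Arr2 AB. ?F (decode x))\<rparr>"
  have K_simps [simp]: "Dom K = AB" "Cod K = D"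
    "x \<in> Obj AB \<Longrightarrow> map0 K x = ?ob x" "f \<in> Arr1 AB \<Longrightarrow> map1 K f = E f"
    "\<alpha> \<in> Arr2 AB \<Longrightarrow> map2 K \<alpha> = ?F (decode \<alpha>)" for x f \<alpha>
    by (simp_all add: K_def)
  interpret AB: two_category "AB" by (rule two_category_gray)
  have "two_functor K"
  proof (intro two_functor.intro two_functor_axioms.intro)
    show "map0 K \<in> Obj (Dom K) \<rightarrow>\<^sub>E Obj (Cod K)" by (auto simp: K_def ob simp del: case_prod_beta)
    show "map1 K \<in> Arr1 (Dom K) \<rightarrow>\<^sub>E Arr1 (Cod K)" by (auto simp: K_def E_in)
    have "?F (decode x) \<in> Arr2 D" if "x \<in> Arr2 AB" for x
      using that wt by (elim Arr2_grayE) (simp add: cell)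
    then show "map2 K \<in> Arr2 (Dom K) \<rightarrow>\<^sub>E Arr2 (Cod K)" by (simp add: K_def)
  next
    fix f assume "f \<in> Arr1 (Dom K)"
    then show "src1 (Cod K) (map1 K f) = map0 K (src1 (Dom K) f)" "tgt1 (Cod K) (map1 K f)
      = map0 K (tgt1 (Dom K) f)"
      "map2 K (id2 (Dom K) f) = id2 (Cod K) (map1 K f)"
      using E_in by (simp_all, elim Arr1_grayE) (simp add: cell_simps cell)
  next
    fix x assume "x \<in> Obj (Dom K)"
    then show "map1 K (id1 (Dom K) x) = id1 (Cod K) (map0 K x)" using E_id by simp
  next
    fix x y assume "x \<in> Arr1 (Dom K)" "y \<in> Arr1 (Dom K)" "src1 (Dom K) x = tgt1 (Dom K) y"
    then show "map1 K (comp1 (Dom K) x y) = comp1 (Cod K) (map1 K x) (map1 K y)" using E_comp by simp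
  next
    fix x assume "x \<in> Arr2 (Dom K)"
    then show "src2 (Cod K) (map2 K x) = map1 K (src2 (Dom K) x)" "tgt2 (Cod K) (map2 K x)
      = map1 K (tgt2 (Dom K) x)"
      using wt by (simp_all, (elim Arr2_grayE, simp add: cell_simps cell)+)
  next
    fix x y assume xy: "x \<in> Arr2 (Dom K)" "y \<in> Arr2 (Dom K)" and c: "src2 (Dom K) x = tgt2 (Dom K) y"
    then obtain s t where "x = cell2 A B s" "wf2 A B s" "y = cell2 A B t" "wf2 A B t"
      by (auto elim!: Arr2_grayE)
    then show "map2 K (vcomp (Dom K) x y) = vcomp (Cod K) (map2 K x) (map2 K y)"
      using c by (simp add: cell_simps cell1_eq_iff cell)
  next
    fix x y assume xy: "x \<in> Arr2 (Dom K)" "y \<in> Arr2 (Dom K)"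
      and c: "src1 (Dom K) (src2 (Dom K) x) = tgt1 (Dom K) (src2 (Dom K) y)"
    then obtain s t where "x = cell2 A B s" "wf2 A B s" "y = cell2 A B t" "wf2 A B t"
      by (auto elim!: Arr2_grayE)
    then show "map2 K (hcomp (Dom K) x y) = hcomp (Cod K) (map2 K x) (map2 K y)"
      using c by (simp add: cell_simps cell)
  qed (simp_all add: AB.two_category_axioms D.two_category_axioms)
  then show thesis
    by (intro that[of K] lifts_cubical.intro) (use EL ER
      in \<open>simp_all add: cell_simps cell Lfun_def Rfun_def gsig_def Obj_gray\<close>)
qed

section \<open>The universal cubical family and uniqueness of extensions\<close>

lemma two_functor_Lfun [simp]:
  assumes b: "b \<in> Obj B"
  shows "two_functor (Lfun A B b)"
proof -
  interpret AB: two_category "AB" by (rule two_category_gray)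
  show ?thesis
    by (intro two_functor.intro two_functor_axioms.intro)
      (use b A.two_category_axioms AB.two_category_axioms
        in \<open>auto simp: Lfun_def cell_simps Obj_gray wf2_edom_ecod cell1_eq_iff eq1_refl
         intro!: cell1_eqI cell2_eqI eq1_L_id eq1_L_comp eq2_L_id eq2_L_vcomp eq2_L_hcomp\<close>)
qed

lemma two_functor_Rfun [simp]:
  assumes a: "a \<in> Obj A"
  shows "two_functor (Rfun A B a)"
proof -
  interpret AB: two_category "AB" by (rule two_category_gray)
  show ?thesis
    by (intro two_functor.intro two_functor_axioms.intro)
      (use a B.two_category_axioms AB.two_category_axioms
        in \<open>auto simp: Rfun_def cell_simps Obj_gray wf2_edom_ecod cell1_eq_iff eq1_refl
         intro!: cell1_eqI cell2_eqI eq1_R_id eq1_R_comp eq2_R_id eq2_R_vcomp eq2_R_hcomp\<close>)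
qed

lemma inverse2_gsig:
  "f \<in> Arr1 A \<Longrightarrow> g \<in> Arr1 B \<Longrightarrow> inverse2 AB (gsig A B f g) (cell2 A B (SigInv f g))"
  by (auto simp: inverse2_def gsig_def cell_simps eq1_refl intro!: cell2_eqI eq2_Sig_inv_left eq2_Sig_inv_right)

text \<open>The relations of the presentation, regrouped by variable: naturality, unit and
  composition relations in f are pseudonaturality of \<Sigma>, and those in g, once inverted, are
  pseudonaturality of its inverse.\<close>

lemma cubical_gray: "cubical A B AB (Lfun A B) (Rfun A B) (gsig A B)"
proof -
  let ?D = "AB" and ?L = "Lfun A B" and ?R = "Rfun A B" and ?S = "gsig A B"
  interpret D: two_category ?D by (rule two_category_gray)
  have [simp]: "iso2 ?D (?S f g)" if "f \<in> Arr1 A" "g \<in> Arr1 B" for f g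
    using inverse2_gsig[OF that] by (auto simp: iso2_def)
  have [simp]: "?S f g \<in> Arr2 ?D" "src2 ?D (?S f g) = comp1 ?D (map1 (?L (tgt1 B g)) f) (map1 (?R (src1 A f)) g)"
     "tgt2 ?D (?S f g) = comp1 ?D (map1 (?R (tgt1 A f)) g) (map1 (?L (src1 B g)) f)"
       if "f \<in> Arr1 A" "g \<in> Arr1 B" for f g
    using that by (simp_all add: gsig_def cell_simps Lfun_def Rfun_def)
  have natural: "vcomp ?D (?S (tgt2 A \<alpha>) (tgt2 B \<beta>)) (hcomp ?D (map2 (?L (tgt1 B (src2 B \<beta>))) \<alpha>) (map2 (?R (src1 A (src2 A \<alpha>))) \<beta>)) =
      vcomp ?D (hcomp ?D (map2 (?R (tgt1 A (src2 A \<alpha>))) \<beta>) (map2 (?L (src1 B (src2 B \<beta>))) \<alpha>)) (?S (src2 A \<alpha>) (src2 B \<beta>))"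
    if "\<alpha> \<in> Arr2 A" "\<beta> \<in> Arr2 B" for \<alpha> \<beta>
    using that eq2_Sig_natural[OF that refl refl refl refl refl refl refl refl, THEN cell2_eqI]
      eq2_Sig_natural[OF that refl refl refl refl refl refl refl refl, THEN eq2_wf]
    by (simp add: gsig_def cell_simps Lfun_def Rfun_def)
  \<comment> \<open>The two-variable relation with the other 2-cell taken to be an identity;
    \<open>natural_right\<close> does the same in the other variable and then inverts
    \<Sigma>.\<close>
  have natural_left: "vcomp ?D (?S (tgt2 A \<alpha>) g) (hcomp ?D (map2 (?L (tgt1 B g)) \<alpha>) (id2 ?D (map1 (?R (src1 A (src2 A \<alpha>))) g))) =
      vcomp ?D (hcomp ?D (id2 ?D (map1 (?R (tgt1 A (src2 A \<alpha>))) g)) (map2 (?L (src1 B g)) \<alpha>)) (?S (src2 A \<alpha>) g)"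
    if "\<alpha> \<in> Arr2 A" "g \<in> Arr1 B" for \<alpha> g
    using natural[of \<alpha> "id2 B g"] that by (simp add: two_functor_maps)
  have natural_right: "vcomp ?D (inv2 ?D (?S f (tgt2 B \<beta>))) (hcomp ?D (map2 (?R (tgt1 A f)) \<beta>) (id2 ?D (map1 (?L (src1 B (src2 B \<beta>))) f))) =
      vcomp ?D (hcomp ?D (id2 ?D (map1 (?L (tgt1 B (src2 B \<beta>))) f)) (map2 (?R (src1 A f)) \<beta>)) (inv2 ?D (?S f (src2 B \<beta>)))"
    if "f \<in> Arr1 A" "\<beta> \<in> Arr2 B" for f \<beta>
    by (rule D.vcomp_inv2_commute) (use natural[of "id2 A f" \<beta>] that in \<open>simp_all add: two_functor_maps\<close>)
  have comp_left: "?S (comp1 A f' f) g = vcomp ?D (hcomp ?D (?S f' g) (id2 ?D (map1 (?L (src1 B g)) f)))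
      (hcomp ?D (id2 ?D (map1 (?L (tgt1 B g)) f')) (?S f g))"
    if "f \<in> Arr1 A" "f' \<in> Arr1 A" "src1 A f' = tgt1 A f" "g \<in> Arr1 B" for f f' g
    using that eq2_Sig_comp_left[OF that, THEN cell2_eqI] eq2_Sig_comp_left[OF that, THEN eq2_wf]
    by (simp add: gsig_def cell_simps Lfun_def)
  have comp_right: "?S f (comp1 B g' g) = vcomp ?D (hcomp ?D (id2 ?D (map1 (?R (tgt1 A f)) g')) (?S f g))
      (hcomp ?D (?S f g') (id2 ?D (map1 (?R (src1 A f)) g)))"
    if "f \<in> Arr1 A" "g \<in> Arr1 B" "g' \<in> Arr1 B" "src1 B g' = tgt1 B g" for f g g'
    using that eq2_Sig_comp_right[OF that, THEN cell2_eqI] eq2_Sig_comp_right[OF that, THEN eq2_wf]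
    by (simp add: gsig_def cell_simps Rfun_def)
  have id_left: "?S (id1 A a) g = id2 ?D (map1 (?R a) g)" if "a \<in> Obj A" "g \<in> Arr1 B" for a g
    using that by (auto simp: gsig_def Rfun_def cell_simps intro!: cell2_eqI eq2_Sig_id_left)
  have id_right: "?S f (id1 B b) = id2 ?D (map1 (?L b) f)" if "f \<in> Arr1 A" "b \<in> Obj B" for f b
    using that by (auto simp: gsig_def Lfun_def cell_simps intro!: cell2_eqI eq2_Sig_id_right)
  show ?thesis
  proof (intro cubical.intro cubical_axioms.intro A.two_category_axioms B.two_category_axioms D.two_category_axioms)
    show "pseudonat (?L (src1 B g)) (?L (tgt1 B g)) (\<lambda>a. map1 (?R a) g) (\<lambda>f. ?S f g)" if "g \<in> Arr1 B" for g
      by (intro pseudonat.intro pseudonat_axioms.intro) (use that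
        in \<open>simp_all add: natural_left comp_left id_left\<close>)
    show "pseudonat (?R (src1 A f)) (?R (tgt1 A f)) (\<lambda>b. map1 (?L b) f) (\<lambda>g. inv2 ?D (?S f g))" if "f \<in> Arr1 A"
      for f
      by (intro pseudonat.intro pseudonat_axioms.intro)
        (use that in \<open>simp_all add: natural_right comp_right id_right D.inv2_vcomp D.inv2_hcomp D.comp1_assoc\<close>)
  qed simp_all
qed

sublocale gray: cubical A B "AB" "Lfun A B" "Rfun A B" "gsig A B"
  by (rule cubical_gray)

text \<open>Uniqueness half of the universal property. The inverses of \<Sigma> require no
  hypothesis, as 2-functors preserve inverse 2-cells.\<close>

lemma gray_functor_eqI:
  assumes H: "two_functor H" "Dom H = AB" and K: "two_functor K" "Dom K = AB" and "Cod H = Cod K"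
    and ob: "\<And>a b. a \<in> Obj A \<Longrightarrow> b \<in> Obj B \<Longrightarrow> map0 H (code (a, b)) = map0 K (code (a, b))"
    and L1: "\<And>f b. f \<in> Arr1 A \<Longrightarrow> b \<in> Obj B \<Longrightarrow> map1 H (map1 (Lfun A B b) f) = map1 K (map1 (Lfun A B b) f)"
    and R1: "\<And>a g. a \<in> Obj A \<Longrightarrow> g \<in> Arr1 B \<Longrightarrow> map1 H (map1 (Rfun A B a) g) = map1 K (map1 (Rfun A B a) g)"
    and L2: "\<And>\<alpha> b. \<alpha> \<in> Arr2 A \<Longrightarrow> b \<in> Obj B \<Longrightarrow> map2 H (map2 (Lfun A B b) \<alpha>) = map2 K (map2 (Lfun A B b) \<alpha>)"
    and R2: "\<And>a \<beta>. a \<in> Obj A \<Longrightarrow> \<beta> \<in> Arr2 B \<Longrightarrow> map2 H (map2 (Rfun A B a) \<beta>) = map2 K (map2 (Rfun A B a) \<beta>)"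
    and S: "\<And>f g. f \<in> Arr1 A \<Longrightarrow> g \<in> Arr1 B \<Longrightarrow> map2 H (gsig A B f g) = map2 K (gsig A B f g)"
  shows "H = K"
proof -
  interpret H: two_functor H by fact
  interpret K: two_functor K by fact
  note HK = H(2) K(2)
  have 1: "map1 H x = map1 K x" if "x \<in> Arr1 AB" for x
    using that
  proof (induction rule: Arr1_gray_induct)
    case (L f b) then show ?case by (rule L1)
  next
    case (R a g) then show ?case by (rule R1)
  next
    case (comp x y) then show ?case using H.map_comp1[of x y] K.map_comp1[of x y] HK assms(5) by simp
  qed
  have 2: "map2 H x = map2 K x" if "x \<in> Arr2 AB" for x
    using that
  proof (induction rule: Arr2_gray_induct)
    case (L \<alpha> b) then show ?case by (rule L2)
  next
    case (R a \<beta>) then show ?case by (rule R2)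
  next
    case (Sig f g) then show ?case by (rule S)
  next
    case (SigInv f g)
    then show ?case using H.map_inv2[of "gsig A B f g"] K.map_inv2[of "gsig A B f g"] HK assms(5) by simp
  next
    case (id x) then show ?case using H.map_id2[of x] K.map_id2[of x] 1[of x] HK assms(5) by simp
  next
    case (vcomp x y) then show ?case using H.map_vcomp[of x y] K.map_vcomp[of x y] HK assms(5) by simp
  next
    case (hcomp x y) then show ?case using H.map_hcomp[of x y] K.map_hcomp[of x y] HK assms(5) by simp
  qed
  show ?thesis
    by (rule two_functor_eqI[OF H(1) K(1) H(2) K(2) assms(5)]) (auto simp: 1 2 ob elim!: Obj_grayE)
qed

text \<open>The cells over f \<otimes> 1 and 1 \<otimes> g determine the transformation. Their only
  mutual condition \<open>compat\<close> is naturality at \<Sigma>_{f,g}, with the transformation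
  expanded over the two composite boundaries by the composition law.\<close>

lemma pseudonat_extend:
  assumes F: "two_functor F" "Dom F = AB" "Cod F = D"
    and G: "two_functor G" "Dom G = AB" "Cod G = D"
    and u: "\<And>x. x \<in> Obj AB \<Longrightarrow> u x \<in> Arr1 D \<and> src1 D (u x) = map0 F x \<and> tgt1 D (u x) = map0 G x"
    and sL: "\<And>b. b \<in> Obj B \<Longrightarrow>
      pseudonat (comp_fun F (Lfun A B b)) (comp_fun G (Lfun A B b)) (\<lambda>a. u (code (a, b))) (\<lambda>f. sL f b)"
    and sR: "\<And>a. a \<in> Obj A \<Longrightarrow>
      pseudonat (comp_fun F (Rfun A B a)) (comp_fun G (Rfun A B a)) (\<lambda>b. u (code (a, b))) (sR a)"
    and compat: "\<And>f g. f \<in> Arr1 A \<Longrightarrow> g \<in> Arr1 B \<Longrightarrow>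
      vcomp D (vcomp D (hcomp D (sR (tgt1 A f) g) (id2 D (map1 F (map1 (Lfun A B (src1 B g)) f))))
                       (hcomp D (id2 D (map1 G (map1 (Rfun A B (tgt1 A f)) g))) (sL f (src1 B g))))
              (hcomp D (map2 G (gsig A B f g)) (id2 D (u (code (src1 A f, src1 B g))))) =
      vcomp D (hcomp D (id2 D (u (code (tgt1 A f, tgt1 B g)))) (map2 F (gsig A B f g)))
              (vcomp D (hcomp D (sL f (tgt1 B g)) (id2 D (map1 F (map1 (Rfun A B (src1 A f)) g))))
                       (hcomp D (id2 D (map1 G (map1 (Lfun A B (tgt1 B g)) f))) (sR (src1 A f) g)))"
  obtains s where "pseudonat F G u s"
    "\<And>f b. f \<in> Arr1 A \<Longrightarrow> b \<in> Obj B \<Longrightarrow> s (map1 (Lfun A B b) f) = sL f b"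
    "\<And>a g. a \<in> Obj A \<Longrightarrow> g \<in> Arr1 B \<Longrightarrow> s (map1 (Rfun A B a) g) = sR a g"
proof -
  let ?C = "AB"
  interpret F: two_functor F by fact
  interpret G: two_functor G by fact
  interpret D: two_category D using F.B.two_category_axioms F by simp
  note [simp] = F G D.comp1_assoc
  have [simp]: "u x \<in> Arr1 D" "src1 D (u x) = map0 F x" "tgt1 D (u x) = map0 G x" if "x \<in> Obj ?C" for x
    using u[OF that] by auto
  have [simp]: "code (a, b) \<in> Obj ?C" if "a \<in> Obj A" "b \<in> Obj B" for a b using that by (simp add: Obj_gray)
  have L [simp]: "iso2 D (sL f b)" "sL f b \<in> Arr2 D"
    "src2 D (sL f b) = comp1 D (map1 G (map1 (Lfun A B b) f)) (u (code (src1 A f, b)))"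
    "tgt2 D (sL f b) = comp1 D (u (code (tgt1 A f, b))) (map1 F (map1 (Lfun A B b) f))"
      if "f \<in> Arr1 A" "b \<in> Obj B" for f b
    using pseudonat.s_iso[OF sL] pseudonat.s_in[OF sL] pseudonat.src2_s[OF sL] pseudonat.tgt2_s[OF sL] that
      by simp_all
  have R [simp]: "iso2 D (sR a g)" "sR a g \<in> Arr2 D"
    "src2 D (sR a g) = comp1 D (map1 G (map1 (Rfun A B a) g)) (u (code (a, src1 B g)))"
    "tgt2 D (sR a g) = comp1 D (u (code (a, tgt1 B g))) (map1 F (map1 (Rfun A B a) g))"
      if "a \<in> Obj A" "g \<in> Arr1 B" for a g
    using pseudonat.s_iso[OF sR] pseudonat.s_in[OF sR] pseudonat.src2_s[OF sR] pseudonat.tgt2_s[OF sR] that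
      by simp_all
  \<comment> \<open>A square carries its whole boundary; only the last component is new
    information.\<close>
  let ?sq = "\<lambda>x \<sigma>. (u (src1 ?C x), u (tgt1 ?C x), map1 F x, map1 G x, \<sigma>)"
  have [simp]: "?sq x \<sigma> \<in> squares D \<longleftrightarrow> iso2 D \<sigma> \<and> src2 D \<sigma> = comp1 D (map1 G x) (u (src1 ?C x)) \<and>
      tgt2 D \<sigma> = comp1 D (u (tgt1 ?C x)) (map1 F x)" if "x \<in> Arr1 ?C" for x \<sigma>
    using that by (simp add: squares_def)
  obtain E where E0: "lifts_cells1 A B (squares D) fst (fst \<circ> snd) (\<lambda>u. (u, u, id1 D (src1 D u), id1 D (tgt1 D u), id2 D u)) (paste D) u
      (\<lambda>f b. ?sq (map1 (Lfun A B b) f) (sL f b)) (\<lambda>a g. ?sq (map1 (Rfun A B a) g) (sR a g)) E"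
  proof (rule lift_cells1[OF D.one_category_squares])
    fix a b assume ab: "a \<in> Obj A" "b \<in> Obj B"
    then show "?sq (map1 (Lfun A B b) (id1 A a)) (sL (id1 A a) b) =
         (u (code (a, b)), u (code (a, b)), id1 D (src1 D (u (code (a, b)))), id1 D (tgt1 D (u (code (a, b)))), id2 D (u (code (a, b))))"
      using pseudonat.s_id1[OF sL] by (simp add: two_functor_maps)
    show "?sq (map1 (Rfun A B a) (id1 B b)) (sR a (id1 B b)) =
         (u (code (a, b)), u (code (a, b)), id1 D (src1 D (u (code (a, b)))), id1 D (tgt1 D (u (code (a, b)))), id2 D (u (code (a, b))))"
      using ab pseudonat.s_id1[OF sR] by (simp add: two_functor_maps)
  next
    fix f f' b assume "f \<in> Arr1 A" "f' \<in> Arr1 A" "src1 A f' = tgt1 A f" "b \<in> Obj B"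
    then show "?sq (map1 (Lfun A B b) (comp1 A f' f)) (sL (comp1 A f' f) b) =
      paste D (?sq (map1 (Lfun A B b) f') (sL f' b)) (?sq (map1 (Lfun A B b) f) (sL f b))"
      using pseudonat.s_comp1[OF sL] by (simp add: two_functor_maps paste_def)
  next
    fix g g' a assume "g \<in> Arr1 B" "g' \<in> Arr1 B" "src1 B g' = tgt1 B g" "a \<in> Obj A"
    then show "?sq (map1 (Rfun A B a) (comp1 B g' g)) (sR a (comp1 B g' g)) =
      paste D (?sq (map1 (Rfun A B a) g') (sR a g')) (?sq (map1 (Rfun A B a) g) (sR a g))"
      using pseudonat.s_comp1[OF sR] by (simp add: two_functor_maps paste_def)
  qed (simp_all add: squares_def)
  define s where "s = (\<lambda>x. snd (snd (snd (snd (E x)))))"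
  note E_in = lifts_cells1.in_Ar[OF E0] and E_id = lifts_cells1.id1[OF E0] and E_comp = lifts_cells1.comp1[OF E0]
    and EL = lifts_cells1.L[OF E0] and ER = lifts_cells1.R[OF E0]
  \<comment> \<open>The lift is known a priori only to yield some square with the right end 1-cells.
    Induction shows that its remaining sides are the images of x under F and G.\<close>
  have E: "E x = ?sq x (s x)" if "x \<in> Arr1 ?C" for x
    using that
  proof (induction rule: Arr1_gray_induct)
    case (L f b) then show ?case using EL[of f b] by (simp add: s_def)
  next
    case (R a g) then show ?case using ER[of a g] by (simp add: s_def)
  next
    case (comp x y)
    have "E (comp1 ?C x y) = paste D (?sq x (s x)) (?sq y (s y))" using E_comp[OF comp(1-3)] comp(4,5) by simp
    then show ?case using comp(1-3) by (simp add: paste_def two_functor_maps s_def)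
  qed
  have s [simp]: "iso2 D (s x)" "s x \<in> Arr2 D" "src2 D (s x) = comp1 D (map1 G x) (u (src1 ?C x))"
      "tgt2 D (s x) = comp1 D (u (tgt1 ?C x)) (map1 F x)" if "x \<in> Arr1 ?C" for x
    using E_in[OF that] E[OF that] that D.iso2_in by auto
  have s_comp: "s (comp1 ?C x y) = vcomp D (hcomp D (s x) (id2 D (map1 F y))) (hcomp D (id2 D (map1 G x)) (s y))"
    if "x \<in> Arr1 ?C" "y \<in> Arr1 ?C" "src1 ?C x = tgt1 ?C y" for x y
    using E_comp[OF that] E[of x] E[of y] E[of "comp1 ?C x y"] that by (simp add: paste_def)
  have s_id: "s (id1 ?C x) = id2 D (u x)" if "x \<in> Obj ?C" for x
    using E_id[OF that] by (simp add: s_def)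
  have s_L: "s (map1 (Lfun A B b) f) = sL f b" if "f \<in> Arr1 A" "b \<in> Obj B" for f b
    using EL[OF that] by (simp add: s_def)
  have s_R: "s (map1 (Rfun A B a) g) = sR a g" if "a \<in> Obj A" "g \<in> Arr1 B" for a g
    using ER[OF that] by (simp add: s_def)
  have natural: "vcomp D (s (tgt2 ?C \<theta>)) (hcomp D (map2 G \<theta>) (id2 D (u (src1 ?C (src2 ?C \<theta>))))) =
     vcomp D (hcomp D (id2 D (u (tgt1 ?C (src2 ?C \<theta>)))) (map2 F \<theta>)) (s (src2 ?C \<theta>))" if "\<theta> \<in> Arr2 ?C" for \<theta>
    using that
  proof (induction rule: Arr2_gray_induct)
    case (L \<alpha> b)
    then show ?case using pseudonat.s_natural[OF sL, of b \<alpha>] L by (simp add: s_L)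
  next
    case (R a \<beta>)
    then show ?case using pseudonat.s_natural[OF sR, of a \<beta>] R by (simp add: s_R)
  next
    case (Sig f g)
    then show ?case using compat[of f g] by (simp add: s_comp s_L s_R)
  next
    case (SigInv f g)
    let ?\<theta> = "gsig A B f g"
    have \<theta> [simp]: "iso2 ?C ?\<theta>" "?\<theta> \<in> Arr2 ?C" using SigInv by auto
    \<comment> \<open>Names for the boundary keep it from being expanded into generators; only its
      endpoints matter when the naturality square of \<Sigma> is inverted.\<close>
    define p q where "p = src2 ?C ?\<theta>" and "q = tgt2 ?C ?\<theta>"
    have [simp]: "src2 ?C ?\<theta> = p" "tgt2 ?C ?\<theta> = q" "p \<in> Arr1 ?C" "q \<in> Arr1 ?C"
      "src1 ?C q = src1 ?C p" "tgt1 ?C q = tgt1 ?C p"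
      using gray.D.src2_in[OF \<theta>(2)] gray.D.tgt2_in[OF \<theta>(2)] gray.D.src1_tgt2[OF \<theta>(2)] gray.D.tgt1_tgt2[OF \<theta>(2)]
        by (simp_all only: p_def q_def)
    have IH: "vcomp D (hcomp D (id2 D (u (tgt1 ?C p))) (map2 F ?\<theta>)) (s p) =
        vcomp D (s q) (hcomp D (map2 G ?\<theta>) (id2 D (u (src1 ?C p))))"
      using SigInv(3) by (simp only: p_def q_def)
    have "vcomp D (inv2 D (hcomp D (id2 D (u (tgt1 ?C p))) (map2 F ?\<theta>))) (s q) =
        vcomp D (s p) (inv2 D (hcomp D (map2 G ?\<theta>) (id2 D (u (src1 ?C p)))))"
      by (rule D.vcomp_inv2_commute[OF _ _ _ _ _ _ _ _ IH]) (simp_all del: gray.S_simps(3,4))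
    then show ?case by (simp add: D.inv2_hcomp two_functor_maps del: gray.S_simps(3,4))
  next
    case (id x)
    then show ?case by (simp add: two_functor_maps D.hcomp_id2)
  next
    case (vcomp x y)
    let ?p = "src2 ?C y" and ?q = "src2 ?C x" and ?r = "tgt2 ?C x"
    let ?a = "u (src1 ?C ?p)" and ?b = "u (tgt1 ?C ?p)"
    note [simp] = vcomp(1-3)
    have st: "src1 ?C ?q = src1 ?C ?p" "tgt1 ?C ?q = tgt1 ?C ?p"
      using gray.D.src1_tgt2[of y] gray.D.tgt1_tgt2[of y] by simp_all
    have y: "vcomp D (s (tgt2 ?C y)) (hcomp D (map2 G y) (id2 D ?a))
      = vcomp D (hcomp D (id2 D ?b) (map2 F y)) (s ?p)"
      by (rule vcomp(5))
    have x: "vcomp D (s ?r) (hcomp D (map2 G x) (id2 D ?a)) = vcomp D (hcomp D (id2 D ?b) (map2 F x)) (s ?q)"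
      using vcomp(4) st by simp
    have "vcomp D (s ?r) (hcomp D (map2 G (vcomp ?C x y)) (id2 D ?a)) =
        vcomp D (vcomp D (s ?r) (hcomp D (map2 G x) (id2 D ?a))) (hcomp D (map2 G y) (id2 D ?a))"
      using st by (simp add: two_functor_maps D.whisker_right_vcomp D.vcomp_assoc)
    also have "\<dots> = vcomp D (hcomp D (id2 D ?b) (map2 F x)) (vcomp D (s ?q) (hcomp D (map2 G y) (id2 D ?a)))"
      unfolding x using st by (simp add: D.vcomp_assoc)
    also have "\<dots> = vcomp D (hcomp D (id2 D ?b) (map2 F (vcomp ?C x y))) (s ?p)"
      using y st by (simp add: two_functor_maps D.whisker_left_vcomp D.vcomp_assoc)
    finally show ?case by simp
  next
    case (hcomp x y)
    let ?f = "src2 ?C x" and ?f' = "tgt2 ?C x" and ?g = "src2 ?C y" and ?g' = "tgt2 ?C y"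
    let ?a = "u (src1 ?C ?g)" and ?b = "u (tgt1 ?C ?g)" and ?c = "u (tgt1 ?C ?f)"
    note [simp] = hcomp(1-3)
    have x: "vcomp D (s ?f') (hcomp D (map2 G x) (id2 D ?b)) = vcomp D (hcomp D (id2 D ?c) (map2 F x)) (s ?f)"
      using hcomp(4) by simp
    have y: "vcomp D (s ?g') (hcomp D (map2 G y) (id2 D ?a)) = vcomp D (hcomp D (id2 D ?b) (map2 F y)) (s ?g)"
      using hcomp(5) by simp
    \<comment> \<open>The squares of x and y are pasted side by side: after expanding s at the
      composite, the square of y is used to the right of \<open>map2 G x\<close>, then the square of
      x to the left of \<open>map2 F y\<close>.\<close>
    have "vcomp D (s (comp1 ?C ?f' ?g')) (hcomp D (map2 G (hcomp ?C x y)) (id2 D ?a)) =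
        vcomp D (hcomp D (s ?f') (id2 D (map1 F ?g')))
          (vcomp D (hcomp D (id2 D (map1 G ?f')) (s ?g')) (hcomp D (map2 G x) (hcomp D (map2 G y) (id2 D ?a))))"
      by (simp add: s_comp two_functor_maps D.hcomp_assoc D.vcomp_assoc)
    also have "vcomp D (hcomp D (id2 D (map1 G ?f')) (s ?g')) (hcomp D (map2 G x) (hcomp D (map2 G y) (id2 D ?a))) =
        hcomp D (map2 G x) (vcomp D (hcomp D (id2 D ?b) (map2 F y)) (s ?g))"
      unfolding y[symmetric] by (subst D.interchange[symmetric]) simp_all
    also have "\<dots> = vcomp D (hcomp D (map2 G x) (hcomp D (id2 D ?b) (map2 F y))) (hcomp D (id2 D (map1 G ?f)) (s ?g))"
      using D.interchange[of "id2 D (map1 G ?f)" "map2 G x" "s ?g" "hcomp D (id2 D ?b) (map2 F y)"] by simp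
    also have "vcomp D (hcomp D (s ?f') (id2 D (map1 F ?g'))) \<dots> =
        vcomp D (vcomp D (hcomp D (s ?f') (id2 D (map1 F ?g'))) (hcomp D (hcomp D (map2 G x) (id2 D ?b)) (map2 F y)))
          (hcomp D (id2 D (map1 G ?f)) (s ?g))"
      by (simp add: D.hcomp_assoc D.vcomp_assoc)
    also have "vcomp D (hcomp D (s ?f') (id2 D (map1 F ?g'))) (hcomp D (hcomp D (map2 G x) (id2 D ?b)) (map2 F y)) =
        hcomp D (vcomp D (hcomp D (id2 D ?c) (map2 F x)) (s ?f)) (map2 F y)"
      unfolding x[symmetric] by (subst D.interchange[symmetric]) simp_all
    also have "\<dots> = vcomp D (hcomp D (id2 D ?c) (map2 F (hcomp ?C x y))) (hcomp D (s ?f) (id2 D (map1 F ?g)))"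
      using D.interchange[of "s ?f" "hcomp D (id2 D ?c) (map2 F x)" "id2 D (map1 F ?g)" "map2 F y"]
      by (simp add: two_functor_maps D.hcomp_assoc)
    finally show ?case by (simp add: s_comp two_functor_maps D.vcomp_assoc)
  qed
  have "pseudonat F G u s"
    by (intro pseudonat.intro pseudonat_axioms.intro F(1) G(1)) (use natural in \<open>simp_all add: s_comp s_id\<close>)
  then show thesis by (rule that) (simp_all add: s_L s_R)
qed

end

section \<open>Functoriality, symmetry and associativity\<close>

lemma two_category_conditional_simps [simp]:
  assumes "two_category C"
  shows "f \<in> Arr1 C \<Longrightarrow> src1 C f \<in> Obj C" "f \<in> Arr1 C \<Longrightarrow> tgt1 C f \<in> Obj C"
    and "\<alpha> \<in> Arr2 C \<Longrightarrow> src2 C \<alpha> \<in> Arr1 C" "\<alpha> \<in> Arr2 C \<Longrightarrow> tgt2 C \<alpha> \<in> Arr1 C"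
    and "f \<in> Arr1 C \<Longrightarrow> id2 C f \<in> Arr2 C" "x \<in> Obj C \<Longrightarrow> id1 C x \<in> Arr1 C"
    and "iso2 C \<alpha> \<Longrightarrow> inv2 C (inv2 C \<alpha>) = \<alpha>"
    and "iso2 C \<alpha> \<Longrightarrow> iso2 C (inv2 C \<alpha>)"
  using assms by (simp_all add: two_category.src1_in two_category.tgt1_in two_category.src2_in two_category.tgt2_in
      two_category.id1_simps two_category.id2_simps two_category.inv2_simps)

lemma gray_tensor_fun_Dom_Cod [simp]:
  "Dom (gray_tensor_fun F G) = (Dom F) \<otimes> (Dom G)"
  "Cod (gray_tensor_fun F G) = (Cod F) \<otimes> (Cod G)"
  by (simp_all add: gray_tensor_fun_def)

text \<open>The parameter carries no data; it fixes the type \<open>'u\<close> about which infinity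
  is assumed.\<close>

locale infinite_universe =
  fixes univ :: "'u itself"
  assumes infinite_UNIV: "infinite (UNIV :: 'u set)"
begin

abbreviation opair :: "'u \<Rightarrow> 'u \<Rightarrow> 'u" where
  "opair a b \<equiv> code (a, b)"

lemma gray_pairI: "two_category A \<Longrightarrow> two_category B \<Longrightarrow> gray_pair A B" for A B :: "'u cat2"
  by (intro gray_pair.intro gray_pair_axioms.intro infinite_UNIV)

lemma decode_code_pair [simp]: "decode (code p :: 'u) = p" for p :: "'u \<times> 'u"
  by (simp add: decode_def inj_code_pair[OF infinite_UNIV])

lemma code_pair_eq_iff [simp]: "(code p :: 'u) = code q \<longleftrightarrow> p = q" for p q :: "'u \<times> 'u"
  using inj_code_pair[OF infinite_UNIV] by (simp add: inj_eq)

lemma two_category_gray_tensor [simp]: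
  "two_category A \<Longrightarrow> two_category B \<Longrightarrow> two_category (A \<otimes> B)" for A B :: "'u cat2"
  by (intro gray_pair.two_category_gray gray_pairI)

lemma code_in_Obj_gray [simp]:
  "two_category A \<Longrightarrow> two_category B \<Longrightarrow> code (a, b) \<in> Obj (A \<otimes> B) \<longleftrightarrow> a \<in> Obj A \<and> b \<in> Obj B" for A B :: "'u cat2"
  using gray_pair.Obj_gray[OF gray_pairI] by auto

lemma two_functor_LR [simp]:
  fixes A B :: "'u cat2"
  assumes "two_category A" "two_category B"
  shows "b \<in> Obj B \<Longrightarrow> two_functor (Lfun A B b)" "a \<in> Obj A \<Longrightarrow> two_functor (Rfun A B a)"
  using assms by (simp_all add: gray_pair.two_functor_Lfun gray_pair.two_functor_Rfun gray_pairI)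

lemma gsig_simps [simp]:
  fixes A B :: "'u cat2"
  assumes "two_category A" "two_category B" "f \<in> Arr1 A" "g \<in> Arr1 B"
  shows "iso2 (A \<otimes> B) (gsig A B f g)" "gsig A B f g \<in> Arr2 (A \<otimes> B)"
    and "src2 (A \<otimes> B) (gsig A B f g) =
      comp1 (A \<otimes> B) (map1 (Lfun A B (tgt1 B g)) f) (map1 (Rfun A B (src1 A f)) g)"
    and "tgt2 (A \<otimes> B) (gsig A B f g) =
      comp1 (A \<otimes> B) (map1 (Rfun A B (tgt1 A f)) g) (map1 (Lfun A B (src1 B g)) f)"
  using cubical.S_simps[OF gray_pair.cubical_gray[OF gray_pairI[OF assms(1,2)]] assms(3,4)] by simp_all

text \<open>\<open>gray_tensor_fun\<close> applies \<open>emap1\<close> and \<open>emap2\<close> to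
  chosen representatives. Rather than showing directly that these respect the relations, the
  universal property supplies a 2-functor K, and induction on expressions shows that K acts by the
  same formulas.\<close>

lemma lifts_gray_tensor_fun:
  fixes F G :: "'u fun2"
  assumes F: "two_functor F" and G: "two_functor G"
  shows "lifts_cubical (Dom F) (Dom G) ((Cod F) \<otimes> (Cod G)) (\<lambda>b. comp_fun (Lfun (Cod F) (Cod G) (map0 G b)) F)
      (\<lambda>a. comp_fun (Rfun (Cod F) (Cod G) (map0 F a)) G) (\<lambda>f g. gsig (Cod F) (Cod G) (map1 F f) (map1 G g)) (gray_tensor_fun F G)"
    (is "lifts_cubical _ _ _ ?P ?Q ?S _")
proof -
  interpret F: two_functor F by fact
  interpret G: two_functor G by fact
  interpret AB: gray_pair "Dom F" "Dom G" using F.A.two_category_axioms G.A.two_category_axioms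
    by (rule gray_pairI)
  interpret AB': gray_pair "Cod F" "Cod G" using F.B.two_category_axioms G.B.two_category_axioms
    by (rule gray_pairI)
  let ?D = "(Cod F) \<otimes> (Cod G)"
  obtain K where lifts: "lifts_cubical (Dom F) (Dom G) ?D ?P ?Q ?S K"
    by (rule AB.lift_cubical[OF cubical.cubical_comp_right[OF AB'.cubical_gray F G refl refl refl refl]])
  note K = lifts_cubical.maps[OF lifts]
  interpret K: two_functor K by (rule K)
  note [simp] = K(1-3)
  have wf1: "wf1 (Cod F) (Cod G) (emap1 F G e) \<and>
      esrc (Cod F) (Cod G) (emap1 F G e) = map_prod (map0 F) (map0 G) (esrc (Dom F) (Dom G) e) \<and>
      etgt (Cod F) (Cod G) (emap1 F G e) = map_prod (map0 F) (map0 G) (etgt (Dom F) (Dom G) e)"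
    if "wf1 (Dom F) (Dom G) e" for e
    using that by (induction e) simp_all
  have 1: "map1 K (cell1 (Dom F) (Dom G) e) = cell1 (Cod F) (Cod G) (emap1 F G e)" if "wf1 (Dom F) (Dom G) e" for e
    using that
  proof (induction e)
    case (LGen f b) then show ?case using K(5)[of f b] by (simp add: Lfun_def)
  next
    case (RGen a g) then show ?case using K(6)[of a g] by (simp add: Rfun_def)
  next
    case (IdE a b)
    then show ?case using K.map_id1[of "code (a, b)"] K(4)[of a b]
      by (simp add: AB.id1_code AB'.id1_code AB.Obj_gray)
  next
    case (CompE d e)
    then show ?case
      using K.map_comp1[of "cell1 (Dom F) (Dom G) d" "cell1 (Dom F) (Dom G) e"] wf1[of d] wf1[of e]
      by (simp add: AB.cell_simps AB'.cell_simps)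
  qed
  have dc: "edom (Cod F) (Cod G) (emap2 F G t) = emap1 F G (edom (Dom F) (Dom G) t) \<and>
      ecod (Cod F) (Cod G) (emap2 F G t) = emap1 F G (ecod (Dom F) (Dom G) t)" if "wf2 (Dom F) (Dom G) t" for t
    using that by (induction t) simp_all
  have 2: "wf2 (Cod F) (Cod G) (emap2 F G t) \<and> map2 K (cell2 (Dom F) (Dom G) t)
    = cell2 (Cod F) (Cod G) (emap2 F G t)"
    if "wf2 (Dom F) (Dom G) t" for t
    using that
  proof (induction t)
    case (LCell \<alpha> b) then show ?case using K(7)[of \<alpha> b] by (simp add: Lfun_def)
  next
    case (RCell a \<beta>) then show ?case using K(8)[of a \<beta>] by (simp add: Rfun_def)
  next
    case (Sig f g) then show ?case using K(9)[of f g] by (simp add: gsig_def)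
  next
    case (SigInv f g)
    then show ?case using K(9)[of f g] K.map_inv2[of "gsig (Dom F) (Dom G) f g"] AB.gray.D.inv2_eqI[OF AB.inverse2_gsig]
       AB'.gray.D.inv2_eqI[OF AB'.inverse2_gsig] by simp
  next
    case (IdC e)
    then show ?case
      using 1[of e] wf1[of e] K.map_id2[of "cell1 (Dom F) (Dom G) e"] by (simp add: AB.cell_simps AB'.cell_simps)
  next
    case (VComp s t)
    then have e: "cell1 (Dom F) (Dom G) (edom (Dom F) (Dom G) s) = cell1 (Dom F) (Dom G) (ecod (Dom F) (Dom G) t)"
      by (simp add: AB.cell1_eqI)
    \<comment> \<open>That \<open>emap1\<close> preserves this instance of \<open>eq1\<close> is
      read off from K: equal classes have equal images, and equal image classes have equivalent
      expressions.\<close>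
    then have "eq1 (Cod F) (Cod G) (emap1 F G (edom (Dom F) (Dom G) s)) (emap1 F G (ecod (Dom F) (Dom G) t))"
      using VComp.prems 1[of "edom (Dom F) (Dom G) s"] 1[of "ecod (Dom F) (Dom G) t"]
      by (simp add: AB.wf2_edom_ecod wf1 flip: AB'.cell1_eq_iff)
    then show ?case
      using VComp K.map_vcomp[of "cell2 (Dom F) (Dom G) s" "cell2 (Dom F) (Dom G) t"] e
      by (simp add: AB.cell_simps AB'.cell_simps dc)
  next
    case (HComp s t)
    then show ?case
      using K.map_hcomp[of "cell2 (Dom F) (Dom G) s" "cell2 (Dom F) (Dom G) t"]
      by (simp add: AB.cell_simps AB'.cell_simps AB.wf2_edom_ecod wf1 dc)
  qed
  have "gray_tensor_fun F G = K"
  proof (rule twofun.equality)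
    have "map0 (gray_tensor_fun F G) = restrict (map0 K) (Obj (Dom K))"
      by (auto simp: gray_tensor_fun_def K(4) elim!: AB.Obj_grayE intro!: restrict_ext)
    then show "map0 (gray_tensor_fun F G) = map0 K" using K.map0_in by (simp add: PiE_restrict)
    have "map1 (gray_tensor_fun F G) = restrict (map1 K) (Arr1 (Dom K))"
      using 1 by (auto simp: gray_tensor_fun_def
        elim!: AB.Arr1_grayE intro!: restrict_ext) (metis AB.wf1_decode AB.cell1_decode)
    then show "map1 (gray_tensor_fun F G) = map1 K" using K.map1_in by (simp add: PiE_restrict)
    have "map2 (gray_tensor_fun F G) = restrict (map2 K) (Arr2 (Dom K))"
      using 2 by (auto simp: gray_tensor_fun_def
        elim!: AB.Arr2_grayE intro!: restrict_ext) (metis AB.wf2_decode AB.cell2_decode)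
    then show "map2 (gray_tensor_fun F G) = map2 K" using K.map2_in by (simp add: PiE_restrict)
  qed simp_all
  with lifts show ?thesis by simp
qed

lemma gray_tensor_fun_simps [simp]:
  fixes F G :: "'u fun2"
  assumes F: "two_functor F" and G: "two_functor G"
  shows "two_functor (gray_tensor_fun F G)"
    and "Dom F = A \<Longrightarrow> Dom G = B \<Longrightarrow> a \<in> Obj A \<Longrightarrow> b \<in> Obj B \<Longrightarrow>
      map0 (gray_tensor_fun F G) (code (a, b)) = code (map0 F a, map0 G b)"
    and "Dom F = A \<Longrightarrow> Dom G = B \<Longrightarrow> f \<in> Arr1 A \<Longrightarrow> b \<in> Obj B \<Longrightarrow>
      map1 (gray_tensor_fun F G) (map1 (Lfun A B b) f) = map1 (Lfun (Cod F) (Cod G) (map0 G b)) (map1 F f)"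
    and "Dom F = A \<Longrightarrow> Dom G = B \<Longrightarrow> a \<in> Obj A \<Longrightarrow> g \<in> Arr1 B \<Longrightarrow>
      map1 (gray_tensor_fun F G) (map1 (Rfun A B a) g) = map1 (Rfun (Cod F) (Cod G) (map0 F a)) (map1 G g)"
    and "Dom F = A \<Longrightarrow> Dom G = B \<Longrightarrow> \<alpha> \<in> Arr2 A \<Longrightarrow> b \<in> Obj B \<Longrightarrow>
      map2 (gray_tensor_fun F G) (map2 (Lfun A B b) \<alpha>) = map2 (Lfun (Cod F) (Cod G) (map0 G b)) (map2 F \<alpha>)"
    and "Dom F = A \<Longrightarrow> Dom G = B \<Longrightarrow> a \<in> Obj A \<Longrightarrow> \<beta> \<in> Arr2 B \<Longrightarrow>
      map2 (gray_tensor_fun F G) (map2 (Rfun A B a) \<beta>) = map2 (Rfun (Cod F) (Cod G) (map0 F a)) (map2 G \<beta>)"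
    and "Dom F = A \<Longrightarrow> Dom G = B \<Longrightarrow> f \<in> Arr1 A \<Longrightarrow> g \<in> Arr1 B \<Longrightarrow>
      map2 (gray_tensor_fun F G) (gsig A B f g) = gsig (Cod F) (Cod G) (map1 F f) (map1 G g)"
  using lifts_cubical.maps[OF lifts_gray_tensor_fun[OF F G]] F G by auto

text \<open>\<Sigma> at a composite is pasted from \<Sigma> at the factors, whiskered only by
  1-cells \<open>x \<otimes> 1\<close>. So agreement on the factors and on those 1-cells
  suffices.\<close>

lemma gsig_comp_left_eq:
  fixes X C :: "'u cat2"
  assumes XC: "two_category X" "two_category C"
    and H: "two_functor H" "Dom H = X \<otimes> C" and K: "two_functor K" "Dom K = X \<otimes> C" and "Cod H = Cod K"
    and L: "\<And>x c. x \<in> Arr1 X \<Longrightarrow> c \<in> Obj C \<Longrightarrow> map1 H (map1 (Lfun X C c) x) = map1 K (map1 (Lfun X C c) x)"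
    and xy: "x \<in> Arr1 X" "y \<in> Arr1 X" "src1 X x = tgt1 X y" "h \<in> Arr1 C"
    and "map2 H (gsig X C x h) = map2 K (gsig X C x h)" "map2 H (gsig X C y h) = map2 K (gsig X C y h)"
  shows "map2 H (gsig X C (comp1 X x y) h) = map2 K (gsig X C (comp1 X x y) h)"
proof -
  interpret gray_pair X C using XC by (rule gray_pairI)
  show ?thesis
    using assms by (simp add: gray.S_comp_left two_functor_maps gray.D.comp1_assoc)
qed

text \<open>For each c the restrictions along \<open>- \<otimes> c\<close> are 2-functors out of A
  \<otimes> B, to which uniqueness applies. What remains is \<Sigma>_{x,h} for an arbitrary 1-cell x
  of A \<otimes> B, which reduces to generating x by induction.\<close>

lemma gray_left_eqI:
  fixes A B C :: "'u cat2"
  assumes ABC: "two_category A" "two_category B" "two_category C"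
    and H: "two_functor H" "Dom H = (A \<otimes> B) \<otimes> C"
    and K: "two_functor K" "Dom K = (A \<otimes> B) \<otimes> C" and "Cod H = Cod K"
    and ob: "\<And>a b c. a \<in> Obj A \<Longrightarrow> b \<in> Obj B \<Longrightarrow> c \<in> Obj C \<Longrightarrow> map0 H (opair (opair a b) c)
      = map0 K (opair (opair a b) c)"
    and LL1: "\<And>f b c. f \<in> Arr1 A \<Longrightarrow> b \<in> Obj B \<Longrightarrow> c \<in> Obj C \<Longrightarrow>
      map1 H (map1 (Lfun (A \<otimes> B) C c) (map1 (Lfun A B b) f))
        = map1 K (map1 (Lfun (A \<otimes> B) C c) (map1 (Lfun A B b) f))"
    and LR1: "\<And>a g c. a \<in> Obj A \<Longrightarrow> g \<in> Arr1 B \<Longrightarrow> c \<in> Obj C \<Longrightarrow>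
      map1 H (map1 (Lfun (A \<otimes> B) C c) (map1 (Rfun A B a) g))
        = map1 K (map1 (Lfun (A \<otimes> B) C c) (map1 (Rfun A B a) g))"
    and R1: "\<And>a b h. a \<in> Obj A \<Longrightarrow> b \<in> Obj B \<Longrightarrow> h \<in> Arr1 C \<Longrightarrow>
      map1 H (map1 (Rfun (A \<otimes> B) C (opair a b)) h) = map1 K (map1 (Rfun (A \<otimes> B) C (opair a b)) h)"
    and LL2: "\<And>\<alpha> b c. \<alpha> \<in> Arr2 A \<Longrightarrow> b \<in> Obj B \<Longrightarrow> c \<in> Obj C \<Longrightarrow>
      map2 H (map2 (Lfun (A \<otimes> B) C c) (map2 (Lfun A B b) \<alpha>))
        = map2 K (map2 (Lfun (A \<otimes> B) C c) (map2 (Lfun A B b) \<alpha>))"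
    and LR2: "\<And>a \<beta> c. a \<in> Obj A \<Longrightarrow> \<beta> \<in> Arr2 B \<Longrightarrow> c \<in> Obj C \<Longrightarrow>
      map2 H (map2 (Lfun (A \<otimes> B) C c) (map2 (Rfun A B a) \<beta>))
        = map2 K (map2 (Lfun (A \<otimes> B) C c) (map2 (Rfun A B a) \<beta>))"
    and R2: "\<And>a b \<gamma>. a \<in> Obj A \<Longrightarrow> b \<in> Obj B \<Longrightarrow> \<gamma> \<in> Arr2 C \<Longrightarrow>
      map2 H (map2 (Rfun (A \<otimes> B) C (opair a b)) \<gamma>) = map2 K (map2 (Rfun (A \<otimes> B) C (opair a b)) \<gamma>)"
    and LS: "\<And>f g c. f \<in> Arr1 A \<Longrightarrow> g \<in> Arr1 B \<Longrightarrow> c \<in> Obj C \<Longrightarrow>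
      map2 H (map2 (Lfun (A \<otimes> B) C c) (gsig A B f g)) = map2 K (map2 (Lfun (A \<otimes> B) C c) (gsig A B f g))"
    and SL: "\<And>f b h. f \<in> Arr1 A \<Longrightarrow> b \<in> Obj B \<Longrightarrow> h \<in> Arr1 C \<Longrightarrow>
      map2 H (gsig (A \<otimes> B) C (map1 (Lfun A B b) f) h) = map2 K (gsig (A \<otimes> B) C (map1 (Lfun A B b) f) h)"
    and SR: "\<And>a g h. a \<in> Obj A \<Longrightarrow> g \<in> Arr1 B \<Longrightarrow> h \<in> Arr1 C \<Longrightarrow>
      map2 H (gsig (A \<otimes> B) C (map1 (Rfun A B a) g) h) = map2 K (gsig (A \<otimes> B) C (map1 (Rfun A B a) g) h)"
  shows "H = K"
proof -
  let ?X = "A \<otimes> B"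
  interpret AB: gray_pair A B using ABC(1,2) by (rule gray_pairI)
  interpret XC: gray_pair ?X C using ABC by (intro gray_pairI) simp_all
  note [simp] = ABC H K \<open>Cod H = Cod K\<close>
  have L: "comp_fun H (Lfun ?X C c) = comp_fun K (Lfun ?X C c)" if [simp]: "c \<in> Obj C" for c
    by (rule AB.gray_functor_eqI) (simp_all add: ob LL1 LR1 LL2 LR2 LS)
  have L1: "map1 H (map1 (Lfun ?X C c) x) = map1 K (map1 (Lfun ?X C c) x)" if "x \<in> Arr1 ?X" "c \<in> Obj C" for x c
    using arg_cong[OF L[OF that(2)], of "\<lambda>J. map1 J x"] that by simp
  have L2: "map2 H (map2 (Lfun ?X C c) x) = map2 K (map2 (Lfun ?X C c) x)" if "x \<in> Arr2 ?X" "c \<in> Obj C" for x c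
    using arg_cong[OF L[OF that(2)], of "\<lambda>J. map2 J x"] that by simp
  have S: "map2 H (gsig ?X C x h) = map2 K (gsig ?X C x h)" if "x \<in> Arr1 ?X" "h \<in> Arr1 C" for x h
    using that(1)
  proof (induction rule: AB.Arr1_gray_induct)
    case (comp x y)
    then show ?case using that(2) by (intro gsig_comp_left_eq) (simp_all add: L1)
  qed (simp_all add: SL SR that)
  show ?thesis
    by (rule XC.gray_functor_eqI) (auto simp: ob L1 L2 R1 R2 S elim!: AB.Obj_grayE)
qed

end

text \<open>\<Sigma>_{f,g} has to go to the inverse of \<Sigma>_{g,f}, since exchanging the factors
  exchanges its source and target.\<close>

definition gray_swap :: "'u cat2 \<Rightarrow> 'u cat2 \<Rightarrow> 'u fun2" where
  "gray_swap A B = (SOME K. lifts_cubical A B (B \<otimes> A) (Rfun B A) (Lfun B A)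
     (\<lambda>f g. inv2 (B \<otimes> A) (gsig B A g f)) K)"

text \<open>The cells of the terminal factor are identities, so the generators they give, and every
  \<Sigma>, are sent to identities.\<close>

definition gray_lunit :: "'u cat2 \<Rightarrow> 'u fun2" where
  "gray_lunit A = (SOME K. lifts_cubical \<one> A A (const_fun \<one> A) (\<lambda>_. id_fun A) (\<lambda>_. id2 A) K)"

definition gray_runit :: "'u cat2 \<Rightarrow> 'u fun2" where
  "gray_runit A = comp_fun (gray_lunit A) (gray_swap A \<one>)"

text \<open>\<open>P\<close>, \<open>Q\<close> and \<open>S\<close> for the associator \<open>(A \<otimes> B) \<otimes> C \<rightarrow> A \<otimes> (B \<otimes> C)\<close>.\<close>

definition assoc_P :: "'u cat2 \<Rightarrow> 'u cat2 \<Rightarrow> 'u cat2 \<Rightarrow> 'u \<Rightarrow> 'u fun2" where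
  "assoc_P A B C c = gray_tensor_fun (id_fun A) (Lfun B C c)"

definition assoc_Q :: "'u cat2 \<Rightarrow> 'u cat2 \<Rightarrow> 'u cat2 \<Rightarrow> 'u \<Rightarrow> 'u fun2" where
  "assoc_Q A B C x = (case decode x of (a, b) \<Rightarrow> comp_fun (Rfun A (B \<otimes> C) a) (Rfun B C b))"

text \<open>S is prescribed only at generators of A \<otimes> B, where it is
  \<Sigma>_{f,1\<otimes>h} and \<open>a \<otimes> -\<close> applied to \<Sigma>_{g,h}. A value at a
  general 1-cell would depend on a decomposition into generators.\<close>

definition is_assoc_S :: "'u cat2 \<Rightarrow> 'u cat2 \<Rightarrow> 'u cat2 \<Rightarrow> ('u \<Rightarrow> 'u \<Rightarrow> 'u) \<Rightarrow> bool" where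
  "is_assoc_S A B C S \<longleftrightarrow> cubical (A \<otimes> B) C (A \<otimes> (B \<otimes> C)) (assoc_P A B C) (assoc_Q A B C) S \<and>
    (\<forall>f\<in>Arr1 A. \<forall>b\<in>Obj B. \<forall>h\<in>Arr1 C. S (map1 (Lfun A B b) f) h = gsig A (B \<otimes> C) f (map1 (Rfun B C b) h)) \<and>
    (\<forall>a\<in>Obj A. \<forall>g\<in>Arr1 B. \<forall>h\<in>Arr1 C. S (map1 (Rfun A B a) g) h = map2 (Rfun A (B \<otimes> C) a) (gsig B C g h))"

definition assoc_S :: "'u cat2 \<Rightarrow> 'u cat2 \<Rightarrow> 'u cat2 \<Rightarrow> 'u \<Rightarrow> 'u \<Rightarrow> 'u" where
  "assoc_S A B C = (SOME S. is_assoc_S A B C S)"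

definition gray_assoc :: "'u cat2 \<Rightarrow> 'u cat2 \<Rightarrow> 'u cat2 \<Rightarrow> 'u fun2" where
  "gray_assoc A B C = (SOME K. lifts_cubical (A \<otimes> B) C (A \<otimes> (B \<otimes> C))
     (assoc_P A B C) (assoc_Q A B C) (assoc_S A B C) K)"

lemma terminal_simps [simp]:
  "Obj \<one> = {code ()}" "Arr1 \<one> = {code ()}"
  "Arr2 \<one> = {code ()}"
  "src1 \<one> (code ()) = code ()" "tgt1 \<one> (code ()) = code ()"
  "src2 \<one> (code ()) = code ()" "tgt2 \<one> (code ()) = code ()"
  "id1 \<one> (code ()) = code ()" "id2 \<one> (code ()) = code ()"
  "comp1 \<one> (code ()) (code ()) = code ()"
  "vcomp \<one> (code ()) (code ()) = code ()"
  "hcomp \<one> (code ()) (code ()) = code ()"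
  by (simp_all add: terminal_twocat_def restrict_twocat_def Let_def)

lemma two_category_terminal [simp]: "two_category \<one>"
  by standard auto

lemma restrict_terminal: "restrict_twocat \<one> = \<one>"
  by (simp add: terminal_twocat_def restrict_twocat_def Let_def fun_eq_iff)

lemma const_fun_simps [simp]:
  "Dom (const_fun A B y) = A" "Cod (const_fun A B y) = B"
  "x \<in> Obj A \<Longrightarrow> map0 (const_fun A B y) x = y"
  "f \<in> Arr1 A \<Longrightarrow> map1 (const_fun A B y) f = id1 B y"
  "\<alpha> \<in> Arr2 A \<Longrightarrow> map2 (const_fun A B y) \<alpha> = id2 B (id1 B y)"
  by (simp_all add: const_fun_def)

lemma two_functor_const_fun [simp]:
  assumes "two_category A" "two_category B" "y \<in> Obj B"
  shows "two_functor (const_fun A B y)"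
proof -
  interpret A: two_category A by fact
  interpret B: two_category B by fact
  show ?thesis
    by (intro two_functor.intro two_functor_axioms.intro) (use assms in \<open>auto simp: const_fun_def B.hcomp_id2\<close>)
qed

context infinite_universe
begin

lemma lifts_gray_swap:
  fixes A B :: "'u cat2"
  assumes "two_category A" "two_category B"
  shows "lifts_cubical A B (B \<otimes> A) (Rfun B A) (Lfun B A) (\<lambda>f g. inv2 (B \<otimes> A) (gsig B A g f)) (gray_swap A B)"
proof -
  interpret AB: gray_pair A B using assms by (rule gray_pairI)
  interpret BA: gray_pair B A using assms by (intro gray_pairI)
  show ?thesis
    unfolding gray_swap_def by (rule AB.lift_cubical[OF BA.gray.cubical_swap]) (rule someI)
qed

lemma gray_swap_simps [simp]:
  fixes A B :: "'u cat2"
  assumes AB: "two_category A" "two_category B"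
  shows "two_functor (gray_swap A B)" "Dom (gray_swap A B) = A \<otimes> B" "Cod (gray_swap A B) = B \<otimes> A"
    "a \<in> Obj A \<Longrightarrow> b \<in> Obj B \<Longrightarrow> map0 (gray_swap A B) (code (a, b)) = code (b, a)"
    "f \<in> Arr1 A \<Longrightarrow> b \<in> Obj B \<Longrightarrow> map1 (gray_swap A B) (map1 (Lfun A B b) f) = map1 (Rfun B A b) f"
    "a \<in> Obj A \<Longrightarrow> g \<in> Arr1 B \<Longrightarrow> map1 (gray_swap A B) (map1 (Rfun A B a) g) = map1 (Lfun B A a) g"
    "\<alpha> \<in> Arr2 A \<Longrightarrow> b \<in> Obj B \<Longrightarrow> map2 (gray_swap A B) (map2 (Lfun A B b) \<alpha>) = map2 (Rfun B A b) \<alpha>"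
    "a \<in> Obj A \<Longrightarrow> \<beta> \<in> Arr2 B \<Longrightarrow> map2 (gray_swap A B) (map2 (Rfun A B a) \<beta>) = map2 (Lfun B A a) \<beta>"
    "f \<in> Arr1 A \<Longrightarrow> g \<in> Arr1 B \<Longrightarrow> map2 (gray_swap A B) (gsig A B f g) = inv2 (B \<otimes> A) (gsig B A g f)"
  using lifts_cubical.maps[OF lifts_gray_swap[OF AB]] AB by simp_all

lemma lifts_gray_lunit:
  fixes A :: "'u cat2"
  assumes "two_category A"
  shows "lifts_cubical \<one> A A (const_fun \<one> A) (\<lambda>_. id_fun A) (\<lambda>_. id2 A) (gray_lunit A)"
proof -
  interpret A: two_category A by fact
  interpret UA: gray_pair \<one> A by (intro gray_pairI assms) simp
  have "cubical \<one> A A (const_fun \<one> A) (\<lambda>_. id_fun A) (\<lambda>_. id2 A)"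
  proof (intro cubical.intro cubical_axioms.intro two_category_terminal assms)
    fix g assume g: "g \<in> Arr1 A"
    interpret F: two_functor "const_fun \<one> A (src1 A g)" using g assms by simp
    interpret G: two_functor "const_fun \<one> A (tgt1 A g)" using g assms by simp
    show "pseudonat (const_fun \<one> A (src1 A g)) (const_fun \<one> A (tgt1 A g))
          (\<lambda>a. map1 (id_fun A) g) (\<lambda>f. id2 A g)"
      by (intro pseudonat.intro pseudonat_axioms.intro F.two_functor_axioms G.two_functor_axioms) (use g in auto)
  next
    fix f :: 'u assume f: "f \<in> Arr1 \<one>"
    interpret F: two_functor "id_fun A" using assms by simp
    show "pseudonat (id_fun A) (id_fun A) (\<lambda>b. map1 (const_fun \<one> A b) f) (\<lambda>g. inv2 A (id2 A g))"
      by (intro pseudonat.intro pseudonat_axioms.intro F.two_functor_axioms) (use f in \<open>auto simp: A.hcomp_id2\<close>)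
  qed (use assms in auto)
  then show ?thesis
    unfolding gray_lunit_def by (rule UA.lift_cubical) (rule someI)
qed

lemma gray_lunit_simps [simp]:
  fixes A :: "'u cat2"
  assumes A: "two_category A"
  shows "two_functor (gray_lunit A)" "Dom (gray_lunit A) = \<one> \<otimes> A" "Cod (gray_lunit A) = A"
    "a \<in> Obj A \<Longrightarrow> map0 (gray_lunit A) (opair (code ()) a) = a"
    "a \<in> Obj A \<Longrightarrow> map1 (gray_lunit A) (map1 (Lfun \<one> A a) (code ())) = id1 A a"
    "f \<in> Arr1 A \<Longrightarrow> map1 (gray_lunit A) (map1 (Rfun \<one> A (code ())) f) = f"
    "a \<in> Obj A \<Longrightarrow> map2 (gray_lunit A) (map2 (Lfun \<one> A a) (code ())) = id2 A (id1 A a)"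
    "\<alpha> \<in> Arr2 A \<Longrightarrow> map2 (gray_lunit A) (map2 (Rfun \<one> A (code ())) \<alpha>) = \<alpha>"
    "f \<in> Arr1 A \<Longrightarrow> map2 (gray_lunit A) (gsig \<one> A (code ()) f) = id2 A f"
  using lifts_cubical.maps[OF lifts_gray_lunit[OF A]] A by simp_all

lemma gray_runit_simps [simp]:
  fixes A :: "'u cat2"
  assumes A: "two_category A"
  shows "two_functor (gray_runit A)" "Dom (gray_runit A) = A \<otimes> \<one>" "Cod (gray_runit A) = A"
    "a \<in> Obj A \<Longrightarrow> map0 (gray_runit A) (opair a (code ())) = a"
    "f \<in> Arr1 A \<Longrightarrow> map1 (gray_runit A) (map1 (Lfun A \<one> (code ())) f) = f"
    "a \<in> Obj A \<Longrightarrow> map1 (gray_runit A) (map1 (Rfun A \<one> a) (code ())) = id1 A a"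
    "\<alpha> \<in> Arr2 A \<Longrightarrow> map2 (gray_runit A) (map2 (Lfun A \<one> (code ())) \<alpha>) = \<alpha>"
    "a \<in> Obj A \<Longrightarrow> map2 (gray_runit A) (map2 (Rfun A \<one> a) (code ())) = id2 A (id1 A a)"
    "f \<in> Arr1 A \<Longrightarrow> map2 (gray_runit A) (gsig A \<one> f (code ())) = id2 A f"
  using A two_category.inv2_id2[OF A] by (simp_all add: gray_runit_def two_functor_maps)

lemma gray_swap_swap:
  fixes A B :: "'u cat2"
  assumes "two_category A" "two_category B"
  shows "comp_fun (gray_swap B A) (gray_swap A B) = id_fun (A \<otimes> B)"
proof -
  interpret gray_pair A B using assms by (rule gray_pairI)
  show ?thesis using assms by (intro gray_functor_eqI) (simp_all add: two_functor_maps)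
qed

text \<open>The inverse includes A at the unique object of the terminal factor. The second composite
  is the identity because generators from the terminal factor are images of identities, and \<Sigma>
  at an identity is an identity.\<close>

lemma gray_lunit_inverse:
  fixes A :: "'u cat2"
  assumes A: "two_category A"
  shows "comp_fun (gray_lunit A) (Rfun \<one> A (code ())) = id_fun A"
    and "comp_fun (Rfun \<one> A (code ())) (gray_lunit A) = id_fun (\<one> \<otimes> A)"
proof -
  interpret UA: gray_pair \<one> A by (intro gray_pairI A) simp
  note [simp] = A
  show "comp_fun (gray_lunit A) (Rfun \<one> A (code ())) = id_fun A"
    by (rule two_functor_eqI[where A = A]) simp_all
  have 1: "map1 (Lfun \<one> A a) (code ()) = id1 (\<one> \<otimes> A) (opair (code ()) a)" if "a \<in> Obj A" for a
    using two_functor_maps(1)[of "Lfun \<one> A a" \<one> "code ()"] that by simp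
  have 2: "map2 (Lfun \<one> A a) (code ()) = id2 (\<one> \<otimes> A) (id1 (\<one> \<otimes> A) (opair (code ()) a))" if "a \<in> Obj A" for a
    using two_functor_maps(3)[of "Lfun \<one> A a" \<one> "code ()"] 1[OF that] that by simp
  have 3: "gsig \<one> A (code ()) g = id2 (\<one> \<otimes> A) (map1 (Rfun \<one> A (code ())) g)" if "g \<in> Arr1 A" for g
    using UA.gray.S_id_left[of "code ()" g] that by simp
  show "comp_fun (Rfun \<one> A (code ())) (gray_lunit A) = id_fun (\<one> \<otimes> A)"
    by (rule UA.gray_functor_eqI) (auto simp: two_functor_maps 1 2 3)
qed

text \<open>For each h a pseudonatural transformation in the variable of A \<otimes> B is extended
  from generators. Pseudonaturality of the inverses in h has to hold for every 1-cell of A \<otimes>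
  B and is closed under its composition, which permits induction.\<close>

lemma is_assoc_S_assoc_S:
  fixes A B C :: "'u cat2"
  assumes ABC: "two_category A" "two_category B" "two_category C"
  shows "is_assoc_S A B C (assoc_S A B C)"
proof -
  let ?X = "A \<otimes> B" and ?Y = "B \<otimes> C"
  let ?D = "A \<otimes> ?Y"
  let ?P = "\<lambda>c. gray_tensor_fun (id_fun A) (Lfun B C c)" and ?Q = "assoc_Q A B C"
  interpret AB: gray_pair A B using ABC(1,2) by (rule gray_pairI)
  interpret BC: gray_pair B C using ABC(2,3) by (rule gray_pairI)
  interpret AY: gray_pair A ?Y using ABC by (intro gray_pairI) simp_all
  note [simp] = ABC
  have [simp]: "?Q (opair a b) = comp_fun (Rfun A ?Y a) (Rfun B C b)" for a b by (simp add: assoc_Q_def)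
  \<comment> \<open>The restrictions of \<open>?P c\<close> to the two kinds of generators, so that
    known transformations have the required boundaries.\<close>
  have PL: "comp_fun (?P c) (Lfun A B b) = Lfun A ?Y (opair b c)" if "b \<in> Obj B" "c \<in> Obj C" for b c
    by (rule two_functor_eqI[where A = A]) (use that in simp_all)
  have PR: "comp_fun (?P c) (Rfun A B a) = comp_fun (Rfun A ?Y a) (Lfun B C c)" if "a \<in> Obj A" "c \<in> Obj C" for a c
    by (rule two_functor_eqI[where A = B]) (use that in simp_all)
  have "\<exists>s. pseudonat (?P (src1 C h)) (?P (tgt1 C h)) (\<lambda>x. map1 (?Q x) h) s \<and>
      (\<forall>f\<in>Arr1 A. \<forall>b\<in>Obj B. s (map1 (Lfun A B b) f) = gsig A ?Y f (map1 (Rfun B C b) h)) \<and>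
      (\<forall>a\<in>Obj A. \<forall>g\<in>Arr1 B. s (map1 (Rfun A B a) g) = map2 (Rfun A ?Y a) (gsig B C g h))" if h: "h \<in> Arr1 C" for h
  proof (rule AB.pseudonat_extend[where D = ?D and sL = "\<lambda>f b. gsig A ?Y f (map1 (Rfun B C b) h)"
        and sR = "\<lambda>a g. map2 (Rfun A ?Y a) (gsig B C g h)" and F = "?P (src1 C h)" and G = "?P (tgt1 C h)"
        and u = "\<lambda>x. map1 (?Q x) h"])
    \<comment> \<open>On the generators from A this is \<Sigma> of A and B \<otimes> C with second
      argument fixed at 1 \<otimes> h.\<close>
    fix b assume b: "b \<in> Obj B"
    show "pseudonat (comp_fun (?P (src1 C h)) (Lfun A B b)) (comp_fun (?P (tgt1 C h)) (Lfun A B b))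
          (\<lambda>a. map1 (?Q (opair a b)) h) (\<lambda>f. gsig A ?Y f (map1 (Rfun B C b) h))"
      using AY.gray.natP[of "map1 (Rfun B C b) h"] b h by (simp add: PL)
  next
    \<comment> \<open>On the generators from B this is the image under \<open>a \<otimes> -\<close>
      of \<Sigma> of B and C with second argument h.\<close>
    fix a assume a: "a \<in> Obj A"
    show "pseudonat (comp_fun (?P (src1 C h)) (Rfun A B a)) (comp_fun (?P (tgt1 C h)) (Rfun A B a))
          (\<lambda>b. map1 (?Q (opair a b)) h) (\<lambda>g. map2 (Rfun A ?Y a) (gsig B C g h))"
      using a h by (simp add: PR) (rule pseudonat.cong[OF pseudonat.comp_left[OF BC.gray.natP]], simp_all)
  next
    \<comment> \<open>Both boundaries of \<Sigma>_{g,h} are composites in B \<otimes> C. Expanding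
      \<Sigma>_{f,-} at them by \<open>S_comp_right\<close> turns its naturality square into the two
      pastings required here.\<close>
    fix f g assume fg: "f \<in> Arr1 A" "g \<in> Arr1 B"
    show "vcomp ?D (vcomp ?D (hcomp ?D (map2 (Rfun A ?Y (tgt1 A f)) (gsig B C g h)) (id2 ?D (map1 (?P (src1 C h)) (map1 (Lfun A B (src1 B g)) f))))
              (hcomp ?D (id2 ?D (map1 (?P (tgt1 C h)) (map1 (Rfun A B (tgt1 A f)) g))) (gsig A ?Y f (map1 (Rfun B C (src1 B g)) h))))
          (hcomp ?D (map2 (?P (tgt1 C h)) (gsig A B f g)) (id2 ?D (map1 (?Q (opair (src1 A f) (src1 B g))) h))) =
        vcomp ?D (hcomp ?D (id2 ?D (map1 (?Q (opair (tgt1 A f) (tgt1 B g))) h)) (map2 (?P (src1 C h)) (gsig A B f g)))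
          (vcomp ?D (hcomp ?D (gsig A ?Y f (map1 (Rfun B C (tgt1 B g)) h)) (id2 ?D (map1 (?P (src1 C h)) (map1 (Rfun A B (src1 A f)) g))))
            (hcomp ?D (id2 ?D (map1 (?P (tgt1 C h)) (map1 (Lfun A B (tgt1 B g)) f))) (map2 (Rfun A ?Y (src1 A f)) (gsig B C g h))))"
      using fg h AY.gray.S_natural_right[of f "gsig B C g h"]
      by (simp add: AY.gray.S_comp_right AY.gray.D.vcomp_assoc AY.gray.D.comp1_assoc two_functor_maps)
  next
    fix s assume "pseudonat (?P (src1 C h)) (?P (tgt1 C h)) (\<lambda>x. map1 (?Q x) h) s"
      "\<And>f b. f \<in> Arr1 A \<Longrightarrow> b \<in> Obj B \<Longrightarrow> s (map1 (Lfun A B b) f) = gsig A ?Y f (map1 (Rfun B C b) h)"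
      "\<And>a g. a \<in> Obj A \<Longrightarrow> g \<in> Arr1 B \<Longrightarrow> s (map1 (Rfun A B a) g) = map2 (Rfun A ?Y a) (gsig B C g h)"
    then show ?thesis by blast
  qed (use h in \<open>auto elim!: AB.Obj_grayE\<close>)
  then obtain s where
    nat: "\<And>h. h \<in> Arr1 C \<Longrightarrow> pseudonat (?P (src1 C h)) (?P (tgt1 C h)) (\<lambda>x. map1 (?Q x) h) (s h)"
    and sL: "\<And>h f b. h \<in> Arr1 C \<Longrightarrow> f \<in> Arr1 A \<Longrightarrow> b \<in> Obj B \<Longrightarrow> s h (map1 (Lfun A B b) f)
      = gsig A ?Y f (map1 (Rfun B C b) h)"
    and sR: "\<And>h a g. h \<in> Arr1 C \<Longrightarrow> a \<in> Obj A \<Longrightarrow> g \<in> Arr1 B \<Longrightarrow> s h (map1 (Rfun A B a) g)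
      = map2 (Rfun A ?Y a) (gsig B C g h)"
    by metis
  have Q [simp]: "two_functor (?Q x)" "Dom (?Q x) = C" "Cod (?Q x) = ?D" if "x \<in> Obj ?X" for x
    using that by (auto elim!: AB.Obj_grayE)
  \<comment> \<open>On generators the transformation is \<Sigma>_{f,-} inverted and restricted along
    \<open>b \<otimes> -\<close>, or the image under \<open>a \<otimes> -\<close> of \<Sigma>_{g,-}
    inverted; composites are vertical composites of transformations.\<close>
  have natQ: "pseudonat (?Q (src1 ?X x)) (?Q (tgt1 ?X x)) (\<lambda>c. map1 (?P c) x) (\<lambda>h. inv2 ?D (s h x))"
    if "x \<in> Arr1 ?X" for x
    using that
  proof (induction rule: AB.Arr1_gray_induct)
    case (L f b)
    then show ?case
      by simp (rule pseudonat.cong[OF pseudonat.comp_right[OF AY.gray.natQ]], simp_all add: sL)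
  next
    case (R a g)
    then show ?case
      by simp (rule pseudonat.cong[OF pseudonat.comp_left[OF BC.gray.natQ]], simp_all add: sR two_functor_maps)
  next
    case (comp x y)
    have wt: "iso2 ?D (s h x)" "src2 ?D (s h x) = comp1 ?D (map1 (?P (tgt1 C h)) x) (map1 (?Q (src1 ?X x)) h)"
      "tgt2 ?D (s h x) = comp1 ?D (map1 (?Q (tgt1 ?X x)) h) (map1 (?P (src1 C h)) x)"
        if "x \<in> Arr1 ?X" "h \<in> Arr1 C" for x h
      using pseudonat.s_iso[OF nat] pseudonat.src2_s[OF nat] pseudonat.tgt2_s[OF nat] that by simp_all
    have map0_PQ: "map0 (?P c) x = map0 (?Q x) c" if "x \<in> Obj ?X" "c \<in> Obj C" for x c
      using that by (elim AB.Obj_grayE) simp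
    have s_comp: "s h (comp1 ?X x y) = vcomp ?D (hcomp ?D (s h x) (id2 ?D (map1 (?P (src1 C h)) y)))
        (hcomp ?D (id2 ?D (map1 (?P (tgt1 C h)) x)) (s h y))" if "h \<in> Arr1 C" for h
      using pseudonat.s_comp1[OF nat[OF that], of x y] comp(1-3) that by simp
    \<comment> \<open>Inversion reverses the order of the pasting, which gives exactly the cells of
      the vertical composite of the transformations for y and x.\<close>
    have inv_s: "inv2 ?D (s h (comp1 ?X x y))
      = vcomp ?D (hcomp ?D (id2 ?D (map1 (?P (tgt1 C h)) x)) (inv2 ?D (s h y)))
        (hcomp ?D (inv2 ?D (s h x)) (id2 ?D (map1 (?P (src1 C h)) y)))" if h: "h \<in> Arr1 C" for h
      using comp(1-3) h
      by (simp add: s_comp wt AY.gray.D.iso2_in AY.gray.D.inv2_vcomp AY.gray.D.inv2_hcomp AY.gray.D.comp1_assoc map0_PQ)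
    have "src1 ?X (comp1 ?X x y) = src1 ?X y" "tgt1 ?X (comp1 ?X x y) = tgt1 ?X x" using comp(1-3) by simp_all
    then show ?case
      using pseudonat.cong[OF pseudonat_vcomp[OF comp(5) comp(4)[unfolded comp(3)]]] comp(1-3)
      by (simp add: inv_s two_functor_maps)
  qed
  have "cubical ?X C ?D ?P ?Q (\<lambda>x h. s h x)"
  proof (intro cubical.intro cubical_axioms.intro)
    fix x c assume "x \<in> Obj ?X" "c \<in> Obj C"
    then show "map0 (?Q x) c = map0 (?P c) x" by (elim AB.Obj_grayE) simp
  qed (use nat natQ in simp_all)
  then have "is_assoc_S A B C (\<lambda>x h. s h x)"
    by (simp add: is_assoc_S_def sL sR assoc_P_def[abs_def])
  then show ?thesis unfolding assoc_S_def by (rule someI[of "is_assoc_S A B C"])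
qed

lemma lifts_gray_assoc:
  fixes A B C :: "'u cat2"
  assumes ABC: "two_category A" "two_category B" "two_category C"
  shows "lifts_cubical (A \<otimes> B) C (A \<otimes> (B \<otimes> C))
     (assoc_P A B C) (assoc_Q A B C) (assoc_S A B C) (gray_assoc A B C)"
proof -
  interpret XC: gray_pair "A \<otimes> B" C by (intro gray_pairI) (simp_all add: ABC)
  have "cubical (A \<otimes> B) C (A \<otimes> (B \<otimes> C)) (assoc_P A B C) (assoc_Q A B C) (assoc_S A B C)"
    using is_assoc_S_assoc_S[OF ABC] by (simp add: is_assoc_S_def)
  then show ?thesis unfolding gray_assoc_def by (rule XC.lift_cubical) (rule someI)
qed

lemma gray_assoc_simps [simp]:
  fixes A B C :: "'u cat2"
  assumes ABC: "two_category A" "two_category B" "two_category C"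
  defines "X \<equiv> A \<otimes> B" and "Y \<equiv> B \<otimes> C" and "K \<equiv> gray_assoc A B C"
  shows "two_functor K" "Dom K = X \<otimes> C" "Cod K = A \<otimes> Y"
    "a \<in> Obj A \<Longrightarrow> b \<in> Obj B \<Longrightarrow> c \<in> Obj C \<Longrightarrow> map0 K (opair (opair a b) c) = opair a (opair b c)"
    "f \<in> Arr1 A \<Longrightarrow> b \<in> Obj B \<Longrightarrow> c \<in> Obj C \<Longrightarrow> map1 K (map1 (Lfun X C c) (map1 (Lfun A B b) f))
      = map1 (Lfun A Y (opair b c)) f"
    "a \<in> Obj A \<Longrightarrow> g \<in> Arr1 B \<Longrightarrow> c \<in> Obj C \<Longrightarrow> map1 K (map1 (Lfun X C c) (map1 (Rfun A B a) g))
      = map1 (Rfun A Y a) (map1 (Lfun B C c) g)"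
    "a \<in> Obj A \<Longrightarrow> b \<in> Obj B \<Longrightarrow> h \<in> Arr1 C \<Longrightarrow> map1 K (map1 (Rfun X C (opair a b)) h)
      = map1 (Rfun A Y a) (map1 (Rfun B C b) h)"
    "\<alpha> \<in> Arr2 A \<Longrightarrow> b \<in> Obj B \<Longrightarrow> c \<in> Obj C \<Longrightarrow> map2 K (map2 (Lfun X C c) (map2 (Lfun A B b) \<alpha>))
      = map2 (Lfun A Y (opair b c)) \<alpha>"
    "a \<in> Obj A \<Longrightarrow> \<beta> \<in> Arr2 B \<Longrightarrow> c \<in> Obj C \<Longrightarrow> map2 K (map2 (Lfun X C c) (map2 (Rfun A B a) \<beta>))
      = map2 (Rfun A Y a) (map2 (Lfun B C c) \<beta>)"
    "a \<in> Obj A \<Longrightarrow> b \<in> Obj B \<Longrightarrow> \<gamma> \<in> Arr2 C \<Longrightarrow> map2 K (map2 (Rfun X C (opair a b)) \<gamma>)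
      = map2 (Rfun A Y a) (map2 (Rfun B C b) \<gamma>)"
    "f \<in> Arr1 A \<Longrightarrow> g \<in> Arr1 B \<Longrightarrow> c \<in> Obj C \<Longrightarrow> map2 K (map2 (Lfun X C c) (gsig A B f g))
      = gsig A Y f (map1 (Lfun B C c) g)"
    "f \<in> Arr1 A \<Longrightarrow> b \<in> Obj B \<Longrightarrow> h \<in> Arr1 C \<Longrightarrow> map2 K (gsig X C (map1 (Lfun A B b) f) h)
      = gsig A Y f (map1 (Rfun B C b) h)"
    "a \<in> Obj A \<Longrightarrow> g \<in> Arr1 B \<Longrightarrow> h \<in> Arr1 C \<Longrightarrow> map2 K (gsig X C (map1 (Rfun A B a) g) h)
      = map2 (Rfun A Y a) (gsig B C g h)"
  using ABC lifts_cubical.maps[OF lifts_gray_assoc[OF ABC]] is_assoc_S_assoc_S[OF ABC]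
  by (simp_all add: X_def Y_def K_def assoc_P_def assoc_Q_def is_assoc_S_def)

section \<open>Functoriality of the tensor, naturality and coherence of the constraints\<close>

lemma gray_tensor_fun_id:
  fixes A B :: "'u cat2"
  assumes [simp]: "two_category A" "two_category B"
  shows "gray_tensor_fun (id_fun A) (id_fun B) = id_fun (A \<otimes> B)"
proof -
  interpret gray_pair A B by (intro gray_pairI) simp_all
  show ?thesis by (rule gray_functor_eqI) simp_all
qed

lemma gray_tensor_fun_comp_fun:
  fixes F G F' G' :: "'u fun2"
  assumes F [simp]: "two_functor F" "two_functor F'" "two_functor G" "two_functor G'" "Dom G = Cod F" "Dom G'
    = Cod F'"
  shows "gray_tensor_fun (comp_fun G F) (comp_fun G' F') = comp_fun (gray_tensor_fun G G') (gray_tensor_fun F F')"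
proof -
  have [simp]: "two_category (Dom F)" "two_category (Dom F')" by (intro two_functor.axioms F)+
  interpret gray_pair "Dom F" "Dom F'" by (intro gray_pairI) simp_all
  show ?thesis by (rule gray_functor_eqI) simp_all
qed

lemma gray_assoc_natural:
  fixes F G H :: "'u fun2"
  assumes F [simp]: "two_functor F" "two_functor G" "two_functor H"
  shows "comp_fun (gray_assoc (Cod F) (Cod G) (Cod H)) (gray_tensor_fun (gray_tensor_fun F G) H) =
    comp_fun (gray_tensor_fun F (gray_tensor_fun G H)) (gray_assoc (Dom F) (Dom G) (Dom H))"
proof -
  have [simp]: "two_category (Dom F)" "two_category (Dom G)" "two_category (Dom H)"
    "two_category (Cod F)" "two_category (Cod G)" "two_category (Cod H)"
    by (intro two_functor.axioms F)+
  show ?thesis by (rule gray_left_eqI[of "Dom F" "Dom G" "Dom H"]) simp_all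
qed

text \<open>Reverses the order of the three factors, from A \<otimes> (B \<otimes> C) to (C
  \<otimes> B) \<otimes> A. It also exchanges the two bracketings, so conjugating the associator of
  C, B, A by it gives a map in the opposite direction.\<close>

definition gray_reverse :: "'u cat2 \<Rightarrow> 'u cat2 \<Rightarrow> 'u cat2 \<Rightarrow> 'u fun2" where
  "gray_reverse A B C = comp_fun (gray_tensor_fun (gray_swap B C) (id_fun A)) (gray_swap A (B \<otimes> C))"

definition gray_assoc_inv :: "'u cat2 \<Rightarrow> 'u cat2 \<Rightarrow> 'u cat2 \<Rightarrow> 'u fun2" where
  "gray_assoc_inv A B C = comp_fun (gray_reverse C B A) (comp_fun (gray_assoc C B A) (gray_reverse A B C))"

text \<open>The left inverse law is checked on generators of the left-bracketed product. The right
  inverse law follows formally, which avoids a second generator criterion for the other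
  bracketing.\<close>

lemma gray_assoc_inverse:
  fixes A B C :: "'u cat2"
  assumes ABC [simp]: "two_category A" "two_category B" "two_category C"
  shows "two_functor (gray_assoc_inv A B C)"
    and "Dom (gray_assoc_inv A B C) = A \<otimes> (B \<otimes> C)"
    and "Cod (gray_assoc_inv A B C) = (A \<otimes> B) \<otimes> C"
    and "comp_fun (gray_assoc_inv A B C) (gray_assoc A B C) = id_fun ((A \<otimes> B) \<otimes> C)"
    and "comp_fun (gray_assoc A B C) (gray_assoc_inv A B C) = id_fun (A \<otimes> (B \<otimes> C))"
proof -
  show "two_functor (gray_assoc_inv A B C)" "Dom (gray_assoc_inv A B C) = A \<otimes> (B \<otimes> C)"
    "Cod (gray_assoc_inv A B C) = (A \<otimes> B) \<otimes> C"
    by (simp_all add: gray_assoc_inv_def gray_reverse_def)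
  have inverse: "comp_fun (gray_assoc_inv X Y Z) (gray_assoc X Y Z) = id_fun ((X \<otimes> Y) \<otimes> Z)"
    if [simp]: "two_category X" "two_category Y" "two_category Z" for X Y Z :: "'u cat2"
    by (rule gray_left_eqI[of X Y Z]) (simp_all add: gray_assoc_inv_def gray_reverse_def two_functor_maps)
  then show "comp_fun (gray_assoc_inv A B C) (gray_assoc A B C) = id_fun ((A \<otimes> B) \<otimes> C)" by simp
  let ?R = "gray_reverse A B C" and ?a = "gray_assoc A B C"
  let ?R' = "comp_fun (gray_swap (B \<otimes> C) A) (gray_tensor_fun (gray_swap C B) (id_fun A))"
  have [simp]: "two_functor (gray_reverse X Y Z)" "Dom (gray_reverse X Y Z) = X \<otimes> (Y \<otimes> Z)"
    "Cod (gray_reverse X Y Z) = (Z \<otimes> Y) \<otimes> X"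
    if "two_category X" "two_category Y" "two_category Z" for X Y Z :: "'u cat2"
    using that by (simp_all add: gray_reverse_def)
  have "comp_fun ?R' ?R = comp_fun (gray_swap (B \<otimes> C) A)
      (comp_fun (comp_fun (gray_tensor_fun (gray_swap C B) (id_fun A)) (gray_tensor_fun (gray_swap B C) (id_fun A)))
        (gray_swap A (B \<otimes> C)))"
    by (simp add: gray_reverse_def comp_fun_assoc)
  then have R: "comp_fun ?R' ?R = id_fun (A \<otimes> (B \<otimes> C))"
    by (simp add: gray_swap_swap gray_tensor_fun_id comp_fun_id_left flip: gray_tensor_fun_comp_fun)
  \<comment> \<open>Inserting \<open>?R'\<close> after \<open>?R\<close> makes the inverse
    associator of C, B, A appear next to the associator of C, B, A, where the left inverse law
    cancels the pair.\<close>
  have "comp_fun ?a (gray_assoc_inv A B C) = comp_fun (comp_fun ?R' ?R) (comp_fun ?a (gray_assoc_inv A B C))"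
    by (simp add: R comp_fun_id_left gray_assoc_inv_def)
  also have "\<dots> = comp_fun ?R' (comp_fun (comp_fun (gray_assoc_inv C B A) (gray_assoc C B A)) ?R)"
    by (simp add: gray_assoc_inv_def comp_fun_assoc)
  also have "\<dots> = id_fun (A \<otimes> (B \<otimes> C))" by (simp add: inverse comp_fun_id_left R)
  finally show "comp_fun ?a (gray_assoc_inv A B C) = id_fun (A \<otimes> (B \<otimes> C))" .
qed

lemma gray_lunit_natural:
  fixes F :: "'u fun2"
  assumes F [simp]: "two_functor F"
  shows "comp_fun F (gray_lunit (Dom F)) = comp_fun (gray_lunit (Cod F)) (gray_tensor_fun (id_fun \<one>) F)"
proof -
  have [simp]: "two_category (Dom F)" "two_category (Cod F)" by (intro two_functor.axioms F)+
  interpret gray_pair \<one> "Dom F" by (intro gray_pairI) simp_all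
  show ?thesis by (rule gray_functor_eqI) (auto simp: two_functor_maps)
qed

lemma gray_runit_natural:
  fixes F :: "'u fun2"
  assumes F [simp]: "two_functor F"
  shows "comp_fun F (gray_runit (Dom F)) = comp_fun (gray_runit (Cod F)) (gray_tensor_fun F (id_fun \<one>))"
proof -
  have [simp]: "two_category (Dom F)" "two_category (Cod F)" by (intro two_functor.axioms F)+
  interpret gray_pair "Dom F" \<one> by (intro gray_pairI) simp_all
  show ?thesis by (rule gray_functor_eqI) (auto simp: two_functor_maps)
qed

definition gray_runit_inv :: "'u cat2 \<Rightarrow> 'u fun2" where
  "gray_runit_inv A = comp_fun (gray_swap \<one> A) (Rfun \<one> A (code ()))"

lemma gray_runit_inverse:
  fixes A :: "'u cat2"
  assumes A [simp]: "two_category A"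
  shows "two_functor (gray_runit_inv A)" "Dom (gray_runit_inv A) = A" "Cod (gray_runit_inv A) = A \<otimes> \<one>"
    and "comp_fun (gray_runit A) (gray_runit_inv A) = id_fun A"
    and "comp_fun (gray_runit_inv A) (gray_runit A) = id_fun (A \<otimes> \<one>)"
proof -
  show "two_functor (gray_runit_inv A)" "Dom (gray_runit_inv A) = A" "Cod (gray_runit_inv A) = A \<otimes> \<one>"
    by (simp_all add: gray_runit_inv_def)
  have "comp_fun (gray_runit A) (gray_runit_inv A) =
      comp_fun (gray_lunit A) (comp_fun (comp_fun (gray_swap A \<one>) (gray_swap \<one> A)) (Rfun \<one> A (code ())))"
    by (simp add: gray_runit_def gray_runit_inv_def comp_fun_assoc)
  then show "comp_fun (gray_runit A) (gray_runit_inv A) = id_fun A"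
    by (simp add: gray_swap_swap comp_fun_id_left gray_lunit_inverse)
  have "comp_fun (gray_runit_inv A) (gray_runit A) =
      comp_fun (gray_swap \<one> A) (comp_fun (comp_fun (Rfun \<one> A (code ())) (gray_lunit A)) (gray_swap A \<one>))"
    by (simp add: gray_runit_def gray_runit_inv_def comp_fun_assoc)
  then show "comp_fun (gray_runit_inv A) (gray_runit A) = id_fun (A \<otimes> \<one>)"
    by (simp add: gray_swap_swap comp_fun_id_left gray_lunit_inverse)
qed

lemma gsig_id:
  fixes A B :: "'u cat2"
  assumes "two_category A" "two_category B"
  shows "a \<in> Obj A \<Longrightarrow> g \<in> Arr1 B \<Longrightarrow> gsig A B (id1 A a) g = id2 (A \<otimes> B) (map1 (Rfun A B a) g)"
    and "f \<in> Arr1 A \<Longrightarrow> b \<in> Obj B \<Longrightarrow> gsig A B f (id1 B b) = id2 (A \<otimes> B) (map1 (Lfun A B b) f)"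
proof -
  interpret gray_pair A B using assms by (rule gray_pairI)
  show "a \<in> Obj A \<Longrightarrow> g \<in> Arr1 B \<Longrightarrow> gsig A B (id1 A a) g = id2 (A \<otimes> B) (map1 (Rfun A B a) g)"
    "f \<in> Arr1 A \<Longrightarrow> b \<in> Obj B \<Longrightarrow> gsig A B f (id1 B b) = id2 (A \<otimes> B) (map1 (Lfun A B b) f)"
    by (simp_all add: gray.S_id_left gray.S_id_right)
qed

text \<open>On generators the middle factor contributes only identities; wherever \<Sigma> survives
  on one side, one of its arguments is an identity and \<open>gsig_id\<close> removes it.\<close>

lemma gray_triangle:
  fixes A B :: "'u cat2"
  assumes [simp]: "two_category A" "two_category B"
  shows "comp_fun (gray_tensor_fun (id_fun A) (gray_lunit B)) (gray_assoc A \<one> B) =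
    gray_tensor_fun (gray_runit A) (id_fun B)"
  by (rule gray_left_eqI[of A \<one> B]) (auto simp: two_functor_maps gsig_id)

text \<open>Restricted to the first three factors, both sides are compared by
  \<open>gray_left_eqI\<close>. The cells \<Sigma>_{x,k} need two nested inductions, over 1-cells of
  (A \<otimes> B) \<otimes> C and then over 1-cells of A \<otimes> B inside its left
  generators.\<close>

lemma gray_pentagon:
  fixes A B C D :: "'u cat2"
  assumes [simp]: "two_category A" "two_category B" "two_category C" "two_category D"
  shows "comp_fun (gray_assoc A B (C \<otimes> D)) (gray_assoc (A \<otimes> B) C D) =
    comp_fun (gray_tensor_fun (id_fun A) (gray_assoc B C D))
      (comp_fun (gray_assoc A (B \<otimes> C) D) (gray_tensor_fun (gray_assoc A B C) (id_fun D)))"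
    (is "?H = ?K")
proof -
  let ?X = "A \<otimes> B"
  let ?Y = "?X \<otimes> C"
  interpret AB: gray_pair A B by (intro gray_pairI) simp_all
  interpret XC: gray_pair ?X C by (intro gray_pairI) simp_all
  interpret YD: gray_pair ?Y D by (intro gray_pairI) simp_all
  have H: "two_functor ?H" "Dom ?H = ?Y \<otimes> D" and K: "two_functor ?K" "Dom ?K = ?Y \<otimes> D" "Cod ?H = Cod ?K"
    by simp_all
  have L: "comp_fun ?H (Lfun ?Y D d) = comp_fun ?K (Lfun ?Y D d)" if [simp]: "d \<in> Obj D" for d
    by (rule gray_left_eqI[of A B C]) (simp_all add: two_functor_maps)
  have L1: "map1 ?H (map1 (Lfun ?Y D d) x) = map1 ?K (map1 (Lfun ?Y D d) x)" if "x \<in> Arr1 ?Y" "d \<in> Obj D" for x d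
    using arg_cong[OF L[OF that(2)], of "\<lambda>J. map1 J x"] that by simp
  have L2: "map2 ?H (map2 (Lfun ?Y D d) x) = map2 ?K (map2 (Lfun ?Y D d) x)" if "x \<in> Arr2 ?Y" "d \<in> Obj D" for x d
    using arg_cong[OF L[OF that(2)], of "\<lambda>J. map2 J x"] that by simp
  have comp_eq: "map2 ?H (gsig ?Y D (comp1 ?Y x y) k) = map2 ?K (gsig ?Y D (comp1 ?Y x y) k)"
    if "map2 ?H (gsig ?Y D x k) = map2 ?K (gsig ?Y D x k)" "map2 ?H (gsig ?Y D y k) = map2 ?K (gsig ?Y D y k)"
      "x \<in> Arr1 ?Y" "y \<in> Arr1 ?Y" "src1 ?Y x = tgt1 ?Y y" "k \<in> Arr1 D" for x y k
    by (rule gsig_comp_left_eq[OF _ _ H K]) (use that L1 in simp_all)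
  have SL: "map2 ?H (gsig ?Y D (map1 (Lfun ?X C c) x) k) = map2 ?K (gsig ?Y D (map1 (Lfun ?X C c) x) k)"
    if "x \<in> Arr1 ?X" "c \<in> Obj C" "k \<in> Arr1 D" for x c k
    using that(1)
  proof (induction rule: AB.Arr1_gray_induct)
    case (comp x y)
    then show ?case using that(2,3) comp_eq[of "map1 (Lfun ?X C c) x" k "map1 (Lfun ?X C c) y"]
      by (simp add: two_functor_maps)
  qed (use that in simp_all)
  have S: "map2 ?H (gsig ?Y D x k) = map2 ?K (gsig ?Y D x k)" if "x \<in> Arr1 ?Y" "k \<in> Arr1 D" for x k
    using that(1)
  proof (induction rule: XC.Arr1_gray_induct)
    case (L x c)
    then show ?case using SL that(2) by blast
  next
    case (R x h)
    then show ?case using that(2) by (elim AB.Obj_grayE) simp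
  next
    case (comp x y)
    then show ?case using comp_eq that(2) by blast
  qed
  have ob: "map0 ?H (code (x, d)) = map0 ?K (code (x, d))" if "x \<in> Obj ?Y" "d \<in> Obj D" for x d
    using that by (elim XC.Obj_grayE AB.Obj_grayE) simp
  have R1: "map1 ?H (map1 (Rfun ?Y D x) k) = map1 ?K (map1 (Rfun ?Y D x) k)" if "x \<in> Obj ?Y" "k \<in> Arr1 D" for x k
    using that by (elim XC.Obj_grayE AB.Obj_grayE) simp
  have R2: "map2 ?H (map2 (Rfun ?Y D x) \<delta>) = map2 ?K (map2 (Rfun ?Y D x) \<delta>)" if "x \<in> Obj ?Y" "\<delta> \<in> Arr2 D" for x \<delta>
    using that by (elim XC.Obj_grayE AB.Obj_grayE) simp
  show ?thesis
    by (rule YD.gray_functor_eqI[OF H K ob L1 R1 L2 R2 S])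
qed

end

section \<open>Icons\<close>

lemma is_icon_simps [simp]:
  assumes "is_icon \<alpha>"
  shows "two_functor (iDom \<alpha>)" "two_functor (iCod \<alpha>)"
    "Dom (iCod \<alpha>) = Dom (iDom \<alpha>)" "Cod (iCod \<alpha>) = Cod (iDom \<alpha>)" "map0 (iCod \<alpha>) = map0 (iDom \<alpha>)"
    "two_category (Dom (iDom \<alpha>))" "two_category (Cod (iDom \<alpha>))"
    "Cod (iDom \<alpha>) = D \<Longrightarrow> f \<in> Arr1 (Dom (iDom \<alpha>)) \<Longrightarrow> icomp \<alpha> f \<in> Arr2 D"
    "Cod (iDom \<alpha>) = D \<Longrightarrow> f \<in> Arr1 (Dom (iDom \<alpha>)) \<Longrightarrow> src2 D (icomp \<alpha> f) = map1 (iDom \<alpha>) f"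
    "Cod (iDom \<alpha>) = D \<Longrightarrow> f \<in> Arr1 (Dom (iDom \<alpha>)) \<Longrightarrow> tgt2 D (icomp \<alpha> f) = map1 (iCod \<alpha>) f"
  using is_icon.axioms(1,2)[OF assms] is_icon.same_Dom[OF assms] is_icon.same_Cod[OF assms] is_icon.same_map0[OF assms]
    is_icon.icomp_in[OF assms] is_icon.icomp_src2[OF assms] is_icon.icomp_tgt2[OF assms]
    two_functor.axioms(1,2)[OF is_icon.axioms(1)[OF assms]]
  by auto

lemma icon_eqI:
  assumes "is_icon \<alpha>" "is_icon \<beta>" "iDom \<alpha> = iDom \<beta>" "iCod \<alpha> = iCod \<beta>"
    and "\<And>f. f \<in> Arr1 (Dom (iDom \<alpha>)) \<Longrightarrow> icomp \<alpha> f = icomp \<beta> f"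
  shows "\<alpha> = \<beta>"
proof (rule icon.equality)
  show "icomp \<alpha> = icomp \<beta>"
    by (rule PiE_ext[OF is_icon.icomp_in[OF assms(1)]]) (use assms is_icon.icomp_in[OF assms(2)] in simp_all)
qed (use assms in simp_all)

lemma icon_ops_simps [simp]:
  "iDom (id_icon F) = F" "iCod (id_icon F) = F" "f \<in> Arr1 (Dom F) \<Longrightarrow> icomp (id_icon F) f = id2 (Cod F) (map1 F f)"
  "iDom (vcomp_icon \<beta> \<alpha>) = iDom \<alpha>" "iCod (vcomp_icon \<beta> \<alpha>) = iCod \<beta>"
  "f \<in> Arr1 (Dom (iDom \<alpha>)) \<Longrightarrow> icomp (vcomp_icon \<beta> \<alpha>) f = vcomp (Cod (iDom \<alpha>)) (icomp \<beta> f) (icomp \<alpha> f)"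
  "iDom (hcomp_icon \<gamma> \<alpha>) = comp_fun (iDom \<gamma>) (iDom \<alpha>)" "iCod (hcomp_icon \<gamma> \<alpha>) = comp_fun (iCod \<gamma>) (iCod \<alpha>)"
  "f \<in> Arr1 (Dom (iDom \<alpha>)) \<Longrightarrow> icomp (hcomp_icon \<gamma> \<alpha>) f =
     vcomp (Cod (iDom \<gamma>)) (icomp \<gamma> (map1 (iCod \<alpha>) f)) (map2 (iDom \<gamma>) (icomp \<alpha> f))"
  by (simp_all add: id_icon_def vcomp_icon_def hcomp_icon_def)

lemma is_icon_id_icon [simp]:
  assumes "two_functor F"
  shows "is_icon (id_icon F)"
proof -
  interpret two_functor F by fact
  show ?thesis
    by (intro is_icon.intro is_icon_axioms.intro)
      (auto simp: two_functor_axioms map_id1 map_comp1 B.hcomp_id2 id_icon_def)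
qed

lemma is_icon_vcomp_icon [simp]:
  assumes \<alpha>: "is_icon \<alpha>" and \<beta>: "is_icon \<beta>" and c: "iDom \<beta> = iCod \<alpha>"
  shows "is_icon (vcomp_icon \<beta> \<alpha>)"
proof -
  interpret \<alpha>: is_icon \<alpha> by fact
  interpret \<beta>: is_icon \<beta> by fact
  note [simp] = \<alpha> \<beta> c
  let ?C = "Cod (iDom \<alpha>)" and ?A = "Dom (iDom \<alpha>)"
  have nat: "vcomp ?C (vcomp ?C (icomp \<beta> (tgt2 ?A \<theta>)) (icomp \<alpha> (tgt2 ?A \<theta>))) (map2 (iDom \<alpha>) \<theta>) =
      vcomp ?C (map2 (iCod \<beta>) \<theta>) (vcomp ?C (icomp \<beta> (src2 ?A \<theta>)) (icomp \<alpha> (src2 ?A \<theta>)))" if "\<theta> \<in> Arr2 ?A" for \<theta>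
  proof -
    have "vcomp ?C (vcomp ?C (icomp \<beta> (tgt2 ?A \<theta>)) (icomp \<alpha> (tgt2 ?A \<theta>))) (map2 (iDom \<alpha>) \<theta>) =
        vcomp ?C (icomp \<beta> (tgt2 ?A \<theta>)) (vcomp ?C (map2 (iCod \<alpha>) \<theta>) (icomp \<alpha> (src2 ?A \<theta>)))"
      using that \<alpha>.icon_natural[of \<theta>] by (simp add: \<alpha>.F.B.vcomp_assoc)
    also have "\<dots> = vcomp ?C (vcomp ?C (icomp \<beta> (tgt2 ?A \<theta>)) (map2 (iCod \<alpha>) \<theta>)) (icomp \<alpha> (src2 ?A \<theta>))"
      using that by (simp add: \<alpha>.F.B.vcomp_assoc)
    also have "vcomp ?C (icomp \<beta> (tgt2 ?A \<theta>)) (map2 (iCod \<alpha>) \<theta>) = vcomp ?C (map2 (iCod \<beta>) \<theta>) (icomp \<beta> (src2 ?A \<theta>))"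
      using that \<beta>.icon_natural[of \<theta>] by simp
    finally show ?thesis using that by (simp add: \<alpha>.F.B.vcomp_assoc)
  qed
  show ?thesis
    by (intro is_icon.intro is_icon_axioms.intro)
      (use \<alpha>.icon_id1 \<beta>.icon_id1 \<alpha>.icon_comp1 \<beta>.icon_comp1 nat in \<open>auto simp: vcomp_icon_def \<alpha>.F.B.interchange\<close>)
qed

text \<open>Naturality combines the image of naturality of \<alpha> under
  \<open>iDom \<beta>\<close> with naturality of \<beta> at a 2-cell in the image of
  \<open>iCod \<alpha>\<close>; compatibility with composition of 1-cells is interchange.\<close>

lemma is_icon_hcomp_icon [simp]:
  assumes \<alpha>: "is_icon \<alpha>" and \<beta>: "is_icon \<beta>" and c: "Dom (iDom \<beta>) = Cod (iDom \<alpha>)"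
  shows "is_icon (hcomp_icon \<beta> \<alpha>)"
proof -
  interpret \<alpha>: is_icon \<alpha> by fact
  interpret \<beta>: is_icon \<beta> by fact
  note [simp] = \<alpha> \<beta> c
  let ?C = "Cod (iDom \<beta>)" and ?A = "Dom (iDom \<alpha>)" and ?B = "Cod (iDom \<alpha>)"
  let ?F = "iDom \<alpha>" and ?G = "iCod \<alpha>" and ?H = "iDom \<beta>" and ?K = "iCod \<beta>"
  have nat: "vcomp ?C (vcomp ?C (icomp \<beta> (map1 ?G (tgt2 ?A \<theta>))) (map2 ?H (icomp \<alpha> (tgt2 ?A \<theta>)))) (map2 ?H (map2 ?F \<theta>)) =
      vcomp ?C (map2 ?K (map2 ?G \<theta>)) (vcomp ?C (icomp \<beta> (map1 ?G (src2 ?A \<theta>))) (map2 ?H (icomp \<alpha> (src2 ?A \<theta>))))"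
        if "\<theta> \<in> Arr2 ?A" for \<theta>
  proof -
    have "vcomp ?C (map2 ?H (icomp \<alpha> (tgt2 ?A \<theta>))) (map2 ?H (map2 ?F \<theta>)) =
        vcomp ?C (map2 ?H (map2 ?G \<theta>)) (map2 ?H (icomp \<alpha> (src2 ?A \<theta>)))"
      using that \<alpha>.icon_natural[of \<theta>] two_functor_maps(4)[of ?H ?B "icomp \<alpha> (tgt2 ?A \<theta>)" "map2 ?F \<theta>"]
        two_functor_maps(4)[of ?H ?B "map2 ?G \<theta>" "icomp \<alpha> (src2 ?A \<theta>)"] by simp
    then have "vcomp ?C (vcomp ?C (icomp \<beta> (map1 ?G (tgt2 ?A \<theta>))) (map2 ?H (icomp \<alpha> (tgt2 ?A \<theta>)))) (map2 ?H (map2 ?F \<theta>)) =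
        vcomp ?C (vcomp ?C (icomp \<beta> (map1 ?G (tgt2 ?A \<theta>))) (map2 ?H (map2 ?G \<theta>))) (map2 ?H (icomp \<alpha> (src2 ?A \<theta>)))"
      using that by (simp add: \<beta>.F.B.vcomp_assoc)
    also have "vcomp ?C (icomp \<beta> (map1 ?G (tgt2 ?A \<theta>))) (map2 ?H (map2 ?G \<theta>)) =
        vcomp ?C (map2 ?K (map2 ?G \<theta>)) (icomp \<beta> (map1 ?G (src2 ?A \<theta>)))"
      using that \<beta>.icon_natural[of "map2 ?G \<theta>"] by simp
    finally show ?thesis using that by (simp add: \<beta>.F.B.vcomp_assoc)
  qed
  have id: "vcomp ?C (icomp \<beta> (map1 ?G (id1 ?A x))) (map2 ?H (icomp \<alpha> (id1 ?A x)))
    = id2 ?C (id1 ?C (map0 ?H (map0 ?F x)))"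
    if "x \<in> Obj ?A" for x
    using that \<alpha>.icon_id1[of x] \<beta>.icon_id1[of "map0 ?F x"] by (simp add: two_functor_maps)
  have comp: "vcomp ?C (icomp \<beta> (map1 ?G (comp1 ?A f g))) (map2 ?H (icomp \<alpha> (comp1 ?A f g))) =
      hcomp ?C (vcomp ?C (icomp \<beta> (map1 ?G f)) (map2 ?H (icomp \<alpha> f))) (vcomp ?C (icomp \<beta> (map1 ?G g)) (map2 ?H (icomp \<alpha> g)))"
    if "f \<in> Arr1 ?A" "g \<in> Arr1 ?A" "src1 ?A f = tgt1 ?A g" for f g
    using that \<alpha>.icon_comp1[of f g] \<beta>.icon_comp1[of "map1 ?G f" "map1 ?G g"]
    by (simp add: two_functor_maps \<beta>.F.B.interchange)
  have "icomp (hcomp_icon \<beta> \<alpha>) \<in> Arr1 ?A \<rightarrow>\<^sub>E Arr2 ?C" by (simp add: hcomp_icon_def)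
  moreover have "map0 (comp_fun ?K ?G) = map0 (comp_fun ?H ?F)" by (simp add: comp_fun_def)
  ultimately show ?thesis
    by (intro is_icon.intro is_icon_axioms.intro) (use nat id comp in simp_all)
qed

text \<open>Whiskering by a 2-functor: the identity icon contributes an identity 2-cell, which drops
  out of the general formula for components.\<close>

lemma hcomp_icon_id_icon:
  assumes "is_icon \<alpha>" "two_functor K" "Dom K = Cod (iDom \<alpha>)" "f \<in> Arr1 (Dom (iDom \<alpha>))"
  shows "icomp (hcomp_icon (id_icon K) \<alpha>) f = map2 K (icomp \<alpha> f)"
proof -
  interpret K: two_functor K by fact
  interpret two_category "Cod K" by (rule K.B.two_category_axioms)
  show ?thesis using assms by simp
qed

lemma hcomp_icon_id_icon_right:
  assumes "is_icon \<beta>" "two_functor K" "Dom (iDom \<beta>) = Cod K" "f \<in> Arr1 (Dom K)"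
  shows "icomp (hcomp_icon \<beta> (id_icon K)) f = icomp \<beta> (map1 K f)"
proof -
  interpret two_category "Cod (iDom \<beta>)" using assms by simp
  show ?thesis using assms by (simp add: two_functor_maps)
qed

lemma gray_icon_simps [simp]:
  "A \<in> Obj gray_icon \<longleftrightarrow> two_category A \<and> restrict_twocat A = A"
  "F \<in> Arr1 gray_icon \<longleftrightarrow> two_functor F \<and> Dom F \<in> Obj gray_icon \<and> Cod F \<in> Obj gray_icon"
  "\<alpha> \<in> Arr2 gray_icon \<longleftrightarrow> is_icon \<alpha> \<and> iDom \<alpha> \<in> Arr1 gray_icon \<and> iCod \<alpha> \<in> Arr1 gray_icon"
  "src1 gray_icon = Dom" "tgt1 gray_icon = Cod" "src2 gray_icon = iDom" "tgt2 gray_icon = iCod"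
  "id1 gray_icon = id_fun" "comp1 gray_icon = comp_fun" "id2 gray_icon = id_icon"
  "vcomp gray_icon = vcomp_icon" "hcomp gray_icon = hcomp_icon"
  by (simp_all add: gray_icon_def)

lemma icon_interchange:
  assumes \<alpha>: "is_icon \<alpha>" "is_icon \<alpha>'" "iDom \<alpha>' = iCod \<alpha>" and \<beta>: "is_icon \<beta>" "is_icon \<beta>'" "iDom \<beta>' = iCod \<beta>"
    and c: "Dom (iDom \<alpha>) = Cod (iDom \<beta>)"
  shows "hcomp_icon (vcomp_icon \<alpha>' \<alpha>) (vcomp_icon \<beta>' \<beta>) = vcomp_icon (hcomp_icon \<alpha>' \<beta>') (hcomp_icon \<alpha> \<beta>)"
proof (rule icon_eqI)
  interpret \<alpha>: is_icon \<alpha> by fact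
  note [simp] = assms
  fix f assume "f \<in> Arr1 (Dom (iDom (hcomp_icon (vcomp_icon \<alpha>' \<alpha>) (vcomp_icon \<beta>' \<beta>))))"
  then have f [simp]: "f \<in> Arr1 (Dom (iDom \<beta>))" by simp
  let ?C = "Cod (iDom \<alpha>)" and ?H = "iDom \<alpha>" and ?K = "iCod \<alpha>"
  \<comment> \<open>The components of \<beta>' are themselves 2-cells, so naturality of \<alpha> at
    them exchanges the two middle factors.\<close>
  have "vcomp ?C (icomp \<alpha> (map1 (iCod \<beta>') f)) (map2 ?H (icomp \<beta>' f))
    = vcomp ?C (map2 ?K (icomp \<beta>' f)) (icomp \<alpha> (map1 (iCod \<beta>) f))"
    using \<alpha>.icon_natural[of "icomp \<beta>' f"] by simp
  then have "vcomp ?C (icomp \<alpha> (map1 (iCod \<beta>') f)) (vcomp ?C (map2 ?H (icomp \<beta>' f)) (map2 ?H (icomp \<beta> f))) =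
      vcomp ?C (map2 ?K (icomp \<beta>' f)) (vcomp ?C (icomp \<alpha> (map1 (iCod \<beta>) f)) (map2 ?H (icomp \<beta> f)))"
    by (simp flip: \<alpha>.F.B.vcomp_assoc)
  then show "icomp (hcomp_icon (vcomp_icon \<alpha>' \<alpha>) (vcomp_icon \<beta>' \<beta>)) f
    = icomp (vcomp_icon (hcomp_icon \<alpha>' \<beta>') (hcomp_icon \<alpha> \<beta>)) f"
    by (simp add: two_functor_maps \<alpha>.F.B.vcomp_assoc)
qed (use assms in simp_all)

text \<open>Associativity of horizontal composition rests on preservation of vertical composites by
  2-functors, and interchange on naturality of icons; the remaining laws are componentwise.\<close>

lemma two_category_gray_icon: "two_category gray_icon"
proof (intro two_category.intro)
  fix \<alpha> \<beta> \<gamma> :: "('u, 'u, 'u, 'u, 'u, 'u) icon"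
  assume a: "\<alpha> \<in> Arr2 gray_icon" "\<beta> \<in> Arr2 gray_icon" "\<gamma> \<in> Arr2 gray_icon"
  {
    assume c: "src2 gray_icon \<alpha> = tgt2 gray_icon \<beta>" "src2 gray_icon \<beta> = tgt2 gray_icon \<gamma>"
    interpret \<gamma>: two_category "Cod (iDom \<gamma>)" using a by simp
    show "vcomp gray_icon (vcomp gray_icon \<alpha> \<beta>) \<gamma> = vcomp gray_icon \<alpha> (vcomp gray_icon \<beta> \<gamma>)"
      unfolding gray_icon_simps by (rule icon_eqI) (use a c in \<open>simp_all add: \<gamma>.vcomp_assoc\<close>)
  }
  {
    assume c: "src1 gray_icon (src2 gray_icon \<alpha>) = tgt1 gray_icon (src2 gray_icon \<beta>)"
      "src1 gray_icon (src2 gray_icon \<beta>) = tgt1 gray_icon (src2 gray_icon \<gamma>)"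
    interpret \<alpha>: two_category "Cod (iDom \<alpha>)" using a by simp
    show "hcomp gray_icon (hcomp gray_icon \<alpha> \<beta>) \<gamma> = hcomp gray_icon \<alpha> (hcomp gray_icon \<beta> \<gamma>)"
      unfolding gray_icon_simps
      by (rule icon_eqI) (use a c in \<open>simp_all add: comp_fun_assoc two_functor_maps \<alpha>.vcomp_assoc\<close>)
  }
next
  fix \<alpha> :: "('u, 'u, 'u, 'u, 'u, 'u) icon"
  assume a: "\<alpha> \<in> Arr2 gray_icon"
  interpret \<alpha>: two_category "Cod (iDom \<alpha>)" using a by simp
  show "vcomp gray_icon (id2 gray_icon (tgt2 gray_icon \<alpha>)) \<alpha>
    = \<alpha>" "vcomp gray_icon \<alpha> (id2 gray_icon (src2 gray_icon \<alpha>)) = \<alpha>"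
    unfolding gray_icon_simps by (rule icon_eqI; use a in simp)+
  show "hcomp gray_icon (id2 gray_icon (id1 gray_icon (tgt1 gray_icon (src2 gray_icon \<alpha>)))) \<alpha> = \<alpha>"
    "hcomp gray_icon \<alpha> (id2 gray_icon (id1 gray_icon (src1 gray_icon (src2 gray_icon \<alpha>)))) = \<alpha>"
    unfolding gray_icon_simps by (rule icon_eqI; use a
      in \<open>simp add: comp_fun_id_left comp_fun_id_right two_functor_maps\<close>)+
next
  fix F G :: "('u, 'u, 'u, 'u, 'u, 'u) twofun"
  assume a: "F \<in> Arr1 gray_icon" "G \<in> Arr1 gray_icon" and c: "src1 gray_icon F = tgt1 gray_icon G"
  interpret F: two_functor F using a by simp
  show "hcomp gray_icon (id2 gray_icon F) (id2 gray_icon G) = id2 gray_icon (comp1 gray_icon F G)"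
    unfolding gray_icon_simps by (rule icon_eqI) (use a c in \<open>simp_all add: two_functor_maps\<close>)
qed (auto simp: comp_fun_assoc comp_fun_id_left comp_fun_id_right icon_interchange)

section \<open>The Gray tensor product of icons\<close>

text \<open>Components at composite 1-cells are forced by the icon axiom, so only those at
  generators are prescribed. Agreement of source and target 2-functors on objects gives these
  components the right boundary on both sides.\<close>

definition is_gray_tensor_icon :: "'u icon2 \<Rightarrow> 'u icon2 \<Rightarrow> 'u icon2 \<Rightarrow> bool" where
  "is_gray_tensor_icon \<alpha> \<beta> \<gamma> \<longleftrightarrow> (let A = Dom (iDom \<alpha>); B = Dom (iDom \<beta>); A' = Cod (iDom \<alpha>); B' = Cod (iDom \<beta>) in
    is_icon \<gamma> \<and> iDom \<gamma> = gray_tensor_fun (iDom \<alpha>) (iDom \<beta>) \<and> iCod \<gamma> = gray_tensor_fun (iCod \<alpha>) (iCod \<beta>) \<and>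
    (\<forall>f\<in>Arr1 A. \<forall>b\<in>Obj B. icomp \<gamma> (map1 (Lfun A B b) f) = map2 (Lfun A' B' (map0 (iDom \<beta>) b)) (icomp \<alpha> f)) \<and>
    (\<forall>a\<in>Obj A. \<forall>g\<in>Arr1 B. icomp \<gamma> (map1 (Rfun A B a) g) = map2 (Rfun A' B' (map0 (iDom \<alpha>) a)) (icomp \<beta> g)))"

definition gray_tensor_icon :: "'u icon2 \<Rightarrow> 'u icon2 \<Rightarrow> 'u icon2" where
  "gray_tensor_icon \<alpha> \<beta> = (SOME \<gamma>. is_gray_tensor_icon \<alpha> \<beta> \<gamma>)"

context gray_pair
begin

text \<open>An icon out of A \<otimes> B is a pair of families of icons on the two kinds of
  generators, subject only to naturality at \<Sigma>_{f,g}, which is \<open>compat\<close>.\<close>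

lemma icon_extend:
  assumes F: "two_functor F" "Dom F = AB" "Cod F = D"
    and G: "two_functor G" "Dom G = AB" "Cod G = D" and FG: "map0 G = map0 F"
    and \<alpha>: "\<And>b. b \<in> Obj B \<Longrightarrow> is_icon (\<alpha> b) \<and> iDom (\<alpha> b) = comp_fun F (Lfun A B b) \<and> iCod (\<alpha> b)
      = comp_fun G (Lfun A B b)"
    and \<beta>: "\<And>a. a \<in> Obj A \<Longrightarrow> is_icon (\<beta> a) \<and> iDom (\<beta> a) = comp_fun F (Rfun A B a) \<and> iCod (\<beta> a)
      = comp_fun G (Rfun A B a)"
    and compat: "\<And>f g. f \<in> Arr1 A \<Longrightarrow> g \<in> Arr1 B \<Longrightarrow>
      vcomp D (hcomp D (icomp (\<beta> (tgt1 A f)) g) (icomp (\<alpha> (src1 B g)) f)) (map2 F (gsig A B f g)) =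
      vcomp D (map2 G (gsig A B f g)) (hcomp D (icomp (\<alpha> (tgt1 B g)) f) (icomp (\<beta> (src1 A f)) g))"
  obtains \<gamma> where "is_icon \<gamma>" "iDom \<gamma> = F" "iCod \<gamma> = G"
    "\<And>f b. f \<in> Arr1 A \<Longrightarrow> b \<in> Obj B \<Longrightarrow> icomp \<gamma> (map1 (Lfun A B b) f) = icomp (\<alpha> b) f"
    "\<And>a g. a \<in> Obj A \<Longrightarrow> g \<in> Arr1 B \<Longrightarrow> icomp \<gamma> (map1 (Rfun A B a) g) = icomp (\<beta> a) g"
proof -
  let ?C = "AB"
  interpret F: two_functor F by fact
  interpret G: two_functor G by fact
  interpret D: two_category D using F.B.two_category_axioms F by simp
  note [simp] = F G FG
  have [simp]: "code (a, b) \<in> Obj ?C" if "a \<in> Obj A" "b \<in> Obj B" for a b using that by (simp add: Obj_gray)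
  have \<alpha>_simps [simp]: "is_icon (\<alpha> b)" "iDom (\<alpha> b) = comp_fun F (Lfun A B b)" "iCod (\<alpha> b)
    = comp_fun G (Lfun A B b)" if "b \<in> Obj B" for b
    using \<alpha>[OF that] by auto
  have \<beta>_simps [simp]: "is_icon (\<beta> a)" "iDom (\<beta> a) = comp_fun F (Rfun A B a)" "iCod (\<beta> a)
    = comp_fun G (Rfun A B a)" if "a \<in> Obj A" for a
    using \<beta>[OF that] by auto
  obtain E where E0: "lifts_cells1 A B (Arr2 D) (\<lambda>\<alpha>. src1 D (src2 D \<alpha>)) (\<lambda>\<alpha>. tgt1 D (src2 D \<alpha>)) (\<lambda>x. id2 D (id1 D x)) (hcomp D)
      (map0 F) (\<lambda>f b. icomp (\<alpha> b) f) (\<lambda>a g. icomp (\<beta> a) g) E"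
  proof (rule lift_cells1[OF D.one_category_cells2])
    show "icomp (\<alpha> b) (id1 A a) = id2 D (id1 D (map0 F (code (a, b))))" "icomp (\<beta> a) (id1 B b)
      = id2 D (id1 D (map0 F (code (a, b))))"
      if "a \<in> Obj A" "b \<in> Obj B" for a b
      using is_icon.icon_id1[of "\<alpha> b" a] is_icon.icon_id1[of "\<beta> a" b] that by simp_all
    show "icomp (\<alpha> b) (comp1 A f' f) = hcomp D (icomp (\<alpha> b) f') (icomp (\<alpha> b) f)"
      if "f \<in> Arr1 A" "f' \<in> Arr1 A" "src1 A f' = tgt1 A f" "b \<in> Obj B" for f f' b
      using is_icon.icon_comp1[of "\<alpha> b" f' f] that by simp
    show "icomp (\<beta> a) (comp1 B g' g) = hcomp D (icomp (\<beta> a) g') (icomp (\<beta> a) g)"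
      if "a \<in> Obj A" "g \<in> Arr1 B" "g' \<in> Arr1 B" "src1 B g' = tgt1 B g" for a g g'
      using is_icon.icon_comp1[of "\<beta> a" g' g] that by simp
  qed simp_all
  note E_in [simp] = lifts_cells1.in_Ar[OF E0] and E_id = lifts_cells1.id1[OF E0] and E_comp
    = lifts_cells1.comp1[OF E0]
    and EL = lifts_cells1.L[OF E0] and ER = lifts_cells1.R[OF E0]
  \<comment> \<open>The category of 2-cells under horizontal composition records only endpoint
    objects; the bounding 1-cells are recovered by induction.\<close>
  have "src2 D (E x) = map1 F x \<and> tgt2 D (E x) = map1 G x" if "x \<in> Arr1 ?C" for x
    using that
  proof (induction rule: Arr1_gray_induct)
    case (L f b)
    then show ?case using EL[of f b] L by simp
  next
    case (R a g)
    then show ?case using ER[of a g] R by simp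
  next
    case (comp x y)
    then show ?case
      using lifts_cells1.dm[OF E0] lifts_cells1.cd[OF E0] by (simp add: E_comp two_functor_maps)
  qed
  then have E [simp]: "src2 D (E x) = map1 F x" "tgt2 D (E x) = map1 G x" if "x \<in> Arr1 ?C" for x
    using that by auto
  have natural: "vcomp D (E (tgt2 ?C \<theta>)) (map2 F \<theta>) = vcomp D (map2 G \<theta>) (E (src2 ?C \<theta>))" if "\<theta> \<in> Arr2 ?C" for \<theta>
    using that
  proof (induction rule: Arr2_gray_induct)
    case (L \<theta> b)
    then show ?case using is_icon.icon_natural[of "\<alpha> b" \<theta>] L by (simp add: EL)
  next
    case (R a \<theta>)
    then show ?case using is_icon.icon_natural[of "\<beta> a" \<theta>] R by (simp add: ER)
  next
    case (Sig f g)
    then show ?case using compat[of f g] by (simp add: E_comp EL ER)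
  next
    case (SigInv f g)
    let ?\<theta> = "gsig A B f g"
    have \<theta> [simp]: "iso2 ?C ?\<theta>" "?\<theta> \<in> Arr2 ?C" using SigInv by auto
    define p q where "p = src2 ?C ?\<theta>" and "q = tgt2 ?C ?\<theta>"
    have [simp]: "src2 ?C ?\<theta> = p" "tgt2 ?C ?\<theta> = q" "p \<in> Arr1 ?C" "q \<in> Arr1 ?C"
      using gray.D.src2_in[OF \<theta>(2)] gray.D.tgt2_in[OF \<theta>(2)] by (simp_all only: p_def q_def)
    have IH: "vcomp D (map2 G ?\<theta>) (E p) = vcomp D (E q) (map2 F ?\<theta>)"
      using SigInv(3) by (simp only: p_def q_def)
    have "vcomp D (inv2 D (map2 G ?\<theta>)) (E q) = vcomp D (E p) (inv2 D (map2 F ?\<theta>))"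
      by (rule D.vcomp_inv2_commute[OF _ _ _ _ _ _ _ _ IH]) (simp_all del: gray.S_simps(3,4))
    then show ?case 
      by (simp add: two_functor_maps del: gray.S_simps(3,4))
  next
    case (id x)
    then show ?case by (simp add: two_functor_maps)
  next
    case (vcomp x y)
    have "vcomp D (E (tgt2 ?C x)) (map2 F (vcomp ?C x y))
      = vcomp D (vcomp D (E (tgt2 ?C x)) (map2 F x)) (map2 F y)"
      using vcomp(1-3) by (simp add: two_functor_maps D.vcomp_assoc)
    also have "\<dots> = vcomp D (map2 G x) (vcomp D (E (tgt2 ?C y)) (map2 F y))"
      unfolding vcomp(4) using vcomp(1-3) by (simp add: D.vcomp_assoc)
    also have "\<dots> = vcomp D (map2 G (vcomp ?C x y)) (E (src2 ?C y))"
      unfolding vcomp(5) using vcomp(1-3) by (simp add: two_functor_maps D.vcomp_assoc)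
    finally show ?case using vcomp(1-3) by simp
  next
    case (hcomp x y)
    then show ?case by (simp add: two_functor_maps E_comp flip: D.interchange)
  qed
  define \<gamma> where "\<gamma> = \<lparr>iDom = F, iCod = G, icomp = restrict E (Arr1 ?C)\<rparr>"
  have "is_icon \<gamma>"
    by (intro is_icon.intro is_icon_axioms.intro) (use natural
      in \<open>simp_all add: \<gamma>_def E_comp E_id F.two_functor_axioms G.two_functor_axioms\<close>)
  then show thesis by (rule that) (simp_all add: \<gamma>_def EL ER)
qed

text \<open>Icons have components at 1-cells only, so no comparison at \<Sigma> is involved.\<close>

lemma gray_icon_eqI:
  assumes \<alpha>: "is_icon \<alpha>" "Dom (iDom \<alpha>) = AB" and \<beta>: "is_icon \<beta>" "iDom \<alpha> = iDom \<beta>" "iCod \<alpha> = iCod \<beta>"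
    and L: "\<And>f b. f \<in> Arr1 A \<Longrightarrow> b \<in> Obj B \<Longrightarrow> icomp \<alpha> (map1 (Lfun A B b) f) = icomp \<beta> (map1 (Lfun A B b) f)"
    and R: "\<And>a g. a \<in> Obj A \<Longrightarrow> g \<in> Arr1 B \<Longrightarrow> icomp \<alpha> (map1 (Rfun A B a) g) = icomp \<beta> (map1 (Rfun A B a) g)"
  shows "\<alpha> = \<beta>"
proof -
  have "icomp \<alpha> x = icomp \<beta> x" if "x \<in> Arr1 AB" for x
    using that
  proof (induction rule: Arr1_gray_induct)
    case (L f b) then show ?case by (rule assms(6))
  next
    case (R a g) then show ?case by (rule assms(7))
  next
    case (comp x y)
    then show ?case using is_icon.icon_comp1[OF \<alpha>(1), of x y] is_icon.icon_comp1[OF \<beta>(1), of x y] assms(2,4)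
      by simp
  qed
  then show ?thesis using assms by (intro icon_eqI) simp_all
qed

end

context infinite_universe
begin

lemma gray_left_icon_eqI:
  fixes A B C :: "'u cat2"
  assumes ABC: "two_category A" "two_category B" "two_category C"
    and \<alpha>: "is_icon \<alpha>" "Dom (iDom \<alpha>) = (A \<otimes> B) \<otimes> C"
    and \<beta>: "is_icon \<beta>" "iDom \<alpha> = iDom \<beta>" "iCod \<alpha> = iCod \<beta>"
    and LL: "\<And>f b c. f \<in> Arr1 A \<Longrightarrow> b \<in> Obj B \<Longrightarrow> c \<in> Obj C \<Longrightarrow>
      icomp \<alpha> (map1 (Lfun (A \<otimes> B) C c) (map1 (Lfun A B b) f))
        = icomp \<beta> (map1 (Lfun (A \<otimes> B) C c) (map1 (Lfun A B b) f))"
    and LR: "\<And>a g c. a \<in> Obj A \<Longrightarrow> g \<in> Arr1 B \<Longrightarrow> c \<in> Obj C \<Longrightarrow>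
      icomp \<alpha> (map1 (Lfun (A \<otimes> B) C c) (map1 (Rfun A B a) g))
        = icomp \<beta> (map1 (Lfun (A \<otimes> B) C c) (map1 (Rfun A B a) g))"
    and R: "\<And>a b h. a \<in> Obj A \<Longrightarrow> b \<in> Obj B \<Longrightarrow> h \<in> Arr1 C \<Longrightarrow>
      icomp \<alpha> (map1 (Rfun (A \<otimes> B) C (opair a b)) h) = icomp \<beta> (map1 (Rfun (A \<otimes> B) C (opair a b)) h)"
  shows "\<alpha> = \<beta>"
proof -
  let ?X = "A \<otimes> B"
  interpret AB: gray_pair A B using ABC(1,2) by (rule gray_pairI)
  interpret XC: gray_pair ?X C using ABC by (intro gray_pairI) simp_all
  note [simp] = ABC
  have L: "icomp \<alpha> (map1 (Lfun ?X C c) x) = icomp \<beta> (map1 (Lfun ?X C c) x)" if "x \<in> Arr1 ?X" "c \<in> Obj C" for x c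
    using that(1)
  proof (induction rule: AB.Arr1_gray_induct)
    case (comp x y)
    then show ?case using \<open>c \<in> Obj C\<close>
      is_icon.icon_comp1[OF \<alpha>(1), of "map1 (Lfun ?X C c) x" "map1 (Lfun ?X C c) y"]
      is_icon.icon_comp1[OF \<beta>(1), of "map1 (Lfun ?X C c) x" "map1 (Lfun ?X C c) y"] \<alpha>(2) \<beta>(2)
      by (simp add: two_functor_maps)
  qed (use that LL LR in simp_all)
  show ?thesis
    by (rule XC.gray_icon_eqI[OF \<alpha> \<beta>]) (auto simp: L R elim!: AB.Obj_grayE)
qed

text \<open>The families to be extended are the whiskerings of \<alpha> by
  \<open>- \<otimes> b\<close> and of \<beta> by \<open>a \<otimes> -\<close> in the
  codomain.\<close>

lemma is_gray_tensor_icon_gray_tensor_icon: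
  fixes \<alpha> \<beta> :: "'u icon2"
  assumes \<alpha> [simp]: "is_icon \<alpha>" and \<beta> [simp]: "is_icon \<beta>"
  shows "is_gray_tensor_icon \<alpha> \<beta> (gray_tensor_icon \<alpha> \<beta>)"
proof -
  let ?A = "Dom (iDom \<alpha>)" and ?B = "Dom (iDom \<beta>)" and ?A' = "Cod (iDom \<alpha>)" and ?B' = "Cod (iDom \<beta>)"
  let ?F = "gray_tensor_fun (iDom \<alpha>) (iDom \<beta>)" and ?G = "gray_tensor_fun (iCod \<alpha>) (iCod \<beta>)"
  let ?D = "?A' \<otimes> ?B'"
  let ?L = "\<lambda>b. hcomp_icon (id_icon (Lfun ?A' ?B' (map0 (iDom \<beta>) b))) \<alpha>"
  let ?R = "\<lambda>a. hcomp_icon (id_icon (Rfun ?A' ?B' (map0 (iDom \<alpha>) a))) \<beta>"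
  interpret AB: gray_pair ?A ?B by (intro gray_pairI) simp_all
  interpret AB': gray_pair ?A' ?B' by (intro gray_pairI) simp_all
  have L: "icomp (?L b) f = map2 (Lfun ?A' ?B' (map0 (iDom \<beta>) b)) (icomp \<alpha> f)" if "f \<in> Arr1 ?A" "b \<in> Obj ?B"
    for f b
    by (rule hcomp_icon_id_icon) (use that in simp_all)
  have R: "icomp (?R a) g = map2 (Rfun ?A' ?B' (map0 (iDom \<alpha>) a)) (icomp \<beta> g)" if "a \<in> Obj ?A" "g \<in> Arr1 ?B"
    for a g
    by (rule hcomp_icon_id_icon) (use that in simp_all)
  obtain \<gamma> where "is_icon \<gamma>" "iDom \<gamma> = ?F" "iCod \<gamma> = ?G"
    "\<And>f b. f \<in> Arr1 ?A \<Longrightarrow> b \<in> Obj ?B \<Longrightarrow> icomp \<gamma> (map1 (Lfun ?A ?B b) f) = icomp (?L b) f"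
    "\<And>a g. a \<in> Obj ?A \<Longrightarrow> g \<in> Arr1 ?B \<Longrightarrow> icomp \<gamma> (map1 (Rfun ?A ?B a) g) = icomp (?R a) g"
  proof (rule AB.icon_extend[of ?F ?D ?G ?L ?R])
    show "map0 ?G = map0 ?F" by (simp add: gray_tensor_fun_def)
    show "is_icon (?L b) \<and> iDom (?L b) = comp_fun ?F (Lfun ?A ?B b) \<and> iCod (?L b) = comp_fun ?G (Lfun ?A ?B b)"
      if "b \<in> Obj ?B" for b
      using that by (auto intro!: two_functor_eqI[where A = ?A])
    show "is_icon (?R a) \<and> iDom (?R a) = comp_fun ?F (Rfun ?A ?B a) \<and> iCod (?R a) = comp_fun ?G (Rfun ?A ?B a)"
      if "a \<in> Obj ?A" for a
      using that by (auto intro!: two_functor_eqI[where A = ?B])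
    \<comment> \<open>This is two-variable naturality of \<Sigma> in the codomain at the component
      2-cells of \<alpha> at f and \<beta> at g.\<close>
    show "vcomp ?D (hcomp ?D (icomp (?R (tgt1 ?A f)) g) (icomp (?L (src1 ?B g)) f)) (map2 ?F (gsig ?A ?B f g)) =
      vcomp ?D (map2 ?G (gsig ?A ?B f g)) (hcomp ?D (icomp (?L (tgt1 ?B g)) f) (icomp (?R (src1 ?A f)) g))"
      if "f \<in> Arr1 ?A" "g \<in> Arr1 ?B" for f g
      using AB'.gray.S_natural[of "icomp \<alpha> f" "icomp \<beta> g"] that by (simp add: L R del: icon_ops_simps)
  qed simp_all
  then have "is_gray_tensor_icon \<alpha> \<beta> \<gamma>" unfolding is_gray_tensor_icon_def Let_def using L R by simp
  then show ?thesis unfolding gray_tensor_icon_def by (rule someI)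
qed

lemma gray_tensor_icon_simps [simp]:
  fixes \<alpha> \<beta> :: "'u icon2"
  assumes "is_icon \<alpha>" "is_icon \<beta>"
  shows "is_icon (gray_tensor_icon \<alpha> \<beta>)"
    "iDom (gray_tensor_icon \<alpha> \<beta>) = gray_tensor_fun (iDom \<alpha>) (iDom \<beta>)"
    "iCod (gray_tensor_icon \<alpha> \<beta>) = gray_tensor_fun (iCod \<alpha>) (iCod \<beta>)"
    "\<lbrakk>Dom (iDom \<alpha>) = A; Dom (iDom \<beta>) = B; f \<in> Arr1 A; b \<in> Obj B\<rbrakk> \<Longrightarrow>
      icomp (gray_tensor_icon \<alpha> \<beta>) (map1 (Lfun A B b) f) =
        map2 (Lfun (Cod (iDom \<alpha>)) (Cod (iDom \<beta>)) (map0 (iDom \<beta>) b)) (icomp \<alpha> f)"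
    "\<lbrakk>Dom (iDom \<alpha>) = A; Dom (iDom \<beta>) = B; a \<in> Obj A; g \<in> Arr1 B\<rbrakk> \<Longrightarrow>
      icomp (gray_tensor_icon \<alpha> \<beta>) (map1 (Rfun A B a) g) =
        map2 (Rfun (Cod (iDom \<alpha>)) (Cod (iDom \<beta>)) (map0 (iDom \<alpha>) a)) (icomp \<beta> g)"
  using is_gray_tensor_icon_gray_tensor_icon[OF assms] unfolding is_gray_tensor_icon_def Let_def by auto

lemma gray_tensor_icon_id_icon:
  fixes F G :: "'u fun2"
  assumes F [simp]: "two_functor F" "two_functor G"
  shows "gray_tensor_icon (id_icon F) (id_icon G) = id_icon (gray_tensor_fun F G)"
proof -
  have [simp]: "two_category (Dom F)" "two_category (Dom G)" "two_category (Cod F)" "two_category (Cod G)"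
    by (intro two_functor.axioms F)+
  interpret gray_pair "Dom F" "Dom G" by (intro gray_pairI) simp_all
  show ?thesis by (rule gray_icon_eqI) (simp_all add: two_functor_maps)
qed

lemma gray_tensor_icon_vcomp_icon:
  fixes \<alpha> \<beta> \<alpha>' \<beta>' :: "'u icon2"
  assumes [simp]: "is_icon \<alpha>" "is_icon \<beta>" "is_icon \<alpha>'" "is_icon \<beta>'" "iDom \<beta> = iCod \<alpha>" "iDom \<beta>' = iCod \<alpha>'"
  shows "gray_tensor_icon (vcomp_icon \<beta> \<alpha>) (vcomp_icon \<beta>' \<alpha>')
    = vcomp_icon (gray_tensor_icon \<beta> \<beta>') (gray_tensor_icon \<alpha> \<alpha>')"
proof -
  interpret gray_pair "Dom (iDom \<alpha>)" "Dom (iDom \<alpha>')" by (intro gray_pairI) simp_all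
  show ?thesis by (rule gray_icon_eqI) (simp_all add: two_functor_maps)
qed

lemma gray_tensor_icon_hcomp_icon:
  fixes \<alpha> \<beta> \<alpha>' \<beta>' :: "'u icon2"
  assumes [simp]: "is_icon \<alpha>" "is_icon \<beta>" "is_icon \<alpha>'" "is_icon \<beta>'"
    "Dom (iDom \<beta>) = Cod (iDom \<alpha>)" "Dom (iDom \<beta>') = Cod (iDom \<alpha>')"
  shows "gray_tensor_icon (hcomp_icon \<beta> \<alpha>) (hcomp_icon \<beta>' \<alpha>')
    = hcomp_icon (gray_tensor_icon \<beta> \<beta>') (gray_tensor_icon \<alpha> \<alpha>')"
proof -
  interpret gray_pair "Dom (iDom \<alpha>)" "Dom (iDom \<alpha>')" by (intro gray_pairI) simp_all
  show ?thesis by (rule gray_icon_eqI) (simp_all add: two_functor_maps gray_tensor_fun_comp_fun)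
qed

lemma gray_assoc_icon_natural:
  fixes \<alpha> \<beta> \<gamma> :: "'u icon2"
  assumes [simp]: "is_icon \<alpha>" "is_icon \<beta>" "is_icon \<gamma>"
  shows "hcomp_icon (gray_tensor_icon \<alpha> (gray_tensor_icon \<beta> \<gamma>)) (id_icon (gray_assoc (Dom (iDom \<alpha>)) (Dom (iDom \<beta>)) (Dom (iDom \<gamma>)))) =
    hcomp_icon (id_icon (gray_assoc (Cod (iDom \<alpha>)) (Cod (iDom \<beta>)) (Cod (iDom \<gamma>)))) (gray_tensor_icon (gray_tensor_icon \<alpha> \<beta>) \<gamma>)"
proof -
  \<comment> \<open>Equality of icons includes equality of their target 2-functors; here that is
    naturality of the associator at the targets of \<alpha>, \<beta> and \<gamma>.\<close>
  have 1: "comp_fun (gray_assoc (Cod (iCod \<alpha>)) (Cod (iCod \<beta>)) (Cod (iCod \<gamma>))) (gray_tensor_fun (gray_tensor_fun (iCod \<alpha>) (iCod \<beta>)) (iCod \<gamma>)) =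
    comp_fun (gray_tensor_fun (iCod \<alpha>) (gray_tensor_fun (iCod \<beta>) (iCod \<gamma>))) (gray_assoc (Dom (iCod \<alpha>)) (Dom (iCod \<beta>)) (Dom (iCod \<gamma>)))"
    by (rule gray_assoc_natural) simp_all
  show ?thesis
    by (rule gray_left_icon_eqI[of "Dom (iDom \<alpha>)" "Dom (iDom \<beta>)" "Dom (iDom \<gamma>)"])
      (use 1 in \<open>simp_all add: gray_assoc_natural hcomp_icon_id_icon hcomp_icon_id_icon_right two_functor_maps del: icon_ops_simps(9)\<close>)
qed

text \<open>On generators from A the two sides agree at once. Those from the terminal factor become
  identities, where \<open>icon_id1\<close> makes the component of \<alpha> an identity.\<close>

lemma gray_lunit_icon_natural:
  fixes \<alpha> :: "'u icon2"
  assumes [simp]: "is_icon \<alpha>"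
  shows "hcomp_icon \<alpha> (id_icon (gray_lunit (Dom (iDom \<alpha>)))) =
    hcomp_icon (id_icon (gray_lunit (Cod (iDom \<alpha>)))) (gray_tensor_icon (id_icon (id_fun \<one>)) \<alpha>)"
proof -
  interpret \<alpha>: is_icon \<alpha> by simp
  interpret gray_pair \<one> "Dom (iDom \<alpha>)" by (intro gray_pairI) simp_all
  have 1: "comp_fun (iCod \<alpha>) (gray_lunit (Dom (iCod \<alpha>))) =
      comp_fun (gray_lunit (Cod (iCod \<alpha>))) (gray_tensor_fun (id_fun \<one>) (iCod \<alpha>))"
    by (rule gray_lunit_natural) simp
  show ?thesis
    by (rule gray_icon_eqI)
      (use 1 in \<open>auto simp: gray_lunit_natural hcomp_icon_id_icon hcomp_icon_id_icon_right two_functor_maps \<alpha>.icon_id1 simp del: icon_ops_simps(9)\<close>)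
qed

lemma gray_runit_icon_natural:
  fixes \<alpha> :: "'u icon2"
  assumes [simp]: "is_icon \<alpha>"
  shows "hcomp_icon \<alpha> (id_icon (gray_runit (Dom (iDom \<alpha>)))) =
    hcomp_icon (id_icon (gray_runit (Cod (iDom \<alpha>)))) (gray_tensor_icon \<alpha> (id_icon (id_fun \<one>)))"
proof -
  interpret \<alpha>: is_icon \<alpha> by simp
  interpret gray_pair "Dom (iDom \<alpha>)" \<one> by (intro gray_pairI) simp_all
  have 1: "comp_fun (iCod \<alpha>) (gray_runit (Dom (iCod \<alpha>))) =
      comp_fun (gray_runit (Cod (iCod \<alpha>))) (gray_tensor_fun (iCod \<alpha>) (id_fun \<one>))"
    by (rule gray_runit_natural) simp
  show ?thesis
    by (rule gray_icon_eqI)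
      (use 1 in \<open>auto simp: gray_runit_natural hcomp_icon_id_icon hcomp_icon_id_icon_right two_functor_maps \<alpha>.icon_id1 simp del: icon_ops_simps(9)\<close>)
qed

end

section \<open>Products of 2-categories and 2-natural isomorphisms\<close>

lemma prod_twocat_simps [simp]:
  "Obj (prod_twocat A B) = Obj A \<times> Obj B" "Arr1 (prod_twocat A B) = Arr1 A \<times> Arr1 B" "Arr2 (prod_twocat A B)
    = Arr2 A \<times> Arr2 B"
  "src1 (prod_twocat A B) = map_prod (src1 A) (src1 B)" "tgt1 (prod_twocat A B) = map_prod (tgt1 A) (tgt1 B)"
  "src2 (prod_twocat A B) = map_prod (src2 A) (src2 B)" "tgt2 (prod_twocat A B) = map_prod (tgt2 A) (tgt2 B)"
  "id1 (prod_twocat A B) = map_prod (id1 A) (id1 B)" "id2 (prod_twocat A B) = map_prod (id2 A) (id2 B)"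
  "comp1 (prod_twocat A B) (f, g) (f', g') = (comp1 A f f', comp1 B g g')"
  "vcomp (prod_twocat A B) (\<alpha>, \<beta>) (\<alpha>', \<beta>') = (vcomp A \<alpha> \<alpha>', vcomp B \<beta> \<beta>')"
  "hcomp (prod_twocat A B) (\<alpha>, \<beta>) (\<alpha>', \<beta>') = (hcomp A \<alpha> \<alpha>', hcomp B \<beta> \<beta>')"
  by (simp_all add: prod_twocat_def)

lemma two_category_prod_twocat [simp]:
  assumes "two_category A" "two_category B"
  shows "two_category (prod_twocat A B)"
proof -
  interpret A: two_category A by fact
  interpret B: two_category B by fact
  show ?thesis
    by standard (auto simp: A.comp1_assoc B.comp1_assoc A.vcomp_assoc B.vcomp_assoc A.hcomp_assoc B.hcomp_assoc
        A.hcomp_id2 B.hcomp_id2 A.interchange B.interchange)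
qed

lemma proj_fun_simps [simp]:
  "Dom (fst_fun A B) = prod_twocat A B" "Cod (fst_fun A B) = A"
  "Dom (snd_fun A B) = prod_twocat A B" "Cod (snd_fun A B) = B"
  "x \<in> Obj A \<Longrightarrow> y \<in> Obj B \<Longrightarrow> map0 (fst_fun A B) (x, y) = x"
  "f \<in> Arr1 A \<Longrightarrow> g \<in> Arr1 B \<Longrightarrow> map1 (fst_fun A B) (f, g) = f"
  "\<alpha> \<in> Arr2 A \<Longrightarrow> \<beta> \<in> Arr2 B \<Longrightarrow> map2 (fst_fun A B) (\<alpha>, \<beta>) = \<alpha>"
  "x \<in> Obj A \<Longrightarrow> y \<in> Obj B \<Longrightarrow> map0 (snd_fun A B) (x, y) = y"
  "f \<in> Arr1 A \<Longrightarrow> g \<in> Arr1 B \<Longrightarrow> map1 (snd_fun A B) (f, g) = g"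
  "\<alpha> \<in> Arr2 A \<Longrightarrow> \<beta> \<in> Arr2 B \<Longrightarrow> map2 (snd_fun A B) (\<alpha>, \<beta>) = \<beta>"
  by (simp_all add: fst_fun_def snd_fun_def)

lemma pair_fun_simps [simp]:
  "Dom (pair_fun F G) = Dom F" "Cod (pair_fun F G) = prod_twocat (Cod F) (Cod G)"
  "x \<in> Obj (Dom F) \<Longrightarrow> map0 (pair_fun F G) x = (map0 F x, map0 G x)"
  "f \<in> Arr1 (Dom F) \<Longrightarrow> map1 (pair_fun F G) f = (map1 F f, map1 G f)"
  "\<alpha> \<in> Arr2 (Dom F) \<Longrightarrow> map2 (pair_fun F G) \<alpha> = (map2 F \<alpha>, map2 G \<alpha>)"
  by (simp_all add: pair_fun_def)

lemma two_functor_proj_fun [simp]: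
  assumes "two_category A" "two_category B"
  shows "two_functor (fst_fun A B)" "two_functor (snd_fun A B)"
proof -
  interpret A: two_category A by fact
  interpret B: two_category B by fact
  show "two_functor (fst_fun A B)"
    by (intro two_functor.intro two_functor_axioms.intro) (use assms in \<open>auto simp: fst_fun_def\<close>)
  show "two_functor (snd_fun A B)"
    by (intro two_functor.intro two_functor_axioms.intro) (use assms in \<open>auto simp: snd_fun_def\<close>)
qed

lemma two_functor_pair_fun [simp]:
  assumes F: "two_functor F" and G: "two_functor G" and "Dom G = Dom F"
  shows "two_functor (pair_fun F G)"
proof -
  interpret F: two_functor F by fact
  interpret G: two_functor G by fact
  interpret A: two_category "Dom F" by (rule F.A.two_category_axioms)
  show ?thesis
    by (intro two_functor.intro two_functor_axioms.intro)
      (use assms F.A.two_category_axioms F.B.two_category_axioms G.B.two_category_axioms in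
        \<open>auto simp: two_functor_maps\<close>, auto simp: pair_fun_def)
qed

text \<open>Componentwise inverses of a 2-natural transformation are automatically 2-natural:
  conjugating each naturality square by them gives the inverse square, for 1-cells and for
  2-cells.\<close>

lemma two_natural_isoI:
  assumes \<tau>: "two_natural F G \<tau>"
    and \<sigma>: "\<And>x. x \<in> Obj (Dom F) \<Longrightarrow> \<sigma> x \<in> Arr1 (Cod F) \<and> src1 (Cod F) (\<sigma> x) = map0 G x \<and> tgt1 (Cod F) (\<sigma> x)
      = map0 F x"
    and inv: "\<And>x. x \<in> Obj (Dom F) \<Longrightarrow> comp1 (Cod F) (\<sigma> x) (\<tau> x) = id1 (Cod F) (map0 F x)"
      "\<And>x. x \<in> Obj (Dom F) \<Longrightarrow> comp1 (Cod F) (\<tau> x) (\<sigma> x) = id1 (Cod F) (map0 G x)"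
  shows "two_natural_iso F G \<tau>"
proof -
  interpret two_natural F G \<tau> by fact
  let ?A = "Dom F" and ?C = "Cod F"
  note [simp] = same_Dom same_Cod F.two_functor_axioms G.two_functor_axioms
  have \<sigma>' [simp]: "\<sigma> x \<in> Arr1 ?C" "src1 ?C (\<sigma> x) = map0 G x" "tgt1 ?C (\<sigma> x) = map0 F x" if "x \<in> Obj ?A" for x
    using \<sigma>[OF that] by auto
  have \<tau>' [simp]: "\<tau> x \<in> Arr1 ?C" "src1 ?C (\<tau> x) = map0 F x" "tgt1 ?C (\<tau> x) = map0 G x" if "x \<in> Obj ?A" for x
    using component[OF that] by auto
  have n1: "comp1 ?C (map1 F f) (\<sigma> (src1 ?A f)) = comp1 ?C (\<sigma> (tgt1 ?A f)) (map1 G f)" if [simp]: "f \<in> Arr1 ?A"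
    for f
  proof -
    let ?x = "src1 ?A f" and ?y = "tgt1 ?A f"
    have "comp1 ?C (map1 F f) (\<sigma> ?x) = comp1 ?C (comp1 ?C (\<sigma> ?y) (\<tau> ?y)) (comp1 ?C (map1 F f) (\<sigma> ?x))"
      by (simp add: inv)
    also have "\<dots> = comp1 ?C (\<sigma> ?y) (comp1 ?C (comp1 ?C (\<tau> ?y) (map1 F f)) (\<sigma> ?x))"
      by (simp add: F.B.comp1_assoc del: F.B.comp1_id1_left')
    also have "\<dots> = comp1 ?C (\<sigma> ?y) (comp1 ?C (map1 G f) (comp1 ?C (\<tau> ?x) (\<sigma> ?x)))"
      by (simp add: F.B.comp1_assoc flip: natural1)
    also have "\<dots> = comp1 ?C (\<sigma> ?y) (map1 G f)" by (simp add: inv)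
    finally show ?thesis .
  qed
  have n2: "hcomp ?C (map2 F \<theta>) (id2 ?C (\<sigma> (src1 ?A (src2 ?A \<theta>))))
    = hcomp ?C (id2 ?C (\<sigma> (tgt1 ?A (src2 ?A \<theta>)))) (map2 G \<theta>)"
    if [simp]: "\<theta> \<in> Arr2 ?A" for \<theta>
  proof -
    let ?x = "src1 ?A (src2 ?A \<theta>)" and ?y = "tgt1 ?A (src2 ?A \<theta>)"
    have inv2: "hcomp ?C (id2 ?C (\<sigma> z)) (id2 ?C (\<tau> z)) = id2 ?C (id1 ?C (map0 F z))"
       "hcomp ?C (id2 ?C (\<tau> z)) (id2 ?C (\<sigma> z)) = id2 ?C (id1 ?C (map0 G z))" if "z \<in> Obj ?A" for z
      using that by (simp_all add: F.B.hcomp_id2 inv)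
    have "hcomp ?C (map2 F \<theta>) (id2 ?C (\<sigma> ?x))
      = hcomp ?C (hcomp ?C (id2 ?C (\<sigma> ?y)) (id2 ?C (\<tau> ?y))) (hcomp ?C (map2 F \<theta>) (id2 ?C (\<sigma> ?x)))"
      by (simp add: inv2)
    also have "\<dots> = hcomp ?C (id2 ?C (\<sigma> ?y)) (hcomp ?C (hcomp ?C (id2 ?C (\<tau> ?y)) (map2 F \<theta>)) (id2 ?C (\<sigma> ?x)))"
      by (simp add: F.B.hcomp_assoc)
    also have "\<dots> = hcomp ?C (id2 ?C (\<sigma> ?y)) (hcomp ?C (map2 G \<theta>) (hcomp ?C (id2 ?C (\<tau> ?x)) (id2 ?C (\<sigma> ?x))))"
      by (simp add: F.B.hcomp_assoc flip: natural2)
    also have "\<dots> = hcomp ?C (id2 ?C (\<sigma> ?y)) (map2 G \<theta>)" by (simp add: inv2)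
    finally show ?thesis .
  qed
  have "two_natural G F \<sigma>"
    by (intro two_natural.intro two_natural_axioms.intro) (simp_all add: n1 n2)
  then show ?thesis unfolding two_natural_iso_def using \<tau> inv by auto
qed

section \<open>The monoidal structure\<close>

definition gray_functor :: "('u cat2 \<times> 'u cat2, 'u fun2 \<times> 'u fun2, 'u icon2 \<times> 'u icon2, 'u cat2, 'u fun2, 'u icon2) twofun" where
  "gray_functor = \<lparr>Dom = prod_twocat gray_icon gray_icon, Cod = gray_icon,
     map0 = (\<lambda>(A, B)\<in>Obj gray_icon \<times> Obj gray_icon. A \<otimes> B),
     map1 = (\<lambda>(F, G)\<in>Arr1 gray_icon \<times> Arr1 gray_icon. gray_tensor_fun F G),
     map2 = (\<lambda>(\<alpha>, \<beta>)\<in>Arr2 gray_icon \<times> Arr2 gray_icon. gray_tensor_icon \<alpha> \<beta>)\<rparr>"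

lemma gray_functor_simps [simp]:
  "Dom gray_functor = prod_twocat gray_icon gray_icon" "Cod gray_functor = gray_icon"
  "A \<in> Obj gray_icon \<Longrightarrow> B \<in> Obj gray_icon \<Longrightarrow> map0 gray_functor (A, B) = A \<otimes> B"
  "F \<in> Arr1 gray_icon \<Longrightarrow> G \<in> Arr1 gray_icon \<Longrightarrow> map1 gray_functor (F, G) = gray_tensor_fun F G"
  "\<alpha> \<in> Arr2 gray_icon \<Longrightarrow> \<beta> \<in> Arr2 gray_icon \<Longrightarrow> map2 gray_functor (\<alpha>, \<beta>) = gray_tensor_icon \<alpha> \<beta>"
  by (simp_all add: gray_functor_def)

context infinite_universe
begin

lemma restrict_gray_tensor [simp]:
  "two_category A \<Longrightarrow> two_category B \<Longrightarrow> restrict_twocat (A \<otimes> B) = A \<otimes> B" for A B :: "'u cat2"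
  by (intro gray_pair.restrict_gray gray_pairI)

lemma two_functor_gray_functor:
  "two_functor (gray_functor :: (_, _, _, 'u cat2, 'u fun2, 'u icon2) twofun)"
  (is "two_functor ?T")
proof (intro two_functor.intro two_functor_axioms.intro)
  show "map0 ?T \<in> Obj (Dom ?T) \<rightarrow>\<^sub>E Obj (Cod ?T)" "map1 ?T \<in> Arr1 (Dom ?T) \<rightarrow>\<^sub>E Arr1 (Cod ?T)"
    "map2 ?T \<in> Arr2 (Dom ?T) \<rightarrow>\<^sub>E Arr2 (Cod ?T)"
    by (auto simp: gray_functor_def)
qed (auto simp: two_category_gray_icon gray_tensor_fun_id gray_tensor_fun_comp_fun gray_tensor_icon_id_icon
    gray_tensor_icon_vcomp_icon gray_tensor_icon_hcomp_icon)

text \<open>After unfolding the product 2-functors, 2-naturality at 1-cells is naturality of the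
  associator in 2-functors, and at 2-cells its naturality in icons.\<close>

lemma gray_associator:
  fixes V defines "V \<equiv> gray_icon :: ('u cat2, 'u fun2, 'u icon2) twocat"
  shows "two_natural_iso
    (comp_fun gray_functor (prod_fun gray_functor (id_fun V)))
    (comp_fun gray_functor (comp_fun (prod_fun (id_fun V) gray_functor) (assoc_fun V V V)))
    (\<lambda>((A, B), C). gray_assoc A B C)" (is "two_natural_iso ?F ?G ?\<tau>")
proof (rule two_natural_isoI[where \<sigma> = "\<lambda>((A, B), C). gray_assoc_inv A B C"])
  note [simp] = two_category_gray_icon two_functor_gray_functor
  have F: "two_functor ?F" by (simp add: prod_fun_def V_def)
  have G: "two_functor ?G" by (simp add: prod_fun_def assoc_fun_def Let_def V_def)
  show "two_natural ?F ?G ?\<tau>"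
    by (intro two_natural.intro two_natural_axioms.intro F G)
      (auto simp: prod_fun_def assoc_fun_def Let_def V_def gray_assoc_natural gray_assoc_icon_natural)
qed (auto simp: prod_fun_def assoc_fun_def Let_def V_def two_category_gray_icon two_functor_gray_functor gray_assoc_inverse)

text \<open>The constant 2-functor at the unit contributes the identity icon on the identity of the
  terminal 2-category, which is the form in which naturality of the unitor in icons was
  proved.\<close>

lemma gray_left_unitor:
  fixes V defines "V \<equiv> gray_icon :: ('u cat2, 'u fun2, 'u icon2) twocat"
  shows "two_natural_iso
    (comp_fun gray_functor (pair_fun (const_fun V V \<one>) (id_fun V))) (id_fun V) gray_lunit"
    (is "two_natural_iso ?F ?G ?\<tau>")
proof (rule two_natural_isoI[where \<sigma> = "\<lambda>A. Rfun \<one> A (code ())"])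
  note [simp] = two_category_gray_icon two_functor_gray_functor restrict_terminal
  have F: "two_functor ?F" by (simp add: V_def)
  have G: "two_functor ?G" by (simp add: V_def)
  show "two_natural ?F ?G ?\<tau>"
    by (intro two_natural.intro two_natural_axioms.intro F G)
      (auto simp: V_def gray_lunit_natural gray_lunit_icon_natural)
qed (auto simp: V_def restrict_terminal gray_lunit_inverse)

lemma gray_right_unitor:
  fixes V defines "V \<equiv> gray_icon :: ('u cat2, 'u fun2, 'u icon2) twocat"
  shows "two_natural_iso
    (comp_fun gray_functor (pair_fun (id_fun V) (const_fun V V \<one>))) (id_fun V) gray_runit"
    (is "two_natural_iso ?F ?G ?\<tau>")
proof (rule two_natural_isoI[where \<sigma> = gray_runit_inv])
  note [simp] = two_category_gray_icon two_functor_gray_functor restrict_terminal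
  have F: "two_functor ?F" by (simp add: V_def)
  have G: "two_functor ?G" by (simp add: V_def)
  show "two_natural ?F ?G ?\<tau>"
    by (intro two_natural.intro two_natural_axioms.intro F G)
      (auto simp: V_def gray_runit_natural gray_runit_icon_natural)
qed (auto simp: V_def restrict_terminal gray_runit_inverse)

lemma strongly_monoidal_gray_icon:
  "strongly_monoidal_two_category (gray_icon :: ('u cat2, 'u fun2, 'u icon2) twocat)
     gray_functor \<one> gray_assoc gray_lunit gray_runit"
  by (intro strongly_monoidal_two_category.intro strongly_monoidal_two_category_axioms.intro
      two_category_gray_icon two_functor_gray_functor gray_associator gray_left_unitor gray_right_unitor)
    (simp_all add: restrict_terminal gray_pentagon gray_triangle)

end

theorem proposition3p7:
  assumes "infinite (UNIV :: 'u set)"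
  shows "\<exists>T a l r.
    strongly_monoidal_two_category (gray_icon :: ('u cat2, 'u fun2, 'u icon2) twocat)
      T terminal_twocat a l r \<and>
    (\<forall>A\<in>Obj gray_icon. \<forall>B\<in>Obj gray_icon. map0 T (A, B) = gray_tensor A B) \<and>
    (\<forall>F\<in>Arr1 gray_icon. \<forall>G\<in>Arr1 gray_icon. map1 T (F, G) = gray_tensor_fun F G)"
proof -
  interpret infinite_universe "TYPE('u)" using assms by unfold_locales
  show ?thesis
    by (rule exI[of _ gray_functor], rule exI[of _ gray_assoc], rule exI[of _ gray_lunit],
        rule exI[of _ gray_runit]) (simp add: strongly_monoidal_gray_icon del: gray_icon_simps)
qed

end
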